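(* Let $p>5$ be a prime and let $Q$ be a connected quandle of size $4p$. The following are equivalent: (i) $Q$ is subdirectly reducible. (ii) $Q\cong \mathrm{Aff}(\mathbb{Z}_2^2,f)\times \mathrm{Aff}(\mathbb{Z}_p,g)$ where $f\in\mathrm{Aut}(\mathbb{Z}_2^2)$ has order $3$ and $g\in\mathrm{Aut}(\mathbb{Z}_p)$. In particular there are $p-2$ such quandles up to isomorphism.
   Context: A quandle is a set $Q$ with a binary operation $*$ such that every left translation $L_a:b\mapsto a*b$ is a bijection, $a*(b*c)=(a*b)*(a*c)$ and $a*a=a$. $Q$ is connected if the group generated by all $L_a$ is transitive on $Q$. Congruences are equivalence relations compatible with $*$ and left division; $0_Q$ is equality. $Q$ is subdirectly irreducible if the intersection of all congruences different from $0_Q$ is different from $0_Q$, and subdirectly reducible otherwise. For an abelian group $A$ and $f\in\mathrm{Aut}(A)$, $\mathrm{Aff}(A,f)$ is the quandle on $A$ with $a*b=a+f(b-a)$. (Up to isomorphism $\mathrm{Aff}(\mathbb{Z}_2^2,f)$ with $f$ of order $3$ is the unique connected quandle of size $4$.) *)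

theory Defs
  imports "HOL-Algebra.Algebra" "HOL-Computational_Algebra.Primes"
begin

record 'a quandle = "'a partial_object" +
  qop :: "'a \<Rightarrow> 'a \<Rightarrow> 'a"  (infixr \<open>\<triangleright>\<index>\<close> 70)

locale quandle =
  fixes Q (structure)
  assumes left_translation_bij:
      "a \<in> carrier Q \<Longrightarrow> bij_betw (\<lambda>b. a \<triangleright> b) (carrier Q) (carrier Q)"
    and left_distrib:
      "\<lbrakk>a \<in> carrier Q; b \<in> carrier Q; c \<in> carrier Q\<rbrakk>
        \<Longrightarrow> a \<triangleright> (b \<triangleright> c) = (a \<triangleright> b) \<triangleright> (a \<triangleright> c)"
    and idem: "a \<in> carrier Q \<Longrightarrow> a \<triangleright> a = a"

definition left_translation :: "('a, 'b) quandle_scheme \<Rightarrow> 'a \<Rightarrow> 'a \<Rightarrow> 'a"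
  where "left_translation Q a = (\<lambda>b\<in>carrier Q. a \<triangleright>\<^bsub>Q\<^esub> b)"

definition left_mult_group :: "('a, 'b) quandle_scheme \<Rightarrow> ('a \<Rightarrow> 'a) set"
  where "left_mult_group Q =
    generate (BijGroup (carrier Q)) (left_translation Q ` carrier Q)"

locale connected_quandle = quandle +
  assumes transitive:
    "\<lbrakk>a \<in> carrier Q; b \<in> carrier Q\<rbrakk> \<Longrightarrow> \<exists>h\<in>left_mult_group Q. h a = b"

text \<open>Left division: \<open>left_div Q a b\<close> is the unique \<open>c \<in> carrier Q\<close> with
  \<open>a \<triangleright> c = b\<close>.\<close>

definition left_div :: "('a, 'b) quandle_scheme \<Rightarrow> 'a \<Rightarrow> 'a \<Rightarrow> 'a"
  where "left_div Q a b = inv_into (carrier Q) (\<lambda>c. a \<triangleright>\<^bsub>Q\<^esub> c) b"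

definition quandle_congruence :: "('a, 'b) quandle_scheme \<Rightarrow> ('a \<times> 'a) set \<Rightarrow> bool"
  where "quandle_congruence Q r \<longleftrightarrow>
    equiv (carrier Q) r \<and>
    (\<forall>(a, a')\<in>r. \<forall>(b, b')\<in>r.
      (a \<triangleright>\<^bsub>Q\<^esub> b, a' \<triangleright>\<^bsub>Q\<^esub> b') \<in> r \<and> (left_div Q a b, left_div Q a' b') \<in> r)"

text \<open>The intersection of congruences is taken inside \<open>carrier Q \<times> carrier Q\<close>, so that an empty
  intersection is the full relation on the carrier and not \<open>UNIV\<close>.\<close>

definition subdirectly_irreducible :: "('a, 'b) quandle_scheme \<Rightarrow> bool"
  where "subdirectly_irreducible Q \<longleftrightarrow>
    (carrier Q \<times> carrier Q) \<inter> \<Inter>{r. quandle_congruence Q r \<and> r \<noteq> Id_on (carrier Q)}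
      \<noteq> Id_on (carrier Q)"

abbreviation subdirectly_reducible :: "('a, 'b) quandle_scheme \<Rightarrow> bool"
  where "subdirectly_reducible Q \<equiv> \<not> subdirectly_irreducible Q"

definition Aff :: "('a, 'b) monoid_scheme \<Rightarrow> ('a \<Rightarrow> 'a) \<Rightarrow> 'a quandle"
  where "Aff A f =
    \<lparr>carrier = carrier A, qop = (\<lambda>a b. a \<otimes>\<^bsub>A\<^esub> f (b \<otimes>\<^bsub>A\<^esub> inv\<^bsub>A\<^esub> a))\<rparr>"

definition quandle_prod ::
    "('a, 'c) quandle_scheme \<Rightarrow> ('b, 'd) quandle_scheme \<Rightarrow> ('a \<times> 'b) quandle"
  where "quandle_prod Q R =
    \<lparr>carrier = carrier Q \<times> carrier R,
     qop = (\<lambda>(a, b) (a', b'). (a \<triangleright>\<^bsub>Q\<^esub> a', b \<triangleright>\<^bsub>R\<^esub> b'))\<rparr>"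

definition quandle_iso ::
    "('a, 'c) quandle_scheme \<Rightarrow> ('b, 'd) quandle_scheme \<Rightarrow> ('a \<Rightarrow> 'b) set"
  where "quandle_iso Q R =
    {h. bij_betw h (carrier Q) (carrier R) \<and>
        (\<forall>a\<in>carrier Q. \<forall>b\<in>carrier Q. h (a \<triangleright>\<^bsub>Q\<^esub> b) = h a \<triangleright>\<^bsub>R\<^esub> h b)}"

definition quandle_isomorphic ::
    "('a, 'c) quandle_scheme \<Rightarrow> ('b, 'd) quandle_scheme \<Rightarrow> bool"
  where "quandle_isomorphic Q R \<longleftrightarrow> quandle_iso Q R \<noteq> {}"

text \<open>The quotient of a class \<open>K\<close> of quandles by isomorphism; by the lemma
  \<open>quandle_isomorphism_equiv\<close> below this is a quotient by an equivalence relation.\<close>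

definition isomorphism_classes :: "'a quandle set \<Rightarrow> 'a quandle set set"
  where "isomorphism_classes K = K // {(Q, R). Q \<in> K \<and> R \<in> K \<and> quandle_isomorphic Q R}"

abbreviation Z2_squared :: "(int \<times> int) monoid"
  where "Z2_squared \<equiv> integer_mod_group 2 \<times>\<times> integer_mod_group 2"

lemma (in quandle) qop_closed:
  "\<lbrakk>a \<in> carrier Q; b \<in> carrier Q\<rbrakk> \<Longrightarrow> a \<triangleright> b \<in> carrier Q"
  using left_translation_bij[of a] by (auto simp: bij_betw_def)

lemma quandle_isomorphic_refl: "quandle_isomorphic Q Q"
proof -
  have "id \<in> quandle_iso Q Q"
    by (simp add: quandle_iso_def)
  then show ?thesis
    unfolding quandle_isomorphic_def by blast
qed

lemma quandle_isomorphic_sym: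
  assumes "quandle Q" "quandle_isomorphic Q R"
  shows "quandle_isomorphic R Q"
proof -
  interpret quandle Q by fact
  obtain h where bij: "bij_betw h (carrier Q) (carrier R)"
    and hom: "\<And>a b. \<lbrakk>a \<in> carrier Q; b \<in> carrier Q\<rbrakk> \<Longrightarrow> h (a \<triangleright>\<^bsub>Q\<^esub> b) = h a \<triangleright>\<^bsub>R\<^esub> h b"
    using assms(2) unfolding quandle_isomorphic_def quandle_iso_def by blast
  let ?k = "inv_into (carrier Q) h"
  have "?k (a \<triangleright>\<^bsub>R\<^esub> b) = ?k a \<triangleright>\<^bsub>Q\<^esub> ?k b" if "a \<in> carrier R" "b \<in> carrier R" for a b
  proof -
    have mem: "?k a \<in> carrier Q" "?k b \<in> carrier Q"
      using that bij bij_betw_inv_into bij_betwE by blast+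
    have "h (?k a \<triangleright>\<^bsub>Q\<^esub> ?k b) = a \<triangleright>\<^bsub>R\<^esub> b"
      using hom[OF mem] that bij bij_betw_inv_into_right by metis
    then show ?thesis
      using qop_closed[OF mem] bij bij_betw_inv_into_left by metis
  qed
  then have "?k \<in> quandle_iso R Q"
    by (simp add: quandle_iso_def bij bij_betw_inv_into)
  then show ?thesis
    unfolding quandle_isomorphic_def by blast
qed

lemma quandle_isomorphic_trans:
  assumes "quandle_isomorphic Q R" "quandle_isomorphic R S"
  shows "quandle_isomorphic Q S"
proof -
  obtain h k where h: "h \<in> quandle_iso Q R" and k: "k \<in> quandle_iso R S"
    using assms unfolding quandle_isomorphic_def by blast
  have "h a \<in> carrier R" if "a \<in> carrier Q" for a
    using h that by (auto simp: quandle_iso_def bij_betw_def)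
  then have "k \<circ> h \<in> quandle_iso Q S"
    using h k by (auto simp: quandle_iso_def intro: bij_betw_trans)
  then show ?thesis
    unfolding quandle_isomorphic_def by blast
qed

lemma quandle_isomorphism_equiv:
  assumes "\<And>Q. Q \<in> K \<Longrightarrow> quandle Q"
  shows "equiv K {(Q, R). Q \<in> K \<and> R \<in> K \<and> quandle_isomorphic Q R}"
proof (intro equivI refl_onI symI transI)
  fix Q R S
  assume "(Q, R) \<in> {(Q, R). Q \<in> K \<and> R \<in> K \<and> quandle_isomorphic Q R}"
    and "(R, S) \<in> {(Q, R). Q \<in> K \<and> R \<in> K \<and> quandle_isomorphic Q R}"
  then show "(Q, S) \<in> {(Q, R). Q \<in> K \<and> R \<in> K \<and> quandle_isomorphic Q R}"
    using quandle_isomorphic_trans by blast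
next
  fix Q R
  assume "(Q, R) \<in> {(Q, R). Q \<in> K \<and> R \<in> K \<and> quandle_isomorphic Q R}"
  then show "(R, Q) \<in> {(Q, R). Q \<in> K \<and> R \<in> K \<and> quandle_isomorphic Q R}"
    using assms quandle_isomorphic_sym by blast
qed (auto simp: quandle_isomorphic_refl)

text \<open>Every finite quandle is isomorphic to one whose elements are natural numbers, so
  isomorphism classes of finite quandles can be counted on the type \<open>nat quandle\<close>.\<close>

lemma finite_quandle_nat_copy:
  assumes "quandle Q" "finite (carrier Q)"
  shows "\<exists>R :: nat quandle. quandle R \<and> quandle_isomorphic Q R"
proof -
  interpret quandle Q by fact
  obtain h :: "'a \<Rightarrow> nat" where h: "bij_betw h (carrier Q) {0..<card (carrier Q)}"
    using assms(2) ex_bij_betw_finite_nat by blast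
  define N where "N = {0..<card (carrier Q)}"
  define k where "k = inv_into (carrier Q) h"
  define R where "R = \<lparr>carrier = N, qop = (\<lambda>m n. h (k m \<triangleright>\<^bsub>Q\<^esub> k n))\<rparr>"
  have hN: "bij_betw h (carrier Q) N" and kN: "bij_betw k N (carrier Q)"
    using h bij_betw_inv_into by (auto simp: N_def k_def)
  have kh: "k (h a) = a" if "a \<in> carrier Q" for a
    using that hN bij_betw_inv_into_left unfolding k_def by metis
  have hk: "h (k n) = n" if "n \<in> N" for n
    using that hN bij_betw_inv_into_right unfolding k_def by metis
  have kmem: "k n \<in> carrier Q" if "n \<in> N" for n
    using that kN bij_betwE by blast
  have "quandle R"
  proof
    fix a assume "a \<in> carrier R"
    then have a: "k a \<in> carrier Q"
      by (simp add: R_def kmem)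
    have "bij_betw (h \<circ> ((\<lambda>b. k a \<triangleright>\<^bsub>Q\<^esub> b) \<circ> k)) N N"
      by (intro bij_betw_trans[OF _ hN] bij_betw_trans[OF kN] left_translation_bij a)
    then show "bij_betw (\<lambda>b. a \<triangleright>\<^bsub>R\<^esub> b) (carrier R) (carrier R)"
      by (simp add: R_def comp_def)
  qed (auto simp: R_def kh hk kmem qop_closed left_distrib[symmetric] idem)
  moreover have "h \<in> quandle_iso Q R"
    using hN by (simp add: quandle_iso_def R_def kh)
  ultimately show ?thesis
    unfolding quandle_isomorphic_def by blast
qed

end

theory Submission
  imports Defs "Jordan_Normal_Form.Schur_Decomposition" "HOL-Combinatorics.Permutations"
begin

text \<open>
  A connected quandle \<open>Q\<close> of prime size \<open>p\<close> is affine. Its left translations form a conjugacy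
  class of size \<open>p\<close> in the group they generate, and for an irreducible character \<open>\<chi>\<close> the class
  sum acts by \<open>p \<tau>\<close>, where \<open>\<tau> = \<chi>(L a)/\<chi>(1)\<close>. As in Burnside's theorem on classes of prime
  power size, \<open>\<tau>\<close> is \<open>0\<close> or of modulus \<open>1\<close> unless \<open>p\<close> divides \<open>\<chi>(1)\<close>, in which case \<open>\<chi>\<close>
  vanishes on the elements of order \<open>p\<close>. Counting the quotients of class elements by traces, one
  finds that the displacement group has order \<open>p\<close>, hence acts regularly, and \<open>Q\<close> is read off from it.

  If \<open>Q\<close> has size \<open>4 p\<close> and is subdirectly reducible, then by finiteness two congruences
  \<open>\<alpha>, \<beta> \<noteq> 0\<close> meet trivially, and no quotient has size \<open>2\<close>. If \<open>Q / \<beta>\<close> has size \<open>p\<close> or \<open>4\<close>,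
  it is affine, so a displacement fixing one class of \<open>\<beta>\<close> fixes all of them. Hence \<open>\<alpha>\<close> and \<open>\<beta>\<close>
  permute, the class sizes multiply, they must be \<open>4\<close> and \<open>p\<close>, and \<open>Q\<close> is the product of
  the two quotients. Otherwise both have classes of size \<open>2\<close>; exchanging the two elements of each
  class commutes with all left translations. The join of \<open>\<alpha>\<close> and \<open>\<beta>\<close> is then either full, so that
  all left translations are trivial, or yields a connected quandle of size \<open>2 p\<close> over one of size \<open>p\<close>.
  The latter does not exist: a lift \<open>c\<close> of order \<open>p\<close> of a translation satisfies
  \<open>L b \<circ> c = c\<^sup>u \<circ> L b\<close>, so its orbits, of size \<open>p\<close>, are closed under all left translations.
\<close>

text \<open>No Galois group is made to act on characters: \<tau> is, up to the factor
  \<open>p\<close>, an eigenvalue of the integer matrix of the class sum in the regular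
  representation. Every row of that matrix has absolute sum at most \<open>p\<close>, so after
  rescaling all roots of its characteristic polynomial lie in the closed unit disc, and an algebraic
  integer \<tau> \<noteq> 0 has modulus at least 1. A character is the trace on a minimal projection
  commuting with the left regular representation. With \<open>S\<close> the class sum,
  \<open>c\<close> of order \<open>p\<close> and \<open>D\<close> the displacement group,
  \<open>tr (S * adj S * rho c)\<close> is the group order times the number of pairs
  \<open>x\<close>, \<open>y\<close> of class elements with
  \<open>x y\<^sup>-\<^sup>1 c = 1\<close>; only the \<open>D\<close>-invariant part of the
  representation contributes, so this number times \<open>card D\<close> is \<open>p * p\<close>,
  while \<open>p\<close> divides the group order only once. The count \<open>p - 2\<close> comes
  from the multipliers \<open>u\<close> other than 0 and 1; they are told apart by recovering
  \<open>u\<close> from the operation alone.\<close>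

section \<open>Algebraic integers\<close>

hide_const (open) Polynomials.lead_coeff Polynomials.degree up_ring.coeff up_ring.monom Polynomial.order

text \<open>A single matrix has to serve all \<open>x\<close> at once, because the modulus bound is
  needed for every root of its characteristic polynomial and not only for one given eigenvalue. The
  index set stays arbitrary so that group elements can index rows.\<close>

lemma ex_int_mat:
  fixes A :: "'i \<Rightarrow> 'i \<Rightarrow> int"
  assumes fin: "finite I"
  obtains n M where "M \<in> carrier_mat n n"
    and "\<And>x :: complex. eigenvalue (map_mat of_int M) x \<longleftrightarrow>
      (\<exists>v. (\<exists>k\<in>I. v k \<noteq> 0) \<and> (\<forall>i\<in>I. x * v i = (\<Sum>j\<in>I. of_int (A i j) * v j)))"
proof -
  define n where "n = card I"
  obtain e where e: "bij_betw e {0..<n} I"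
    using fin ex_bij_betw_nat_finite unfolding n_def by blast
  define M where "M = mat n n (\<lambda>(i, j). A (e i) (e j))"
  let ?M = "map_mat complex_of_int M"
  have M: "M \<in> carrier_mat n n" "?M \<in> carrier_mat n n"
    by (auto simp: M_def)
  have eI: "e i \<in> I" if "i < n" for i
    using e that by (auto simp: bij_betw_def)
  have mult: "(?M *\<^sub>v vec n (\<lambda>i. v (e i))) $ i = (\<Sum>j\<in>I. of_int (A (e i) j) * v j)" if "i < n" for v i
  proof -
    have "(?M *\<^sub>v vec n (\<lambda>i. v (e i))) $ i = (\<Sum>j = 0..<n. of_int (A (e i) (e j)) * v (e j))"
      using that by (simp add: M_def scalar_prod_def)
    then show ?thesis
      using sum.reindex_bij_betw[OF e, of "\<lambda>j. of_int (A (e i) j) * v j"] by simp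
  qed
  have "eigenvalue ?M x \<longleftrightarrow>
      (\<exists>v. (\<exists>k\<in>I. v k \<noteq> 0) \<and> (\<forall>i\<in>I. x * v i = (\<Sum>j\<in>I. of_int (A i j) * v j)))" (is "_ = ?R") for x
  proof
    assume "eigenvalue ?M x"
    then obtain w where w: "w \<in> carrier_vec n" "w \<noteq> 0\<^sub>v n" "?M *\<^sub>v w = x \<cdot>\<^sub>v w"
      unfolding eigenvalue_def eigenvector_def using M by auto
    define v where "v = (\<lambda>i. w $ (inv_into {0..<n} e i))"
    have inv: "inv_into {0..<n} e (e i) = i" if "i < n" for i
      using e that by (simp add: bij_betw_inv_into_left)
    have wv: "w = vec n (\<lambda>i. v (e i))"
      using w(1) inv by (intro eq_vecI) (auto simp: v_def)
    obtain i where i: "i < n" "w $ i \<noteq> 0"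
      using w(1,2) by (metis carrier_vecD eq_vecI index_zero_vec)
    have "x * v (e i) = (\<Sum>j\<in>I. of_int (A (e i) j) * v j)" if "i < n" for i
      using arg_cong[OF w(3), of "\<lambda>u. u $ i"] mult[OF that, of v] w(1) that inv
      by (simp add: wv[symmetric]) (simp add: v_def)
    moreover have "\<exists>i<n. k = e i" if "k \<in> I" for k
      using e that by (auto simp: bij_betw_def)
    moreover have "v (e i) \<noteq> 0" using i inv by (simp add: v_def)
    ultimately show ?R using eI[OF i(1)] by (intro exI[of _ v]) blast
  next
    assume ?R
    then obtain v k where v: "k \<in> I" "v k \<noteq> 0"
      "\<And>i. i \<in> I \<Longrightarrow> x * v i = (\<Sum>j\<in>I. of_int (A i j) * v j)"
      by blast
    define w where "w = vec n (\<lambda>i. v (e i))"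
    obtain k' where k': "k' < n" "e k' = k"
      using e \<open>k \<in> I\<close> by (auto simp: bij_betw_def image_iff)
    have "w \<noteq> 0\<^sub>v n"
      using k' \<open>v k \<noteq> 0\<close> by (auto simp: w_def vec_eq_iff)
    moreover have "?M *\<^sub>v w = x \<cdot>\<^sub>v w"
      using M v(3) eI by (intro eq_vecI) (auto simp: mult w_def simp del: index_mult_mat_vec)
    ultimately show "eigenvalue ?M x"
      unfolding eigenvalue_def eigenvector_def using M by (intro exI[of _ w]) (auto simp: w_def)
  qed
  then show ?thesis using that M(1) by blast
qed

text \<open>The characteristic polynomial of an integer matrix is monic with integer coefficients,
  and \<open>x\<close> is one of its roots.\<close>

lemma algebraic_int_eigenI:
  fixes x :: complex and A :: "'i \<Rightarrow> 'i \<Rightarrow> int"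
  assumes fin: "finite I" and "k \<in> I" "v k \<noteq> 0"
    and ev: "\<And>i. i \<in> I \<Longrightarrow> x * v i = (\<Sum>j\<in>I. of_int (A i j) * v j)"
  shows "algebraic_int x"
proof -
  obtain n M where M: "M \<in> carrier_mat n n"
    and eig: "\<And>x :: complex. eigenvalue (map_mat of_int M) x \<longleftrightarrow>
      (\<exists>v. (\<exists>k\<in>I. v k \<noteq> 0) \<and> (\<forall>i\<in>I. x * v i = (\<Sum>j\<in>I. of_int (A i j) * v j)))"
    by (rule ex_int_mat[OF fin, where A = A]) (rule that)
  have "eigenvalue (map_mat of_int M) x"
    using assms by (auto simp: eig)
  then have "poly (char_poly (map_mat of_int M)) x = 0"
    using eigenvalue_root_char_poly[of "map_mat of_int M" n x] M by simp
  also have "char_poly (map_mat of_int M) = map_poly of_int (char_poly M)"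
    by (rule of_int_hom.char_poly_hom[OF M])
  finally show ?thesis
    using degree_monic_char_poly[OF M] algebraic_int_altdef_ipoly by blast
qed

lemma algebraic_int_power_basis:
  fixes x :: complex
  assumes "algebraic_int x"
  obtains n :: nat and a :: "nat \<Rightarrow> nat \<Rightarrow> int"
  where "n > 0" "\<And>i. i < n \<Longrightarrow> x * x ^ i = (\<Sum>k<n. of_int (a i k) * x ^ k)"
proof -
  obtain q :: "int poly" where q: "poly (map_poly of_int q) x = 0" "lead_coeff q = 1"
    using assms algebraic_int_altdef_ipoly by blast
  define n where "n = degree q"
  have dq: "degree (map_poly complex_of_int q) = n"
    by (simp add: n_def degree_map_poly)
  have eq: "(\<Sum>k<n. of_int (coeff q k) * x ^ k) + x ^ n = 0"
    using q unfolding poly_altdef dq lessThan_Suc_atMost[symmetric]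
    by (simp add: coeff_map_poly n_def)
  have "n > 0"
    using eq by (cases n) auto
  \<comment> \<open>The companion matrix: multiplication by \<open>x\<close> shifts the powers, and
    in the last row the monic equation rewrites \<open>x ^ n\<close>.\<close>
  define a where "a = (\<lambda>i k. if Suc i < n then of_bool (k = Suc i) else - coeff q k)"
  have "x * x ^ i = (\<Sum>k<n. of_int (a i k) * x ^ k)" if "i < n" for i
  proof (cases "Suc i < n")
    case True
    have "(\<Sum>k<n. of_int (a i k) * x ^ k) = (\<Sum>k<n. if k = Suc i then x ^ Suc i else 0)"
      using True by (intro sum.cong) (auto simp: a_def)
    then show ?thesis using True by simp
  next
    case False
    then have "Suc i = n" using that by simp
    then have "x * x ^ i = x ^ n" by (metis power_Suc)
    also have "\<dots> = (\<Sum>k<n. of_int (a i k) * x ^ k)"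
      using eq[unfolded add_eq_0_iff] False by (simp add: a_def sum_negf)
    finally show ?thesis .
  qed
  then show ?thesis using that \<open>n > 0\<close> by blast
qed

text \<open>The monomials \<open>x ^ i * y ^ j\<close> with bounded exponents are mapped to integer
  combinations of themselves by multiplication with \<open>x\<close> and with \<open>y\<close>,
  hence also with the sum and the product. They form the eigenvector.\<close>

lemma
  fixes x y :: complex
  assumes "algebraic_int x" "algebraic_int y"
  shows algebraic_int_add: "algebraic_int (x + y)"
    and algebraic_int_mult: "algebraic_int (x * y)"
proof -
  obtain m :: nat and a :: "nat \<Rightarrow> nat \<Rightarrow> int"
    where m: "m > 0" and a: "\<And>i. i < m \<Longrightarrow> x * x ^ i = (\<Sum>k<m. of_int (a i k) * x ^ k)"
    using algebraic_int_power_basis[OF assms(1)] by metis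
  obtain n :: nat and b :: "nat \<Rightarrow> nat \<Rightarrow> int"
    where n: "n > 0" and b: "\<And>i. i < n \<Longrightarrow> y * y ^ i = (\<Sum>k<n. of_int (b i k) * y ^ k)"
    using algebraic_int_power_basis[OF assms(2)] by metis
  let ?I = "{..<m} \<times> {..<n}"
  let ?v = "\<lambda>(i, j). x ^ i * y ^ j"
  let ?A = "\<lambda>(i, j) (k, l). a i k * of_bool (j = l)"
  let ?B = "\<lambda>(i, j) (k, l). b j l * of_bool (i = k)"
  have A: "x * ?v s = (\<Sum>t\<in>?I. of_int (?A s t) * ?v t)" if "s \<in> ?I" for s
  proof -
    obtain i j where s: "s = (i, j)" "i < m" "j < n" using \<open>s \<in> ?I\<close> by auto
    have "(\<Sum>t\<in>?I. of_int (?A s t) * ?v t)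
        = (\<Sum>k<m. \<Sum>l<n. if l = j then of_int (a i k) * x ^ k * y ^ j else 0)"
      unfolding sum.cartesian_product
      by (intro sum.cong) (auto simp: s)
    also have "\<dots> = (x * x ^ i) * y ^ j"
      using s a by (simp add: sum_distrib_right)
    finally show ?thesis by (simp add: s)
  qed
  have B: "y * ?v s = (\<Sum>t\<in>?I. of_int (?B s t) * ?v t)" if "s \<in> ?I" for s
  proof -
    obtain i j where s: "s = (i, j)" "i < m" "j < n" using \<open>s \<in> ?I\<close> by auto
    have "(\<Sum>t\<in>?I. of_int (?B s t) * ?v t)
        = (\<Sum>k<m. \<Sum>l<n. if k = i then x ^ i * (of_int (b j l) * y ^ l) else 0)"
      unfolding sum.cartesian_product
      by (intro sum.cong) (auto simp: s)
    also have "\<dots> = (\<Sum>l<n. x ^ i * (of_int (b j l) * y ^ l))"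
      using s by (subst sum.swap) simp
    also have "\<dots> = x ^ i * (y * y ^ j)"
      using s b by (simp add: sum_distrib_left)
    finally show ?thesis by (simp add: s)
  qed
  \<comment> \<open>The monomial with both exponents 0 is 1, so the eigenvector does not
    vanish.\<close>
  have 0: "(0, 0) \<in> ?I" "?v (0, 0) \<noteq> 0" "finite ?I"
    using m n by auto
  show "algebraic_int (x + y)"
  proof (rule algebraic_int_eigenI[where v = ?v and A = "\<lambda>s t. ?A s t + ?B s t", OF 0(3,1,2)])
    fix s assume s: "s \<in> ?I"
    show "(x + y) * ?v s = (\<Sum>t\<in>?I. of_int (?A s t + ?B s t) * ?v t)"
      unfolding distrib_right sum.distrib of_int_add A[OF s, symmetric] B[OF s, symmetric] ..
  qed
  show "algebraic_int (x * y)"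
  proof (rule algebraic_int_eigenI[where v = ?v and A = "\<lambda>s t. \<Sum>u\<in>?I. ?B s u * ?A u t", OF 0(3,1,2)])
    fix s assume s: "s \<in> ?I"
    have "x * y * ?v s = (\<Sum>u\<in>?I. of_int (?B s u) * (x * ?v u))"
      using B[OF s] by (simp add: mult.assoc sum_distrib_left mult.left_commute)
    also have "\<dots> = (\<Sum>u\<in>?I. \<Sum>t\<in>?I. of_int (?B s u) * (of_int (?A u t) * ?v t))"
      using A by (intro sum.cong refl) (simp only: sum_distrib_left)
    also have "\<dots> = (\<Sum>t\<in>?I. of_int (\<Sum>u\<in>?I. ?B s u * ?A u t) * ?v t)"
      by (subst sum.swap) (simp only: of_int_sum sum_distrib_right of_int_mult mult.assoc)
    finally show "x * y * ?v s = (\<Sum>t\<in>?I. of_int (\<Sum>u\<in>?I. ?B s u * ?A u t) * ?v t)" .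
  qed
qed

lemma algebraic_int_sum:
  fixes f :: "'i \<Rightarrow> complex"
  shows "(\<And>i. i \<in> I \<Longrightarrow> algebraic_int (f i)) \<Longrightarrow> algebraic_int (sum f I)"
  by (induction I rule: infinite_finite_induct) (auto intro: algebraic_int_add)

lemma algebraic_int_prod_list:
  fixes xs :: "complex list"
  shows "(\<And>x. x \<in> set xs \<Longrightarrow> algebraic_int x) \<Longrightarrow> algebraic_int (prod_list xs)"
  by (induction xs) (auto intro: algebraic_int_mult)

text \<open>Kronecker: the constant term of the minimal polynomial of \<open>x\<close> is, up to sign, the product of
  the conjugates of \<open>x\<close>, and a rational algebraic integer is an integer.\<close>

lemma algebraic_int_norm_ge_1:
  fixes x :: complex and g :: "rat poly"
  assumes x: "algebraic_int x" "x \<noteq> 0"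
    and g: "g \<noteq> 0" "poly (map_poly of_rat g) x = 0"
    and bound: "\<And>y. poly (map_poly of_rat g) y = 0 \<Longrightarrow> cmod y \<le> 1"
  shows "cmod x \<ge> 1"
proof -
  obtain f :: "int poly" where f: "poly (map_poly of_int f) x = 0" "lead_coeff f = 1"
    using x(1) algebraic_int_altdef_ipoly by blast
  define P where "P = (\<lambda>h :: rat poly. h \<noteq> 0 \<and> poly (map_poly of_rat h) x = 0)"
  have Pg: "P g" using g by (simp add: P_def)
  \<comment> \<open>A minimal polynomial of \<open>x\<close> over the rationals, up to a
    scalar.\<close>
  define h where "h = arg_min degree P"
  have h: "P h" and min: "\<And>k. P k \<Longrightarrow> degree h \<le> degree k"
    using arg_min_nat_lemma[of P g degree] Pg unfolding h_def by auto
  interpret of_rat_poly: map_poly_inj_idom_hom "of_rat :: rat \<Rightarrow> complex" ..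
  have dvd: "h dvd k" if "poly (map_poly of_rat k) x = 0" for k
  proof (rule ccontr)
    assume "\<not> h dvd k"
    then have nz: "k mod h \<noteq> 0" by (simp add: dvd_eq_mod_eq_0)
    have "poly (map_poly of_rat (k mod h)) x = 0"
    proof -
      have "map_poly of_rat (k mod h) = map_poly of_rat k
          - map_poly of_rat (k div h) * (map_poly of_rat h :: complex poly)"
        by (simp flip: of_rat_poly.hom_mult of_rat_poly.hom_minus add: minus_div_mult_eq_mod)
      then show ?thesis using that h by (simp add: P_def)
    qed
    then have "degree h \<le> degree (k mod h)" using min nz by (simp add: P_def)
    moreover have "degree (k mod h) < degree h"
      using nz h degree_mod_less'[of h k] by (auto simp: P_def)
    ultimately show False by simp
  qed
  let ?h = "map_poly of_rat h :: complex poly"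
  have fr: "map_poly of_rat (map_poly of_int f) = (map_poly of_int f :: complex poly)"
    by (simp add: map_poly_map_poly o_def)
  have root_f: "algebraic_int y" if "poly ?h y = 0" for y
  proof -
    have "h dvd map_poly of_int f" using dvd f fr by simp
    then have "?h dvd map_poly of_int f" using of_rat_poly.hom_dvd unfolding fr[symmetric] by blast
    then have "poly (map_poly of_int f) y = 0" using that by (auto elim!: dvdE)
    then show ?thesis using f algebraic_int_altdef_ipoly by blast
  qed
  have root_g: "cmod y \<le> 1" if "poly ?h y = 0" for y
  proof -
    have "?h dvd map_poly of_rat g" using dvd g of_rat_poly.hom_dvd by blast
    then have "poly (map_poly of_rat g) y = 0" using that by (auto elim!: dvdE)
    then show ?thesis by (rule bound)
  qed
  \<comment> \<open>Otherwise \<open>h\<close> could be divided by the indeterminate, and since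
    \<open>x \<noteq> 0\<close> the quotient would still annihilate \<open>x\<close>.\<close>
  have h0: "coeff h 0 \<noteq> 0"
  proof
    assume "coeff h 0 = 0"
    then have "[:0, 1:] dvd h"
      using poly_eq_0_iff_dvd[of h 0] by (simp add: poly_0_coeff_0)
    then obtain k where k: "h = [:0, 1:] * k"
      by (elim dvdE)
    then have "k \<noteq> 0" using h by (auto simp: P_def)
    moreover have "poly (map_poly of_rat k) x = 0"
      using h x(2) by (auto simp: P_def k map_poly_pCons)
    ultimately have "degree h \<le> degree k" using min by (simp add: P_def)
    moreover have "degree h = Suc (degree k)"
      using \<open>k \<noteq> 0\<close> by (simp add: k)
    ultimately show False by simp
  qed
  obtain as where as: "smult (lead_coeff ?h) (\<Prod>a\<leftarrow>as. [:- a, 1:]) = ?h" "length as = degree ?h"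
    using fundamental_theorem_algebra_factorized by blast
  have nz: "?h \<noteq> 0" using h by (simp add: P_def)
  have roots: "poly ?h a = 0" if "a \<in> set as" for a
  proof -
    have "poly (\<Prod>a\<leftarrow>as. [:- a, 1:]) a = 0"
      using that by (induction as) auto
    then show ?thesis using arg_cong[OF as(1), of "\<lambda>q. poly q a"] by simp
  qed
  have "coeff ?h 0 = lead_coeff ?h * prod_list (map uminus as)"
  proof -
    have "poly ?h 0 = lead_coeff ?h * poly (\<Prod>a\<leftarrow>as. [:- a, 1:]) 0"
      using arg_cong[OF as(1), of "\<lambda>q. poly q 0"] by simp
    also have "poly (\<Prod>a\<leftarrow>as. [:- a, 1:]) 0 = prod_list (map uminus as)"
      by (induction as) auto
    finally show ?thesis by (simp add: poly_0_coeff_0)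
  qed
  then have quot: "prod_list (map uminus as) = of_rat (coeff h 0 / lead_coeff h)"
    using nz by (simp add: of_rat_divide field_simps)
  have "algebraic_int (prod_list (map uminus as))"
    by (rule algebraic_int_prod_list) (auto intro: root_f roots)
  then have "prod_list (map uminus as) \<in> \<int>"
    by (intro rational_algebraic_int_is_int) (simp_all add: quot)
  then obtain k where k: "prod_list (map uminus as) = of_int k"
    unfolding Ints_def by blast
  have "(of_int k :: complex) \<noteq> 0"
    using h0 h unfolding k[symmetric] quot by (simp add: P_def)
  then have "1 \<le> \<bar>k\<bar>"
    by simp
  then have "cmod (prod_list (map uminus as)) \<ge> 1"
    unfolding k norm_of_int by linarith
  \<comment> \<open>The remaining factors have modulus at most 1, so deleting them from the product
    does not decrease its modulus.\<close>
  moreover have le: "cmod (prod_list (map uminus as)) \<le> cmod a" if "a \<in> set as" for a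
  proof -
    have le1: "cmod (prod_list (map uminus bs)) \<le> 1" if "set bs \<subseteq> set as" for bs
      using that
    proof (induction bs)
      case (Cons b bs)
      have "cmod b \<le> 1" using Cons.prems roots root_g by simp
      moreover have "cmod (prod_list (map uminus bs)) \<le> 1" using Cons by simp
      ultimately show ?case by (simp add: norm_mult mult_le_one)
    qed simp
    obtain bs cs where as_eq: "as = bs @ a # cs" using split_list[OF \<open>a \<in> set as\<close>] by blast
    let ?P = "\<lambda>bs. cmod (prod_list (map uminus bs))"
    have "?P bs * ?P cs \<le> 1"
      using le1[of bs] le1[of cs] as_eq by (intro mult_le_one) auto
    then have "(?P bs * ?P cs) * cmod a \<le> 1 * cmod a"
      by (intro mult_right_mono) auto
    then show ?thesis
      by (simp add: as_eq norm_mult algebra_simps)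
  qed
  moreover have "x \<in> set as"
  proof -
    have "poly (\<Prod>a\<leftarrow>as. [:- a, 1:]) x = 0"
      using h nz arg_cong[OF as(1), of "\<lambda>q. poly q x"] by (simp add: P_def)
    then show ?thesis by (induction as) auto
  qed
  ultimately show ?thesis using le[of x] by linarith
qed

text \<open>The bound on the absolute row sums confines all eigenvalues of the matrix to the disc of
  radius \<open>p\<close>. Substituting \<open>p\<close> times the indeterminate into the
  characteristic polynomial therefore gives a rational polynomial that has the root \<tau> and no
  root outside the unit disc, as \<open>algebraic_int_norm_ge_1\<close> asks.\<close>

lemma scaled_eigenvalue_norm_ge_1:
  fixes \<tau> :: complex and A :: "'i \<Rightarrow> 'i \<Rightarrow> int" and p :: nat
  assumes fin: "finite I" and k: "k \<in> I" "v k \<noteq> 0"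
    and ev: "\<And>i. i \<in> I \<Longrightarrow> of_nat p * \<tau> * v i = (\<Sum>j\<in>I. of_int (A i j) * v j)"
    and rows: "\<And>i. i \<in> I \<Longrightarrow> (\<Sum>j\<in>I. \<bar>A i j\<bar>) \<le> int p"
    and "p > 0" "algebraic_int \<tau>" "\<tau> \<noteq> 0"
  shows "cmod \<tau> \<ge> 1"
proof -
  obtain n M where M: "M \<in> carrier_mat n n"
    and eig: "\<And>x :: complex. eigenvalue (map_mat of_int M) x \<longleftrightarrow>
      (\<exists>v. (\<exists>k\<in>I. v k \<noteq> 0) \<and> (\<forall>i\<in>I. x * v i = (\<Sum>j\<in>I. of_int (A i j) * v j)))"
    by (rule ex_int_mat[OF fin, where A = A]) (rule that)
  have root: "poly (map_poly of_int (char_poly M)) x = 0 \<longleftrightarrow> eigenvalue (map_mat of_int M) x" for x :: complex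
    using eigenvalue_root_char_poly[of "map_mat of_int M" n x] M
    by (simp add: of_int_hom.char_poly_hom[OF M])
  have bound: "cmod x \<le> p" if "eigenvalue (map_mat of_int M) x" for x
  proof -
    have "\<exists>v. (\<exists>k\<in>I. v k \<noteq> 0) \<and> (\<forall>i\<in>I. x * v i = (\<Sum>j\<in>I. of_int (A i j) * v j))"
      using that by (simp only: eig)
    then obtain v where ex: "\<exists>k\<in>I. v k \<noteq> 0"
      and all: "\<forall>i\<in>I. x * v i = (\<Sum>j\<in>I. of_int (A i j) * v j)"
      by (elim exE conjE)
    from ex obtain k where v: "k \<in> I" "v k \<noteq> 0" by blast
    \<comment> \<open>The eigenvalue equation is evaluated at a coordinate of largest
      modulus.\<close>
    define m where "m = Max ((\<lambda>i. cmod (v i)) ` I)"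
    have m: "cmod (v i) \<le> m" if "i \<in> I" for i
      using fin that by (auto simp: m_def)
    have "m > 0" using m[OF v(1)] v(2) zero_less_norm_iff[of "v k"] by linarith
    obtain i where i: "i \<in> I" "cmod (v i) = m"
      using Max_in[of "(\<lambda>i. cmod (v i)) ` I"] fin v(1) unfolding m_def by fastforce
    have "cmod x * m = cmod (\<Sum>j\<in>I. of_int (A i j) * v j)"
      using bspec[OF all i(1)] i(2) by (metis norm_mult)
    also have "\<dots> \<le> (\<Sum>j\<in>I. real_of_int \<bar>A i j\<bar> * m)"
      using m by (intro sum_norm_le) (simp add: norm_mult mult_left_mono)
    also have "\<dots> = of_int (\<Sum>j\<in>I. \<bar>A i j\<bar>) * m"
      by (simp add: sum_distrib_right)
    also have "\<dots> \<le> of_int (int p) * m"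
      using rows[OF i(1)] \<open>m > 0\<close> by (intro mult_right_mono) (auto simp only: of_int_le_iff)
    finally show ?thesis using \<open>m > 0\<close> by simp
  qed
  define g :: "rat poly" where "g = pcompose (map_poly of_int (char_poly M)) [:0, of_nat p:]"
  have g: "poly (map_poly of_rat g) y = poly (map_poly of_int (char_poly M)) (of_nat p * y)" for y :: complex
  proof -
    have "map_poly of_rat [:0, of_nat p:] = [:0, of_nat p :: complex:]"
      by (rule poly_eqI) (simp add: coeff_map_poly coeff_pCons split: nat.split)
    then have "map_poly of_rat g = pcompose (map_poly complex_of_int (char_poly M)) [:0, of_nat p:]"
      unfolding g_def by (subst of_rat_hom.map_poly_pcompose) (simp add: map_poly_map_poly o_def map_poly_pCons)
    then show ?thesis by (simp add: poly_pcompose mult.commute)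
  qed
  have "g \<noteq> 0"
    using degree_monic_char_poly[OF M] \<open>p > 0\<close>
    by (auto simp: g_def pcompose_eq_0_iff)
  show ?thesis
  proof (rule algebraic_int_norm_ge_1[OF \<open>algebraic_int \<tau>\<close> \<open>\<tau> \<noteq> 0\<close> \<open>g \<noteq> 0\<close>])
    have "eigenvalue (map_mat complex_of_int M) (of_nat p * \<tau>)"
      unfolding eig using k ev by blast
    then show "poly (map_poly of_rat g) \<tau> = 0" by (simp add: g root)
    show "cmod y \<le> 1" if "poly (map_poly of_rat g) y = 0" for y
    proof -
      have "cmod (of_nat p * y) \<le> p" using that bound by (simp add: g root)
      then show ?thesis using \<open>p > 0\<close> by (simp add: norm_mult)
    qed
  qed
qed

section \<open>Finitely supported complex matrices\<close>

text \<open>Finite support instead of a fixed dimension makes addition and multiplication total on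
  the type, so ring simplification works without side conditions on sizes. The price is that there
  is no unit: \<open>unit_mat I\<close> acts as one only on matrices supported by
  \<open>I\<close>.\<close>

typedef 'i fmat = "{A :: 'i \<Rightarrow> 'i \<Rightarrow> complex. \<exists>I. finite I \<and> (\<forall>i j. A i j \<noteq> 0 \<longrightarrow> i \<in> I \<and> j \<in> I)}"
  morphisms entry Abs_fmat
  by (intro exI[of _ "\<lambda>_ _. 0"] CollectI exI[of _ "{}"]) simp

setup_lifting type_definition_fmat

lemma fmat_eqI: "(\<And>i j. entry A i j = entry B i j) \<Longrightarrow> A = B"
  by (auto simp: entry_inject[symmetric] fun_eq_iff)

definition supported :: "'i set \<Rightarrow> 'i fmat \<Rightarrow> bool"
  where "supported I A \<longleftrightarrow> (\<forall>i j. entry A i j \<noteq> 0 \<longrightarrow> i \<in> I \<and> j \<in> I)"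

lemma ex_supported: obtains I where "finite I" "supported I A"
  using entry[of A] by (auto simp: supported_def)

lemma supported_mono: "supported I A \<Longrightarrow> I \<subseteq> J \<Longrightarrow> supported J A"
  by (auto simp: supported_def)

lemma supported_outside: "supported I A \<Longrightarrow> i \<notin> I \<or> j \<notin> I \<Longrightarrow> entry A i j = 0"
  by (auto simp: supported_def)

lemma supportedI: "(\<And>i j. i \<notin> I \<or> j \<notin> I \<Longrightarrow> entry A i j = 0) \<Longrightarrow> supported I A"
  by (auto simp: supported_def)

instantiation fmat :: (type) ab_group_add
begin

lift_definition zero_fmat :: "'a fmat" is "\<lambda>_ _. 0" by auto

lift_definition plus_fmat :: "'a fmat \<Rightarrow> 'a fmat \<Rightarrow> 'a fmat" is "\<lambda>A B i j. A i j + B i j"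
proof (elim exE conjE)
  fix A B :: "'a \<Rightarrow> 'a \<Rightarrow> complex" and I J
  assume "finite I" "\<forall>i j. A i j \<noteq> 0 \<longrightarrow> i \<in> I \<and> j \<in> I"
    "finite J" "\<forall>i j. B i j \<noteq> 0 \<longrightarrow> i \<in> J \<and> j \<in> J"
  moreover have "A i j + B i j \<noteq> 0 \<Longrightarrow> A i j \<noteq> 0 \<or> B i j \<noteq> 0" for i j
    by auto
  ultimately show "\<exists>I. finite I \<and> (\<forall>i j. A i j + B i j \<noteq> 0 \<longrightarrow> i \<in> I \<and> j \<in> I)"
    by (intro exI[of _ "I \<union> J"] conjI finite_UnI allI impI) blast+
qed

lift_definition uminus_fmat :: "'a fmat \<Rightarrow> 'a fmat" is "\<lambda>A i j. - A i j" by auto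

definition minus_fmat :: "'a fmat \<Rightarrow> 'a fmat \<Rightarrow> 'a fmat" where "minus_fmat A B = A + - B"

instance
  by standard (auto intro!: fmat_eqI simp: minus_fmat_def plus_fmat.rep_eq zero_fmat.rep_eq
      uminus_fmat.rep_eq)

end

lemma entry_simps [simp]:
  "entry 0 i j = 0" "entry (A + B) i j = entry A i j + entry B i j"
  "entry (- A) i j = - entry A i j" "entry (A - B) i j = entry A i j - entry B i j"
  unfolding minus_fmat_def by (simp_all only: plus_fmat.rep_eq zero_fmat.rep_eq uminus_fmat.rep_eq diff_conv_add_uminus)

lemma entry_sum [simp]: "entry (sum f S) i j = (\<Sum>x\<in>S. entry (f x) i j)"
  by (induction S rule: infinite_finite_induct) simp_all

instantiation fmat :: (type) ring
begin

lift_definition times_fmat :: "'a fmat \<Rightarrow> 'a fmat \<Rightarrow> 'a fmat"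
  is "\<lambda>A B i k. \<Sum>j | A i j \<noteq> 0. A i j * B j k"
proof (elim exE conjE)
  fix A B :: "'a \<Rightarrow> 'a \<Rightarrow> complex" and I J
  assume *: "finite I" "\<forall>i j. A i j \<noteq> 0 \<longrightarrow> i \<in> I \<and> j \<in> I"
    "finite J" "\<forall>i j. B i j \<noteq> 0 \<longrightarrow> i \<in> J \<and> j \<in> J"
  have "i \<in> I \<union> J \<and> k \<in> I \<union> J" if "(\<Sum>j | A i j \<noteq> 0. A i j * B j k) \<noteq> 0" for i k
  proof -
    obtain j where "A i j * B j k \<noteq> 0"
      using \<open>(\<Sum>j | A i j \<noteq> 0. A i j * B j k) \<noteq> 0\<close> by (meson sum.neutral)
    then show ?thesis using * by auto
  qed
  then show "\<exists>I. finite I \<and> (\<forall>i k. (\<Sum>j | A i j \<noteq> 0. A i j * B j k) \<noteq> 0 \<longrightarrow> i \<in> I \<and> k \<in> I)"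
    using * by (intro exI[of _ "I \<union> J"]) auto
qed

lemma entry_mult:
  assumes "finite I" "supported I A"
  shows "entry (A * B) i k = (\<Sum>j\<in>I. entry A i j * entry B j k)"
  unfolding times_fmat.rep_eq
  using assms by (intro sum.mono_neutral_left) (auto simp: supported_def)

instance
proof
  fix A B C :: "'a fmat"
  obtain I where I: "finite I" "supported I A" by (rule ex_supported)
  obtain J where J: "finite J" "supported J B" by (rule ex_supported)
  define K where "K = I \<union> J"
  have K: "finite K" "supported K A" "supported K B"
    using I J supported_mono[OF I(2)] supported_mono[OF J(2)] by (auto simp: K_def)
  have KAB: "supported K (A + B)"
    using K supported_outside[OF K(2)] supported_outside[OF K(3)] by (auto intro: supportedI)
  have "supported K (A * B)"
  proof -
    have "entry (A * B) i k = 0" if "i \<notin> K \<or> k \<notin> K" for i k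
      using that K by (auto simp: entry_mult[OF K(1,2)] supported_outside)
    then show ?thesis by (auto simp: supported_def)
  qed
  then have AB: "supported K (A * B)" .
  show "A * B * C = A * (B * C)"
  proof (rule fmat_eqI)
    fix i l
    have "entry (A * B * C) i l = (\<Sum>k\<in>K. \<Sum>j\<in>K. entry A i j * (entry B j k * entry C k l))"
      by (simp add: entry_mult[OF K(1) AB] entry_mult[OF K(1,2)] sum_distrib_right mult.assoc)
    also have "\<dots> = (\<Sum>j\<in>K. \<Sum>k\<in>K. entry A i j * (entry B j k * entry C k l))"
      by (rule sum.swap)
    also have "\<dots> = entry (A * (B * C)) i l"
      by (simp add: entry_mult[OF K(1,2)] entry_mult[OF K(1,3)] sum_distrib_left)
    finally show "entry (A * B * C) i l = entry (A * (B * C)) i l" .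
  qed
  show "(A + B) * C = A * C + B * C"
    by (intro fmat_eqI) (simp add: entry_mult[OF K(1)] K KAB algebra_simps sum.distrib)
  show "A * (B + C) = A * B + A * C"
    by (intro fmat_eqI) (simp add: entry_mult[OF K(1)] K algebra_simps sum.distrib)
qed

end

lift_definition smul :: "complex \<Rightarrow> 'i fmat \<Rightarrow> 'i fmat"  (infixr \<open>\<star>\<close> 72) is "\<lambda>c A i j. c * A i j"
  by auto

lift_definition adj :: "'i fmat \<Rightarrow> 'i fmat" is "\<lambda>A i j. cnj (A j i)"
  by auto

definition tr :: "'i fmat \<Rightarrow> complex"
  where "tr A = (\<Sum>i | entry A i i \<noteq> 0. entry A i i)"

lemma entry_smul [simp]: "entry (c \<star> A) i j = c * entry A i j"
  by (simp add: smul.rep_eq)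

lemma entry_adj [simp]: "entry (adj A) i j = cnj (entry A j i)"
  by (simp add: adj.rep_eq)

lemma tr_eq: "finite I \<Longrightarrow> supported I A \<Longrightarrow> tr A = (\<Sum>i\<in>I. entry A i i)"
  unfolding tr_def by (intro sum.mono_neutral_left) (auto simp: supported_def)

lemma supported_simps [simp]:
  "supported I 0"
  "supported I A \<Longrightarrow> supported I B \<Longrightarrow> supported I (A + B)"
  "supported I A \<Longrightarrow> supported I B \<Longrightarrow> supported I (A - B)"
  "supported I A \<Longrightarrow> supported I (- A)"
  "supported I A \<Longrightarrow> supported I (c \<star> A)"
  "supported I A \<Longrightarrow> supported I (adj A)"
  by (auto intro!: supportedI simp: supported_outside)

lemma supported_mult [simp]:
  assumes "supported I A" "supported I B"
  shows "supported I (A * B)"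
proof -
  obtain J where J: "finite J" "supported J A" by (rule ex_supported)
  have "entry (A * B) i k = 0" if "i \<notin> I \<or> k \<notin> I" for i k
    using that assms by (auto simp: entry_mult[OF J] supported_outside)
  then show ?thesis by (auto simp: supported_def)
qed

lemma supported_sum [simp]: "(\<And>x. x \<in> S \<Longrightarrow> supported I (f x)) \<Longrightarrow> supported I (sum f S)"
  by (induction S rule: infinite_finite_induct) auto

lemma smul_mult_left [simp]: "(c \<star> A) * B = c \<star> (A * B)"
proof (rule fmat_eqI)
  fix i j
  obtain I where I: "finite I" "supported I A" by (rule ex_supported)
  then show "entry ((c \<star> A) * B) i j = entry (c \<star> (A * B)) i j"
    by (simp add: entry_mult[OF I(1)] sum_distrib_left mult.assoc)
qed

lemma smul_mult_right [simp]: "A * (c \<star> B) = c \<star> (A * B)"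
proof (rule fmat_eqI)
  fix i j
  obtain I where I: "finite I" "supported I A" by (rule ex_supported)
  then show "entry (A * (c \<star> B)) i j = entry (c \<star> (A * B)) i j"
    by (simp add: entry_mult[OF I(1)] sum_distrib_left mult.left_commute)
qed

lemma smul_simps [simp]:
  "c \<star> (d \<star> A) = (c * d) \<star> A" "1 \<star> A = A" "0 \<star> A = 0" "c \<star> 0 = 0" "c \<star> (- A) = - (c \<star> A)"
  "(- c) \<star> A = - (c \<star> A)"
  by (auto intro!: fmat_eqI)

lemma smul_distrib:
  "c \<star> (A + B) = c \<star> A + c \<star> B" "c \<star> (A - B) = c \<star> A - c \<star> B" "(c + d) \<star> A = c \<star> A + d \<star> A"
  "(c - d) \<star> A = c \<star> A - d \<star> A"
  by (auto intro!: fmat_eqI simp: algebra_simps)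

lemma smul_sum: "c \<star> sum f S = (\<Sum>x\<in>S. c \<star> f x)"
  by (auto intro!: fmat_eqI simp: sum_distrib_left)

lemma smul_cancel: "c \<noteq> 0 \<Longrightarrow> c \<star> A = c \<star> B \<longleftrightarrow> A = B"
  by (auto dest: arg_cong[of _ _ "smul (inverse c)"])

lemma smul_eq_0: "c \<star> A = 0 \<longleftrightarrow> c = 0 \<or> A = 0"
  using smul_cancel[of c A 0] by auto

lemma adj_simps [simp]:
  "adj 0 = 0" "adj (A + B) = adj A + adj B" "adj (A - B) = adj A - adj B" "adj (- A) = - adj A"
  "adj (adj A) = A" "adj (c \<star> A) = cnj c \<star> adj A"
  by (auto intro!: fmat_eqI)

lemma adj_sum [simp]: "adj (sum f S) = (\<Sum>x\<in>S. adj (f x))"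
  by (auto intro!: fmat_eqI)

lemma adj_mult [simp]: "adj (A * B) = adj B * adj A"
proof (rule fmat_eqI)
  fix i j
  obtain I where I: "finite I" "supported I A" by (rule ex_supported)
  obtain J where J: "finite J" "supported J B" by (rule ex_supported)
  have K: "finite (I \<union> J)" "supported (I \<union> J) A" "supported (I \<union> J) B"
    using I J supported_mono[OF I(2)] supported_mono[OF J(2)] by auto
  then show "entry (adj (A * B)) i j = entry (adj B * adj A) i j"
    by (simp add: entry_mult[OF K(1)] mult.commute)
qed

lemma tr_simps [simp]:
  "tr 0 = 0" "tr (A + B) = tr A + tr B" "tr (A - B) = tr A - tr B" "tr (- A) = - tr A"
  "tr (c \<star> A) = c * tr A" "tr (adj A) = cnj (tr A)"
proof -
  obtain I where I: "finite I" "supported I A" by (rule ex_supported)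
  obtain J where J: "finite J" "supported J B" by (rule ex_supported)
  have K: "finite (I \<union> J)" "supported (I \<union> J) A" "supported (I \<union> J) B"
    using I J supported_mono[OF I(2)] supported_mono[OF J(2)] by auto
  note eq = tr_eq[OF K(1)]
  show "tr 0 = 0" by (simp add: tr_def)
  show "tr (A + B) = tr A + tr B" "tr (A - B) = tr A - tr B" "tr (- A) = - tr A"
    "tr (c \<star> A) = c * tr A" "tr (adj A) = cnj (tr A)"
    using K by (simp_all add: eq sum.distrib sum_subtractf sum_negf sum_distrib_left)
qed

lemma tr_sum [simp]: "tr (sum f S) = (\<Sum>x\<in>S. tr (f x))"
  by (induction S rule: infinite_finite_induct) auto

lemma tr_mult_commute: "tr (A * B) = tr (B * A)"
proof -
  obtain I where I: "finite I" "supported I A" by (rule ex_supported)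
  obtain J where J: "finite J" "supported J B" by (rule ex_supported)
  have K: "finite (I \<union> J)" "supported (I \<union> J) A" "supported (I \<union> J) B"
    using I J supported_mono[OF I(2)] supported_mono[OF J(2)] by auto
  show ?thesis
    using K by (simp add: tr_eq[OF K(1)] entry_mult[OF K(1)])
      (subst sum.swap, simp add: mult.commute)
qed

text \<open>The squared Hilbert-Schmidt norm. Its positivity takes the place of an inner product on
  vectors: a matrix is shown to be zero by computing this trace.\<close>

lemma tr_adj_mult:
  assumes "finite I" "supported I A"
  shows "tr (adj A * A) = of_real (\<Sum>i\<in>I. \<Sum>j\<in>I. (cmod (entry A i j))\<^sup>2)"
proof -
  have "tr (adj A * A) = (\<Sum>j\<in>I. \<Sum>i\<in>I. of_real ((cmod (entry A i j))\<^sup>2))"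
    using assms by (simp add: tr_eq[OF assms(1)] entry_mult[OF assms(1)] complex_norm_square mult.commute
        del: of_real_power)
  then show ?thesis by (subst (asm) sum.swap) simp
qed

lemma tr_adj_mult_nonneg: "0 \<le> Re (tr (adj A * A))" "Im (tr (adj A * A)) = 0"
proof -
  obtain I where I: "finite I" "supported I A" by (rule ex_supported)
  show "0 \<le> Re (tr (adj A * A))" "Im (tr (adj A * A)) = 0"
    unfolding tr_adj_mult[OF I] by (auto intro!: sum_nonneg)
qed

lemma tr_adj_mult_eq_0: "Re (tr (adj A * A)) = 0 \<Longrightarrow> A = 0"
proof -
  assume 0: "Re (tr (adj A * A)) = 0"
  obtain I where I: "finite I" "supported I A" by (rule ex_supported)
  have "(\<Sum>i\<in>I. \<Sum>j\<in>I. (cmod (entry A i j))\<^sup>2) = 0"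
    using 0 unfolding tr_adj_mult[OF I] by simp
  then have "entry A i j = 0" if "i \<in> I" "j \<in> I" for i j
    using that I by (simp add: sum_nonneg_eq_0_iff sum_nonneg)
  then show "A = 0"
    using supported_outside[OF I(2)] by (intro fmat_eqI) (metis entry_simps(1))
qed

lemma adj_mult_eq_0: "adj A * A = 0 \<Longrightarrow> A = 0"
  by (rule tr_adj_mult_eq_0) simp

text \<open>For infinite \<open>I\<close> the identity on \<open>I\<close> has infinite support, and
  the value is the zero matrix.\<close>

lift_definition unit_mat :: "'i set \<Rightarrow> 'i fmat" is "\<lambda>I i j. if finite I \<and> i \<in> I \<and> i = j then 1 else 0"
  subgoal for I by (rule exI[of _ "if finite I then I else {}"]) auto
  done

lemma entry_unit_mat: "finite I \<Longrightarrow> entry (unit_mat I) i j = (if i \<in> I \<and> i = j then 1 else 0)"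
  by (simp add: unit_mat.rep_eq)

lemma supported_unit_mat [simp]: "supported I (unit_mat I)"
  by (simp add: supported_def unit_mat.rep_eq)

lemma unit_mat_mult:
  assumes "finite I" "supported I A"
  shows "unit_mat I * A = A" "A * unit_mat I = A"
proof -
  show "unit_mat I * A = A"
  proof (rule fmat_eqI)
    fix i j
    have "entry (unit_mat I * A) i j = (\<Sum>k\<in>I. if k = i then entry A i j else 0)"
      unfolding entry_mult[OF assms(1) supported_unit_mat]
      by (intro sum.cong) (auto simp: entry_unit_mat assms(1))
    also have "\<dots> = entry A i j"
      using assms(1) supported_outside[OF assms(2), of i j] by (cases "i \<in> I"; cases "j \<in> I") auto
    finally show "entry (unit_mat I * A) i j = entry A i j" .
  qed
  show "A * unit_mat I = A"
  proof (rule fmat_eqI)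
    fix i j
    have "entry (A * unit_mat I) i j = (\<Sum>k\<in>I. if k = j then entry A i j else 0)"
      unfolding entry_mult[OF assms]
      by (intro sum.cong) (auto simp: entry_unit_mat assms(1))
    also have "\<dots> = entry A i j"
      using assms(1) supported_outside[OF assms(2), of i j] by (cases "i \<in> I"; cases "j \<in> I") auto
    finally show "entry (A * unit_mat I) i j = entry A i j" .
  qed
qed

lemma tr_unit_mat:
  assumes "finite I"
  shows "tr (unit_mat I) = of_nat (card I)"
proof -
  have "tr (unit_mat I) = (\<Sum>i\<in>I. 1)"
    unfolding tr_eq[OF assms supported_unit_mat]
    by (intro sum.cong refl) (simp only: entry_unit_mat[OF assms] simp_thms if_True)
  then show ?thesis by (simp only: sum_constant mult_1_right)
qed

section \<open>Triangularization of complex matrices and spectral projections\<close>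

lemmas square_mat_simps =
  mult_carrier_mat[of _ n n _ n] assoc_mult_mat[of _ n n _ n _ n] left_mult_one_mat[of _ n n]
  right_mult_one_mat[of _ n n] minus_carrier_mat[of _ n n] smult_carrier_mat[of _ n n]
  minus_mult_distrib_mat[of _ n n _ _ n] mult_minus_distrib_mat[of _ n n _ n]
  mult_smult_distrib[of _ n n _ n] mult_smult_assoc_mat[of _ n n _ n] for n

definition to_mat :: "nat \<Rightarrow> (nat \<Rightarrow> 'i) \<Rightarrow> 'i fmat \<Rightarrow> complex mat"
  where "to_mat n e A = mat n n (\<lambda>(i, j). entry A (e i) (e j))"

lemma to_mat_carrier [simp]: "to_mat n e A \<in> carrier_mat n n"
  by (simp add: to_mat_def)

lemma to_mat_mult:
  assumes "bij_betw e {0..<n} I" "supported I A"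
  shows "to_mat n e (A * B) = to_mat n e A * to_mat n e B"
proof (rule eq_matI)
  fix i j assume "i < dim_row (to_mat n e A * to_mat n e B)" "j < dim_col (to_mat n e A * to_mat n e B)"
  then have ij: "i < n" "j < n" by (auto simp: to_mat_def)
  have "finite I" using assms(1) bij_betw_finite by blast
  then show "to_mat n e (A * B) $$ (i, j) = (to_mat n e A * to_mat n e B) $$ (i, j)"
    using ij sum.reindex_bij_betw[OF assms(1), symmetric]
    by (simp add: to_mat_def scalar_prod_def entry_mult[OF _ assms(2)])
qed (auto simp: to_mat_def)

lemma to_mat_diff_smul:
  "to_mat n e (A - c \<star> B) = to_mat n e A - c \<cdot>\<^sub>m to_mat n e B"
  by (rule eq_matI) (auto simp: to_mat_def)

lemma to_mat_eq_0:
  assumes "bij_betw e {0..<n} I" "supported I A" "to_mat n e A = 0\<^sub>m n n"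
  shows "A = 0"
proof (rule fmat_eqI)
  fix x y
  show "entry A x y = entry 0 x y"
  proof (cases "x \<in> I \<and> y \<in> I")
    case True
    then obtain i j where ij: "i < n" "e i = x" "j < n" "e j = y"
      using assms(1) unfolding bij_betw_def image_iff by (metis (no_types) True atLeastLessThan_iff image_iff)
    have "to_mat n e A $$ (i, j) = 0\<^sub>m n n $$ (i, j)"
      using assms(3) by simp
    then show ?thesis using ij by (simp add: to_mat_def)
  qed (use assms(2) in \<open>auto simp: supported_outside\<close>)
qed

lemma complex_schur:
  fixes M :: "complex mat"
  assumes "M \<in> carrier_mat n n"
  obtains P U Q where "P \<in> carrier_mat n n" "U \<in> carrier_mat n n" "Q \<in> carrier_mat n n"
    "upper_triangular U" "M = P * U * Q" "P * Q = 1\<^sub>m n" "Q * P = 1\<^sub>m n"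
proof -
  obtain as where "char_poly M = (\<Prod>a\<leftarrow>as. [:- a, 1:])"
    using char_poly_factorized[OF assms] by blast
  then obtain U where U: "U \<in> carrier_mat n n" "upper_triangular U" "similar_mat M U"
    using schur_decomposition_exists[OF assms] by blast
  then obtain P Q where "similar_mat_wit M U P Q"
    unfolding similar_mat_def by blast
  from similar_mat_witD2[OF assms this] U show ?thesis
    using that by blast
qed

text \<open>Triangularize. The diagonal entries of an idempotent triangular matrix are themselves
  idempotent numbers, so each is 0 or 1, and the trace counts the ones. Traces of projections
  thereby serve as dimensions.\<close>

lemma idempotent_trace_nat:
  assumes "finite I" "supported I A" and idem: "A * A = A"
  shows "\<exists>d :: nat. tr A = of_nat d"
proof -
  define n where "n = card I"
  obtain e where e: "bij_betw e {0..<n} I"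
    using assms(1) ex_bij_betw_nat_finite unfolding n_def by blast
  define M where "M = to_mat n e A"
  have M: "M \<in> carrier_mat n n" "M * M = M"
    using idem by (simp_all add: M_def to_mat_mult[OF e assms(2), symmetric])
  obtain P U Q where PUQ: "P \<in> carrier_mat n n" "U \<in> carrier_mat n n" "Q \<in> carrier_mat n n"
    "upper_triangular U" "M = P * U * Q" "P * Q = 1\<^sub>m n" "Q * P = 1\<^sub>m n"
    using complex_schur[OF M(1)] .
  note [simp] = PUQ(1-3) M(1) and sq = square_mat_simps[where n = n]
  have U: "U = Q * M * P"
  proof -
    have "Q * M * P = Q * (P * U * Q) * P" by (simp add: PUQ(5))
    also have "\<dots> = (Q * P) * U * (Q * P)" by (simp add: sq)
    finally show ?thesis by (simp add: PUQ(7) sq)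
  qed
  have "U * U = Q * M * (P * Q) * M * P"
    by (simp add: U sq)
  then have "U * U = Q * (M * M) * P"
    by (simp add: PUQ(6) sq)
  then have UU: "U * U = U" by (simp add: M(2) U[symmetric])
  have diag: "U $$ (i, i) \<in> {0, 1}" if i: "i < n" for i
  proof -
    have "U $$ (i, i) = (\<Sum>k = 0..<n. U $$ (i, k) * U $$ (k, i))"
      using i carrier_matD[OF PUQ(2)] by (subst UU[symmetric]) (simp add: scalar_prod_def)
    also have "\<dots> = (\<Sum>k = 0..<n. if k = i then U $$ (i, i) * U $$ (i, i) else 0)"
    proof (intro sum.cong refl)
      fix k assume "k \<in> {0..<n}"
      then show "U $$ (i, k) * U $$ (k, i) = (if k = i then U $$ (i, i) * U $$ (i, i) else 0)"
        using PUQ(4) i upper_triangularD[OF PUQ(4), of k i] upper_triangularD[OF PUQ(4), of i k]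
        by (cases k i rule: linorder_cases) (auto simp: carrier_matD[OF PUQ(2)])
    qed
    also have "\<dots> = U $$ (i, i) * U $$ (i, i)" using i by simp
    finally show ?thesis by simp
  qed
  have "tr A = (\<Sum>i = 0..<n. M $$ (i, i))"
    using sum.reindex_bij_betw[OF e, symmetric]
    by (simp add: tr_eq[OF assms(1,2)] M_def to_mat_def)
  also have "\<dots> = (\<Sum>i = 0..<n. \<Sum>k = 0..<n. P $$ (i, k) * (U * Q) $$ (k, i))"
    unfolding PUQ(5) assoc_mult_mat[OF PUQ(1-3)]
    using carrier_matD[OF PUQ(1)] carrier_matD[OF PUQ(2)] carrier_matD[OF PUQ(3)]
    by (intro sum.cong refl, subst index_mult_mat(1)) (auto simp: scalar_prod_def)
  also have "\<dots> = (\<Sum>k = 0..<n. \<Sum>i = 0..<n. (U * Q) $$ (k, i) * P $$ (i, k))"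
    by (subst sum.swap) (simp add: mult.commute)
  also have "\<dots> = (\<Sum>k = 0..<n. (U * Q * P) $$ (k, k))"
    using carrier_matD[OF PUQ(1)] carrier_matD[OF PUQ(2)] carrier_matD[OF PUQ(3)]
    by (intro sum.cong refl, subst (2) index_mult_mat(1)) (auto simp: scalar_prod_def)
  also have "U * Q * P = U"
    by (simp add: sq PUQ(7))
  also have "(\<Sum>k = 0..<n. U $$ (k, k)) = (\<Sum>k = 0..<n. of_nat (if U $$ (k, k) = 1 then 1 else 0))"
    using diag by (intro sum.cong) (auto dest: atLeastLessThan_iff[THEN iffD1])
  finally have "tr A = of_nat (\<Sum>k = 0..<n. if U $$ (k, k) = 1 then 1 else 0)"
    by (simp only: of_nat_sum)
  then show ?thesis ..
qed

text \<open>The product of the factors \<open>A - u i\<close> for \<open>i < k\<close>, applied to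
  \<open>E\<close>. The second argument is carried along because the ring has no unit from which
  scalars could be formed.\<close>

primrec shifts :: "'i fmat \<Rightarrow> (nat \<Rightarrow> complex) \<Rightarrow> nat \<Rightarrow> 'i fmat \<Rightarrow> 'i fmat"
  where
    "shifts A u 0 E = E"
  | "shifts A u (Suc k) E = A * shifts A u k E - u k \<star> shifts A u k E"

lemma shifts_mult: "shifts A u k (E * F) = shifts A u k E * F"
  by (induction k) (auto simp: algebra_simps)

lemma shifts_supported: "supported I A \<Longrightarrow> supported I E \<Longrightarrow> supported I (shifts A u k E)"
  by (induction k) auto

lemma shifts_eigen: "A * F = c \<star> F \<Longrightarrow> shifts A u k F = (\<Prod>i<k. c - u i) \<star> F"
  by (induction k) (auto simp: smul_distrib[symmetric] algebra_simps)

lemma shifts_commute: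
  "C * A = A * C \<Longrightarrow> C * E = E * C \<Longrightarrow> C * shifts A u k E = shifts A u k E * C"
proof (induction k)
  case (Suc k)
  then show ?case
    by (simp add: algebra_simps) (metis mult.assoc)
qed auto

text \<open>A weak form of the Cayley-Hamilton theorem, by triangularization: each factor kills one more
  row from below.\<close>

lemma ex_annihilating_shifts:
  assumes "finite I" "supported I A"
  obtains u k where "shifts A u k (unit_mat I) = 0"
proof -
  define n where "n = card I"
  obtain e where e: "bij_betw e {0..<n} I"
    using assms(1) ex_bij_betw_nat_finite unfolding n_def by blast
  obtain P U Q where PUQ: "P \<in> carrier_mat n n" "U \<in> carrier_mat n n" "Q \<in> carrier_mat n n"
    "upper_triangular U" "to_mat n e A = P * U * Q" "P * Q = 1\<^sub>m n" "Q * P = 1\<^sub>m n"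
    using complex_schur[of "to_mat n e A" n] by auto
  \<comment> \<open>The diagonal is read from the bottom, so that factor \<open>k\<close> carries
    the diagonal entry of the lowest row not yet known to vanish.\<close>
  define u where "u = (\<lambda>k. U $$ (n - 1 - k, n - 1 - k))"
  have "\<exists>T\<in>carrier_mat n n. to_mat n e (shifts A u k (unit_mat I)) = P * T * Q \<and>
      (\<forall>i j. i < n \<and> n - k \<le> i \<and> j < n \<longrightarrow> T $$ (i, j) = 0)" if "k \<le> n" for k
    using that
  proof (induction k)
    case 0
    have "to_mat n e (unit_mat I) = 1\<^sub>m n"
      using e assms(1) by (intro eq_matI)
        (auto simp: to_mat_def entry_unit_mat bij_betw_def inj_on_def)
    then show ?case using PUQ by (intro bexI[of _ "1\<^sub>m n"]) auto
  next
    case (Suc k)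
    then obtain T where T: "T \<in> carrier_mat n n"
      "to_mat n e (shifts A u k (unit_mat I)) = P * T * Q"
      "\<And>i j. i < n \<Longrightarrow> n - k \<le> i \<Longrightarrow> j < n \<Longrightarrow> T $$ (i, j) = 0"
      by (metis Suc_leD)
    define T' where "T' = U * T - u k \<cdot>\<^sub>m T"
    note [simp] = PUQ(1-3) T(1) and sq = square_mat_simps[where n = n]
    have T'c: "T' \<in> carrier_mat n n" unfolding T'_def by (simp add: sq)
    have "P * U * Q * (P * T * Q) = P * (U * ((Q * P) * (T * Q)))"
      by (simp add: sq)
    then have "to_mat n e (shifts A u (Suc k) (unit_mat I)) = P * (U * (T * Q)) - u k \<cdot>\<^sub>m (P * T * Q)"
      by (simp add: to_mat_diff_smul to_mat_mult[OF e assms(2)] PUQ(5) T(2) PUQ(7) sq)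
    also have "\<dots> = P * T' * Q"
      unfolding T'_def
      by (simp add: sq)
    finally have 1: "to_mat n e (shifts A u (Suc k) (unit_mat I)) = P * T' * Q" .
    have "T' $$ (i, j) = 0" if ij: "i < n" "n - Suc k \<le> i" "j < n" for i j
    proof -
      have "(U * T) $$ (i, j) = (\<Sum>l = 0..<n. U $$ (i, l) * T $$ (l, j))"
        using ij carrier_matD[OF PUQ(2)] carrier_matD[OF T(1)] by (simp add: scalar_prod_def)
      also have "\<dots> = (\<Sum>l = 0..<n. if l = i then U $$ (i, i) * T $$ (i, j) else 0)"
      proof (intro sum.cong refl)
        fix l assume "l \<in> {0..<n}"
        then show "U $$ (i, l) * T $$ (l, j) = (if l = i then U $$ (i, i) * T $$ (i, j) else 0)"
          using ij T(3)[of l j] upper_triangularD[OF PUQ(4), of l i] carrier_matD[OF PUQ(2)]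
          by (cases l i rule: linorder_cases) auto
      qed
      finally have "T' $$ (i, j) = U $$ (i, i) * T $$ (i, j) - u k * T $$ (i, j)"
        using ij carrier_matD[OF T(1)] carrier_matD[OF PUQ(2)] unfolding T'_def by simp
      moreover have "T $$ (i, j) = 0 \<or> u k = U $$ (i, i)"
        using ij T(3)[of i j] Suc.prems unfolding u_def
        by (cases "n - k \<le> i") (auto, metis Suc_diff_Suc diff_Suc_1 diff_Suc_eq_diff_pred le_antisym not_less_eq_eq Suc_le_lessD)
      ultimately show ?thesis by auto
    qed
    then show ?case using 1 T'c by blast
  qed
  from this[of n] obtain T where T: "T \<in> carrier_mat n n"
      "to_mat n e (shifts A u n (unit_mat I)) = P * T * Q"
      "\<And>i j. i < n \<Longrightarrow> j < n \<Longrightarrow> T $$ (i, j) = 0"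
    by auto
  have "T = 0\<^sub>m n n" using T by (intro eq_matI) auto
  then have "to_mat n e (shifts A u n (unit_mat I)) = 0\<^sub>m n n"
    using T PUQ by simp
  then have "shifts A u n (unit_mat I) = 0"
    using to_mat_eq_0[OF e] shifts_supported[OF assms(2)] by simp
  then show ?thesis using that by blast
qed

text \<open>For Hermitian \<open>A\<close>, the last nonvanishing product of shifts is a multiple of the spectral
  projection.\<close>

lemma ex_spectral_projection:
  assumes "finite I" "supported I A" "supported I E"
    and herm: "adj A = A" "adj E = E" "E * E = E" "E * A = A" "A * E = A" and "E \<noteq> 0"
  obtains F c where "F \<noteq> 0" "supported I F" "adj F = F" "F * F = F" "F * E = F" "A * F = c \<star> F"
    "\<And>C. C * A = A * C \<Longrightarrow> C * E = E * C \<Longrightarrow> C * F = F * C"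
proof -
  obtain u k where "shifts A u k (unit_mat I) = 0"
    by (rule ex_annihilating_shifts[OF assms(1,2)])
  then have "shifts A u k (unit_mat I * E) = 0"
    by (simp only: shifts_mult mult_zero_left)
  then have k0: "shifts A u k E = 0"
    by (simp add: unit_mat_mult[OF assms(1,3)])
  \<comment> \<open>The last nonzero product \<open>G\<close> satisfies
    \<open>A * G = u j \<star> G\<close>, because one more factor kills it.\<close>
  define m where "m = (LEAST k. shifts A u k E = 0)"
  have m: "shifts A u m E = 0" "\<And>j. j < m \<Longrightarrow> shifts A u j E \<noteq> 0"
    unfolding m_def using k0 by (auto intro: LeastI dest: not_less_Least)
  obtain j where j: "m = Suc j"
    using m(1) \<open>E \<noteq> 0\<close> by (cases m) auto
  define G where "G = shifts A u j E"
  have comm: "C * G = G * C" if "C * A = A * C" "C * E = E * C" for C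
    unfolding G_def using that by (rule shifts_commute)
  have G: "G \<noteq> 0" "A * G = u j \<star> G" "supported I G"
    using m j shifts_supported assms(2,3) by (auto simp: G_def)
  have GE: "G * E = G" "E * G = G"
    using comm[of E] herm by (auto simp: G_def shifts_mult[symmetric])
  have "A * G = G * A" using comm[of A] herm by simp
  then have adjG: "adj G * A = A * adj G"
    using arg_cong[of "A * G" "G * A" adj] unfolding adj_mult herm by blast
  have "adj G * E = E * adj G"
    using arg_cong[OF GE(1), of adj] arg_cong[OF GE(2), of adj] herm by simp
  then have normal: "adj G * G = G * adj G"
    using comm adjG by blast
  define c where "c = (\<Prod>i<j. u j - u i)"
  have "G * G = shifts A u j (E * G)" by (simp add: G_def shifts_mult)
  then have GG: "G * G = c \<star> G"
    by (simp add: GE shifts_eigen[OF G(2)] c_def)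
  \<comment> \<open>\<open>G\<close> is normal. If its square were 0, the Hermitian matrix
    \<open>adj G * G\<close> would have square 0 and vanish, and with it \<open>G\<close>.\<close>
  have "c \<noteq> 0"
  proof
    assume "c = 0"
    then have "G * G = 0" using GG by simp
    moreover have "adj (adj G * G) * (adj G * G) = adj G * (adj G * G) * G"
      by (simp add: mult.assoc) (metis normal mult.assoc)
    ultimately have "adj (adj G * G) * (adj G * G) = 0"
      by (simp add: mult.assoc)
    then show False using adj_mult_eq_0 G(1) by blast
  qed
  define F where "F = inverse c \<star> G"
  have FF: "F * F = F" using GG \<open>c \<noteq> 0\<close> by (simp add: F_def)
  have nF: "adj F * F = F * adj F" using normal by (simp add: F_def mult.commute)
  have aFF: "adj F * adj F = adj F" using arg_cong[OF FF, of adj] by simp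
  \<comment> \<open>A normal idempotent is Hermitian: the norm of \<open>?Y\<close> is 0, so
    \<open>F = adj F * F\<close>, which is its own adjoint.\<close>
  let ?Y = "F - adj F * F"
  have "adj ?Y * ?Y = adj F * F - adj F * (adj F * F) - adj F * (F * F) + adj F * (F * adj F) * F"
    by (simp add: algebra_simps)
  also have "\<dots> = adj F * F - (adj F * adj F) * F - adj F * (F * F) + (adj F * adj F) * (F * F)"
    unfolding nF[symmetric] by (simp add: mult.assoc)
  also have "\<dots> = 0" by (simp add: FF aFF)
  finally have "F = adj F * F" using adj_mult_eq_0[of ?Y] by simp
  then have adjF: "adj F = F"
    by (metis adj_mult adj_simps(5))
  show ?thesis
  proof (rule that[of F "u j"])
    show "C * F = F * C" if "C * A = A * C" "C * E = E * C" for C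
      using comm[OF that] by (simp add: F_def)
  qed (use G GE FF adjF \<open>c \<noteq> 0\<close> in \<open>auto simp: F_def smul_eq_0 mult.commute\<close>)
qed

section \<open>Characters of finite groups\<close>

text \<open>Any nonzero column of \<open>E\<close> is an eigenvector of \<open>A\<close> for
  \<open>c\<close>, which brings both criteria for integer matrices to bear.\<close>

lemma fmat_eigen_algebraic_int:
  assumes I: "finite I" "supported I A" "supported I E" and int: "\<And>i j. entry A i j \<in> \<int>"
    and "A * E = c \<star> E" "E \<noteq> 0"
  shows "algebraic_int c"
    and "\<lbrakk>c = of_nat p * \<tau>; p > 0; algebraic_int \<tau>; \<tau> \<noteq> 0;
      \<And>i. i \<in> I \<Longrightarrow> (\<Sum>j\<in>I. cmod (entry A i j)) \<le> p\<rbrakk> \<Longrightarrow> cmod \<tau> \<ge> 1"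
proof -
  obtain x y where xy: "entry E x y \<noteq> 0"
    using \<open>E \<noteq> 0\<close> fmat_eqI[of E 0] by auto
  then have xI: "x \<in> I" using I(3) by (auto simp: supported_def)
  define a where "a = (\<lambda>i j. \<lfloor>Re (entry A i j)\<rfloor>)"
  have a: "entry A i j = of_int (a i j)" for i j
    using int[of i j] by (auto simp: a_def elim!: Ints_cases)
  have ev: "c * entry E i y = (\<Sum>j\<in>I. of_int (a i j) * entry E j y)" for i
    using arg_cong[OF assms(5), of "\<lambda>B. entry B i y"] by (simp add: entry_mult[OF I(1,2)] a)
  show "algebraic_int c"
    by (rule algebraic_int_eigenI[where v = "\<lambda>i. entry E i y" and A = a, OF I(1) xI xy ev])
  assume c: "c = of_nat p * \<tau>" and p: "p > 0" "algebraic_int \<tau>" "\<tau> \<noteq> 0"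
    and rows: "\<And>i. i \<in> I \<Longrightarrow> (\<Sum>j\<in>I. cmod (entry A i j)) \<le> p"
  have "(\<Sum>j\<in>I. \<bar>a i j\<bar>) \<le> int p" if "i \<in> I" for i
  proof -
    have "real_of_int (\<Sum>j\<in>I. \<bar>a i j\<bar>) \<le> real_of_int (int p)"
      using rows[OF that] by (simp add: a)
    then show ?thesis by (simp only: of_int_le_iff)
  qed
  then show "cmod \<tau> \<ge> 1"
    using scaled_eigenvalue_norm_ge_1[where v = "\<lambda>i. entry E i y" and A = a, OF I(1) xI xy _ _ p]
      ev by (simp add: c)
qed

lemma sum_cis_powers:
  fixes a :: int
  assumes "r > 0"
  shows "(\<Sum>i<r. cis (2 * pi * a / r) ^ i) = (if int r dvd a then of_nat r else 0)"
proof (cases "int r dvd a")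
  case True
  then obtain b where "a = int r * b" by (elim dvdE)
  then have "2 * pi * a / r = 2 * pi * of_int b"
    using assms by simp
  then have "cis (2 * pi * a / r) = 1"
    by (simp only:) (intro cis_multiple_2pi, simp)
  then show ?thesis using True by simp
next
  case False
  let ?z = "cis (2 * pi * a / r)"
  have "?z ^ r = cis (2 * pi * a)"
    using assms by (simp add: DeMoivre)
  also have "\<dots> = 1" by (intro cis_multiple_2pi) auto
  finally have "?z ^ r = 1" .
  moreover have "?z \<noteq> 1"
  proof
    assume "?z = 1"
    then have "cos (2 * pi * a / r) = 1" by (simp add: complex_eq_iff)
    then obtain b :: int where "2 * pi * a / r = b * 2 * pi"
      by (auto simp: cos_one_2pi_int)
    then have "real_of_int a = real_of_int (int r * b)"
      using assms by (simp add: field_simps)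
    then have "a = int r * b" by (simp only: of_int_eq_iff)
    then show False using False by simp
  qed
  ultimately show ?thesis using False geometric_sum[of ?z r] by simp
qed

locale finite_group = group +
  assumes finite_carrier [simp]: "finite (carrier G)"
begin

text \<open>The left regular representation by permutation matrices: the column of \<open>y\<close>
  has its 1 in the row of \<open>g \<otimes> y\<close>.\<close>

definition rho :: "'a \<Rightarrow> 'a fmat"
  where "rho g = Abs_fmat (\<lambda>x y. if x \<in> carrier G \<and> y \<in> carrier G \<and> x = g \<otimes> y then 1 else 0)"

lemma entry_rho: "entry (rho g) x y = (if x \<in> carrier G \<and> y \<in> carrier G \<and> x = g \<otimes> y then 1 else 0)"
  unfolding rho_def by (subst Abs_fmat_inverse) (auto intro!: exI[of _ "carrier G"])

lemma supported_rho [simp]: "supported (carrier G) (rho g)"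
  by (auto simp: supported_def entry_rho split: if_splits)

lemma rho_one: "rho \<one> = unit_mat (carrier G)"
  by (rule fmat_eqI) (auto simp: entry_rho entry_unit_mat)

lemma rho_mult:
  assumes "g \<in> carrier G" "h \<in> carrier G"
  shows "rho (g \<otimes> h) = rho g * rho h"
proof (rule fmat_eqI)
  fix x y
  have "entry (rho g * rho h) x y
      = (\<Sum>z\<in>carrier G. if z = h \<otimes> y then entry (rho g) x z * of_bool (y \<in> carrier G) else 0)"
    unfolding entry_mult[OF finite_carrier supported_rho]
    by (intro sum.cong) (auto simp: entry_rho)
  also have "\<dots> = entry (rho (g \<otimes> h)) x y"
    using assms by (auto simp: entry_rho m_assoc)
  finally show "entry (rho (g \<otimes> h)) x y = entry (rho g * rho h) x y" ..
qed

lemma adj_rho: "g \<in> carrier G \<Longrightarrow> adj (rho g) = rho (inv g)"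
  by (rule fmat_eqI) (auto simp: entry_rho inv_solve_left m_assoc[symmetric])

lemma tr_rho: "g \<in> carrier G \<Longrightarrow> tr (rho g) = (if g = \<one> then of_nat (card (carrier G)) else 0)"
proof (cases "g = \<one>")
  case False
  assume g: "g \<in> carrier G"
  have "entry (rho g) x x = 0" for x
    using g False by (auto simp: entry_rho)
  then show ?thesis using False by (simp add: tr_def)
qed (simp add: rho_one tr_unit_mat)

definition commuting :: "'a fmat \<Rightarrow> bool"
  where "commuting A \<longleftrightarrow> supported (carrier G) A \<and> (\<forall>g\<in>carrier G. A * rho g = rho g * A)"

definition projection :: "'a fmat \<Rightarrow> bool"
  where "projection E \<longleftrightarrow> commuting E \<and> adj E = E \<and> E * E = E"

text \<open>The images of the projections are the subrepresentations of the regular representation,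
  and \<open>F * E = F\<close> is inclusion of images. Minimality is thus irreducibility, expressed
  without subspaces.\<close>

definition minimal :: "'a fmat \<Rightarrow> bool"
  where "minimal E \<longleftrightarrow> projection E \<and> E \<noteq> 0 \<and> (\<forall>F. projection F \<and> F * E = F \<longrightarrow> F = 0 \<or> F = E)"

lemma rho_unit:
  "rho \<one> * rho g = rho g" "rho g * rho \<one> = rho g"
  "supported (carrier G) A \<Longrightarrow> rho \<one> * A = A" "supported (carrier G) A \<Longrightarrow> A * rho \<one> = A"
  by (simp_all add: rho_one unit_mat_mult)

lemma commuting_simps [intro]:
  "commuting A \<Longrightarrow> commuting B \<Longrightarrow> commuting (A + B)"
  "commuting A \<Longrightarrow> commuting B \<Longrightarrow> commuting (A - B)"
  "commuting A \<Longrightarrow> commuting (c \<star> A)"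
  "commuting 0"
  by (auto simp: commuting_def distrib_left distrib_right left_diff_distrib right_diff_distrib)

lemma commuting_mult [intro]:
  assumes "commuting A" "commuting B"
  shows "commuting (A * B)"
  unfolding commuting_def
proof (intro conjI ballI)
  fix g assume "g \<in> carrier G"
  then have "A * rho g = rho g * A" "B * rho g = rho g * B"
    using assms by (auto simp: commuting_def)
  then have "A * (B * rho g) = rho g * A * B"
    by (simp flip: mult.assoc)
  then show "A * B * rho g = rho g * (A * B)"
    by (simp add: mult.assoc)
qed (use assms in \<open>auto simp: commuting_def\<close>)

lemma commuting_adj [intro]:
  assumes "commuting A"
  shows "commuting (adj A)"
  unfolding commuting_def
proof (intro conjI ballI)
  fix g assume g: "g \<in> carrier G"
  then have "A * rho (inv g) = rho (inv g) * A"
    using assms by (auto simp: commuting_def)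
  from arg_cong[OF this, of adj] show "adj A * rho g = rho g * adj A"
    using g by (simp add: adj_rho)
qed (use assms in \<open>auto simp: commuting_def\<close>)

lemma projection_tr:
  assumes "projection E"
  obtains d :: nat where "tr E = of_nat d" "d = 0 \<longleftrightarrow> E = 0"
proof -
  obtain d :: nat where d: "tr E = of_nat d"
    using idempotent_trace_nat[of "carrier G" E] assms by (auto simp: projection_def commuting_def)
  moreover have "E = 0" if "d = 0"
    using tr_adj_mult_eq_0[of E] assms d that by (simp add: projection_def)
  ultimately show ?thesis using that by fastforce
qed

text \<open>Stands in for complete reducibility. A nonzero projection that is not minimal splits
  into two nonzero orthogonal ones, both with smaller trace, and traces are natural numbers.\<close>

lemma projection_induct:
  assumes "projection E" and min: "\<And>F. minimal F \<Longrightarrow> F * E = F \<Longrightarrow> tr (F * A) = 0"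
  shows "tr (E * A) = 0"
  using assms
proof (induction "nat \<lfloor>Re (tr E)\<rfloor>" arbitrary: E rule: less_induct)
  case less
  show ?case
  proof (cases "E = 0 \<or> minimal E")
    case True
    then show ?thesis using less.prems by (auto simp: projection_def)
  next
    case False
    then obtain F where F: "projection F" "F * E = F" "F \<noteq> 0" "F \<noteq> E"
      using less.prems(1) by (auto simp: minimal_def)
    have E: "adj E = E" "E * E = E" "adj F = F" "F * F = F"
      using less.prems(1) F by (auto simp: projection_def)
    have EF: "E * F = F" using arg_cong[OF F(2), of adj] E by simp
    define F' where "F' = E - F"
    have F': "projection F'" "F' * E = F'" "F' \<noteq> 0"
      using less.prems(1) F EF by (auto simp: projection_def F'_def algebra_simps)
    have sub: "H * E = H" if "H * F = H \<or> H * F' = H" for H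
      using that F(2) F'(2) by (metis mult.assoc)
    have trE: "tr E = tr F + tr F'" by (simp add: F'_def)
    obtain d where d: "tr F = of_nat d" "d \<noteq> 0"
      using projection_tr[OF F(1)] F(3) by metis
    obtain d' where d': "tr F' = of_nat d'" "d' \<noteq> 0"
      using projection_tr[OF F'(1)] F'(3) by metis
    have "nat \<lfloor>Re (tr F)\<rfloor> = d" "nat \<lfloor>Re (tr F')\<rfloor> = d'" "nat \<lfloor>Re (tr E)\<rfloor> = d + d'"
      using trE d d' by (simp_all flip: of_nat_add)
    then have "tr (F * A) = 0" "tr (F' * A) = 0"
      using less.hyps[OF _ F(1)] less.hyps[OF _ F'(1)] less.prems(2) sub d d' by simp_all
    moreover have "E * A = F * A + F' * A" by (simp add: F'_def algebra_simps)
    ultimately show ?thesis by simp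
  qed
qed

text \<open>A spectral projection of \<open>B\<close> inside \<open>E\<close> commutes with
  everything that commutes with \<open>B\<close> and \<open>E\<close>, hence with the group. By
  minimality it is all of \<open>E\<close>.\<close>

lemma schur_hermitian:
  assumes E: "minimal E" and B: "commuting B" "adj B = B" "E * B = B" "B * E = B"
  shows "\<exists>c. B = c \<star> E"
proof -
  have E': "supported (carrier G) E" "adj E = E" "E * E = E" "E \<noteq> 0" "commuting E"
    using E by (auto simp: minimal_def projection_def commuting_def)
  obtain F c where F: "F \<noteq> 0" "supported (carrier G) F" "adj F = F" "F * F = F" "F * E = F"
      "B * F = c \<star> F" "\<And>C. C * B = B * C \<Longrightarrow> C * E = E * C \<Longrightarrow> C * F = F * C"
    by (rule ex_spectral_projection[OF finite_carrier _ E'(1) B(2) E'(2,3) B(3,4) E'(4)])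
      (use B(1) in \<open>simp add: commuting_def\<close>, rule that)
  have "commuting F"
    using F(2,7) B(1) E'(5) by (auto simp: commuting_def)
  then have "F = E"
    using E F unfolding minimal_def projection_def by blast
  then show ?thesis using F(6) B(4) by metis
qed

text \<open>Compression to \<open>E\<close> keeps a matrix in the commutant, and every matrix is a
  combination of the two Hermitian ones \<open>A + adj A\<close> and
  \<open>\<i> \<star> (A - adj A)\<close>. Taking traces identifies the scalar.\<close>

lemma schur:
  assumes E: "minimal E" and A: "commuting A"
  shows "E * A * E = (tr (A * E) / tr E) \<star> E"
proof -
  have E': "adj E = E" "E * E = E" "E \<noteq> 0" "projection E" "commuting E"
    using E by (auto simp: minimal_def projection_def)
  define H where "H = (\<lambda>A. E * A * E)"
  have EH: "E * H A = H A" "H A * E = H A" for A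
    by (simp_all add: H_def mult.assoc[symmetric] E') (simp add: mult.assoc E')
  have adjH: "adj (H A) = H (adj A)" for A
    by (simp add: H_def E' mult.assoc)
  have cH: "commuting (H A)" if "commuting A" for A
    using that E' by (auto simp: H_def)
  let ?A1 = "A + adj A" and ?A2 = "\<i> \<star> (A - adj A)"
  have "commuting ?A1" "commuting ?A2"
    using A by auto
  moreover have "adj ?A1 = ?A1" "adj ?A2 = ?A2"
    by (simp_all add: add.commute smul_distrib)
  ultimately obtain c1 c2 where "H ?A1 = c1 \<star> E" "H ?A2 = c2 \<star> E"
    using schur_hermitian[OF E cH] adjH EH by metis
  moreover have "H A = (1 / 2) \<star> H ?A1 - (\<i> / 2) \<star> H ?A2"
  proof -
    have "A = (1 / 2) \<star> ?A1 - (\<i> / 2) \<star> ?A2"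
      by (rule fmat_eqI) (simp add: algebra_simps)
    then have "H A = H ((1 / 2) \<star> ?A1 - (\<i> / 2) \<star> ?A2)"
      by (rule arg_cong)
    then show ?thesis
      unfolding H_def right_diff_distrib left_diff_distrib smul_mult_left smul_mult_right .
  qed
  ultimately have "H A = (c1 / 2 - \<i> / 2 * c2) \<star> E"
    by (simp add: smul_distrib)
  then obtain c where c: "H A = c \<star> E" by blast
  have "tr (H A) = tr (A * E * E)"
    unfolding H_def by (metis tr_mult_commute mult.assoc)
  then have "tr (A * E) = c * tr E"
    using c by (simp add: E' mult.assoc)
  moreover have "tr E \<noteq> 0"
    using projection_tr[OF E'(4)] E'(3) by (metis of_nat_eq_0_iff)
  ultimately show ?thesis using c by (simp add: H_def)
qed

text \<open>The character of the representation on the image of \<open>E\<close>; its degree is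
  \<open>tr E\<close>.\<close>

definition chi :: "'a fmat \<Rightarrow> 'a \<Rightarrow> complex"
  where "chi E g = tr (rho g * E)"

lemma chi_one: "commuting E \<Longrightarrow> chi E \<one> = tr E"
  by (simp add: chi_def rho_unit commuting_def)

lemma chi_conj:
  assumes "commuting E" "g \<in> carrier G" "x \<in> carrier G"
  shows "chi E (g \<otimes> x \<otimes> inv g) = chi E x"
proof -
  have "rho (g \<otimes> x \<otimes> inv g) * E = (rho g * (rho x * E)) * rho (inv g)"
    using assms by (simp add: rho_mult commuting_def mult.assoc)
  then have "chi E (g \<otimes> x \<otimes> inv g) = tr (rho (inv g) * rho g * (rho x * E))"
    unfolding chi_def by (metis tr_mult_commute mult.assoc)
  also have "rho (inv g) * rho g = rho \<one>"
    using assms by (simp add: rho_mult[symmetric])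
  finally show ?thesis
    using assms by (simp add: chi_def rho_unit commuting_def)
qed

lemma chi_inv:
  assumes "projection E" "g \<in> carrier G"
  shows "chi E (inv g) = cnj (chi E g)"
proof -
  have "cnj (chi E g) = tr (adj (rho g * E))" by (simp only: chi_def tr_simps(6))
  also have "adj (rho g * E) = rho (inv g) * E"
    using assms by (simp add: adj_rho projection_def commuting_def)
  finally show ?thesis by (simp add: chi_def)
qed

text \<open>The eigenvalue multiplicities of \<open>g\<close> on the image of \<open>E\<close> are the ranks of the projections
  \<open>1/r \<Sum> z\<^sup>-\<^sup>i g\<^sup>i\<close>, for \<open>z\<close> ranging over the \<open>r\<close>-th roots of unity.\<close>

lemma chi_powers:
  assumes E: "projection E" and g: "g \<in> carrier G" "g [^] r = \<one>" and r: "r > (0::nat)"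
  obtains w :: "nat \<Rightarrow> nat"
  where "\<And>i. chi E (g [^] i) = (\<Sum>j<r. of_nat (w j) * cis (2 * pi * j / r) ^ i)"
proof -
  have E': "E * E = E" "supported (carrier G) E" "\<And>x. x \<in> carrier G \<Longrightarrow> E * rho x = rho x * E"
    using E by (auto simp: projection_def commuting_def)
  define z where "z = (\<lambda>j::nat. cis (2 * pi * j / r))"
  have zr: "z j ^ r = 1" for j
  proof -
    have "z j ^ r = cis (2 * pi * j)"
      using r by (simp add: z_def DeMoivre)
    also have "\<dots> = 1" by (intro cis_multiple_2pi) auto
    finally show ?thesis .
  qed
  have z0: "z j \<noteq> 0" for j by (simp add: z_def)
  define P where "P = (\<lambda>j. (1 / of_nat r) \<star> (\<Sum>i<r. inverse (z j) ^ i \<star> (rho (g [^] i) * E)))"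
  have shift: "rho g * P j = z j \<star> P j" for j
  proof -
    define f where "f = (\<lambda>i. inverse (z j) ^ i \<star> (rho (g [^] i) * E))"
    have "rho g * f i = z j \<star> f (Suc i)" for i
    proof -
      have "rho g * rho (g [^] i) = rho (g [^] Suc i)"
        using g by (simp only: rho_mult[symmetric] nat_pow_Suc2 nat_pow_closed)
      then show ?thesis
        using z0[of j] by (simp add: f_def mult.assoc[symmetric])
    qed
    then have "rho g * (\<Sum>i<r. f i) = z j \<star> (\<Sum>i<r. f (Suc i))"
      by (simp add: sum_distrib_left smul_sum)
    also have "(\<Sum>i<r. f (Suc i)) = (\<Sum>i<r. f i)"
    proof -
      have "f r = f 0" using g zr[of j] by (simp add: f_def power_inverse)
      then show ?thesis
        using sum.lessThan_Suc_shift[of f r] sum.lessThan_Suc[of f r] by (simp add: add.commute)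
    qed
    finally show ?thesis by (simp add: P_def f_def)
  qed
  have shift_pow: "rho (g [^] i) * P j = z j ^ i \<star> P j" for i j
  proof (induction i)
    case 0
    have "supported (carrier G) (P j)" using E' by (auto simp: P_def)
    then show ?case by (simp add: rho_unit)
  next
    case (Suc i)
    have "rho (g [^] Suc i) * P j = rho (g [^] i) * (rho g * P j)"
      using g by (simp add: rho_mult mult.assoc)
    then show ?case using Suc by (simp add: shift)
  qed
  have EP: "E * P j = P j" for j
    using E' g by (simp add: P_def sum_distrib_left mult.assoc[symmetric]) (simp add: mult.assoc E'(1))
  have "P j * P j = P j" for j
  proof -
    have "P j * P j = (1 / of_nat r) \<star> (\<Sum>i<r. inverse (z j) ^ i \<star> (rho (g [^] i) * (E * P j)))"
      by (subst (1) P_def) (simp add: sum_distrib_right mult.assoc)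
    also have "\<dots> = (1 / of_nat r) \<star> (\<Sum>i<r. P j)"
      using z0[of j] by (simp add: EP shift_pow power_inverse)
    also have "(\<Sum>i<r. P j) = of_nat r \<star> P j"
      by (rule fmat_eqI) simp
    finally show ?thesis using r by simp
  qed
  then have "\<exists>d::nat. tr (P j) = of_nat d" for j
    using idempotent_trace_nat[of "carrier G" "P j"] E' by (auto simp: P_def)
  then obtain w :: "nat \<Rightarrow> nat" where w: "\<And>j. tr (P j) = of_nat (w j)" by metis
  have sumP: "(\<Sum>j<r. P j) = E"
  proof (rule fmat_eqI)
    fix x y
    let ?e = "\<lambda>i. entry (rho (g [^] i) * E) x y"
    have "entry (\<Sum>j<r. P j) x y = (\<Sum>j<r. \<Sum>i<r. inverse (z j) ^ i * (?e i / of_nat r))"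
      by (simp add: P_def sum_divide_distrib)
    also have "\<dots> = (\<Sum>i<r. (\<Sum>j<r. inverse (z j) ^ i) * (?e i / of_nat r))"
      by (subst sum.swap) (simp add: sum_distrib_right sum_divide_distrib)
    also have "\<dots> = (\<Sum>i<r. if i = 0 then entry E x y else 0)"
    proof (intro sum.cong refl)
      fix i assume i: "i \<in> {..<r}"
      have "inverse (z j) ^ i = cis (2 * pi * real_of_int (- int i) / r) ^ j" for j
        by (simp add: z_def DeMoivre mult_ac)
      then have "(\<Sum>j<r. inverse (z j) ^ i) = (if int r dvd - int i then of_nat r else 0)"
        using sum_cis_powers[OF r, of "- int i"] by simp
      also have "int r dvd - int i \<longleftrightarrow> i = 0"
        using i by (auto dest: nat_dvd_not_less)
      finally show "(\<Sum>j<r. inverse (z j) ^ i) * (?e i / of_nat r) = (if i = 0 then entry E x y else 0)"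
        using r E' by (simp add: rho_unit)
    qed
    finally show "entry (\<Sum>j<r. P j) x y = entry E x y" using r by simp
  qed
  have "chi E (g [^] i) = (\<Sum>j<r. of_nat (w j) * z j ^ i)" for i
    unfolding chi_def by (subst sumP[symmetric]) (simp add: sum_distrib_left shift_pow w mult.commute)
  then show ?thesis using that by (simp add: z_def)
qed

lemma algebraic_int_root_of_unity: "r > 0 \<Longrightarrow> algebraic_int (cis (2 * pi * real j / real r))"
proof -
  assume r: "r > 0"
  have "cis (2 * pi * j / r) ^ r = cis (2 * pi * j)"
    using r by (simp add: DeMoivre)
  also have "\<dots> = 1" by (intro cis_multiple_2pi) auto
  finally have "cis (2 * pi * j / r) ^ r = 1" .
  then show ?thesis
    using algebraic_int_root[of 1 "monom 1 r" "cis (2 * pi * j / r)"] r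
    by (simp add: poly_monom degree_monom_eq)
qed

lemma algebraic_int_chi:
  assumes "projection E" "g \<in> carrier G"
  shows "algebraic_int (chi E g)"
proof -
  have pos: "card (carrier G) > 0" using finite_carrier one_closed card_gt_0_iff by blast
  define r where "r = card (carrier G)"
  have r: "r > 0" "g [^] r = \<one>"
    using pos pow_order_eq_1[OF assms(2)] by (simp_all add: r_def Coset.order_def)
  obtain w :: "nat \<Rightarrow> nat"
    where w: "\<And>i. chi E (g [^] i) = (\<Sum>j<r. of_nat (w j) * cis (2 * pi * j / r) ^ i)"
    by (rule chi_powers[OF assms r(2,1)]) (rule that)
  have "chi E g = (\<Sum>j<r. of_nat (w j) * cis (2 * pi * j / r))"
    using w[of 1] assms by simp
  moreover have "algebraic_int (\<Sum>j<r. of_nat (w j) * cis (2 * pi * j / r))"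
    by (intro algebraic_int_sum algebraic_int_mult algebraic_int_root_of_unity r int_imp_algebraic_int) auto
  ultimately show ?thesis by simp
qed

end

section \<open>Averaging matrix units and the norm of an irreducible character\<close>

lift_definition elem_mat :: "'i \<Rightarrow> 'i \<Rightarrow> 'i fmat" is "\<lambda>k l i j. if i = k \<and> j = l then 1 else 0"
  subgoal for k l by (rule exI[of _ "{k, l}"]) auto
  done

lemma supported_elem_mat: "k \<in> I \<Longrightarrow> l \<in> I \<Longrightarrow> supported I (elem_mat k l)"
  by (auto simp: supported_def elem_mat.rep_eq split: if_splits)

lemma entry_mult_elem_mat: "entry (A * elem_mat k l * B) i j = entry A i k * entry B l j"
proof -
  obtain I where I: "finite I" "supported I A" by (rule ex_supported)
  have el: "finite {k, l}" "supported {k, l} (elem_mat k l)" by (auto intro: supported_elem_mat)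
  have 1: "entry (elem_mat k l * B) x j = (if x = k then entry B l j else 0)" for x
    unfolding times_fmat.rep_eq elem_mat.rep_eq by (cases "x = k") (auto simp: conj_commute)
  have "entry (A * elem_mat k l * B) i j = (\<Sum>x\<in>I. entry A i x * (if x = k then entry B l j else 0))"
    by (simp add: mult.assoc entry_mult[OF I] 1)
  also have "\<dots> = entry A i k * entry B l j"
  proof (cases "k \<in> I")
    case False
    then show ?thesis using supported_outside[OF I(2), of i k] by (auto intro!: sum.neutral)
  next
    case True
    then have "(\<Sum>x\<in>I. entry A i x * (if x = k then entry B l j else 0))
        = (\<Sum>x\<in>I. if x = k then entry A i k * entry B l j else 0)"
      by (intro sum.cong) auto
    then show ?thesis using I(1) True by simp
  qed
  finally show ?thesis .
qed

lemma tr_elem_mat_mult: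
  assumes "finite I" "k \<in> I" "l \<in> I"
  shows "tr (elem_mat k l * A) = entry A l k"
proof -
  have 1: "entry (elem_mat k l * A) x y = (if x = k then entry A l y else 0)" for x y
    unfolding times_fmat.rep_eq elem_mat.rep_eq by (cases "x = k") (auto simp: conj_commute)
  have "tr (elem_mat k l * A) = (\<Sum>x | x = k \<and> entry A l k \<noteq> 0. entry A l k)"
    unfolding tr_def 1 by (intro sum.cong) auto
  then show ?thesis by (cases "entry A l k = 0") auto
qed

context finite_group
begin

lemma sum_conj_shift:
  assumes "g \<in> carrier G"
  shows "(\<Sum>h\<in>carrier G. f (g \<otimes> h)) = (\<Sum>h\<in>carrier G. f h)"
proof (rule sum.reindex_bij_witness[of _ "\<lambda>h. inv g \<otimes> h" "\<lambda>h. g \<otimes> h"])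
qed (use assms in \<open>auto simp: m_assoc[symmetric]\<close>)

lemma commuting_average:
  assumes "supported (carrier G) A"
  shows "commuting (\<Sum>g\<in>carrier G. rho g * A * rho (inv g))" (is "commuting ?S")
  unfolding commuting_def
proof (intro conjI ballI)
  fix g assume g: "g \<in> carrier G"
  have "?S * rho g = (\<Sum>h\<in>carrier G. rho (g \<otimes> h) * A * rho (inv (g \<otimes> h))) * rho g"
    using sum_conj_shift[OF g, of "\<lambda>h. rho h * A * rho (inv h)"] by simp
  also have "\<dots> = (\<Sum>h\<in>carrier G. rho g * (rho h * A * rho (inv h)))"
    unfolding sum_distrib_right
  proof (intro sum.cong refl)
    fix h assume h: "h \<in> carrier G"
    have "rho (inv (g \<otimes> h)) * rho g = rho (inv h)"
      using g h by (simp add: rho_mult[symmetric] inv_mult_group m_assoc)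
    then show "rho (g \<otimes> h) * A * rho (inv (g \<otimes> h)) * rho g = rho g * (rho h * A * rho (inv h))"
      using g h by (simp add: rho_mult mult.assoc)
  qed
  finally show "?S * rho g = rho g * ?S" by (simp add: sum_distrib_left)
qed (use assms in auto)

lemma tr_average:
  assumes "commuting E" "supported (carrier G) A"
  shows "tr ((\<Sum>g\<in>carrier G. rho g * A * rho (inv g)) * E) = of_nat (card (carrier G)) * tr (A * E)"
proof -
  have "tr (rho g * A * rho (inv g) * E) = tr (A * E)" if g: "g \<in> carrier G" for g
  proof -
    have "rho g * A * rho (inv g) * E = rho g * (A * E * rho (inv g))"
      using assms(1) g by (simp add: commuting_def mult.assoc)
    then have "tr (rho g * A * rho (inv g) * E) = tr (A * E * (rho (inv g) * rho g))"
      by (metis tr_mult_commute mult.assoc)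
    also have "rho (inv g) * rho g = rho \<one>" using g by (simp add: rho_mult[symmetric])
    finally show ?thesis using assms by (simp add: rho_unit commuting_def)
  qed
  then show ?thesis by (simp add: sum_distrib_right)
qed

text \<open>The average of a matrix unit over the group lies in the commutant, so
  \<open>schur\<close> turns its compression to \<open>E\<close> into a scalar multiple of
  \<open>E\<close>. Reading off entry \<open>k\<close>, \<open>l\<close> and summing over all pairs
  gives the squared norm on one side and a multiple of \<open>tr (E * E) = tr E\<close> on the
  other.\<close>

lemma chi_orthonormal:
  assumes E: "minimal E"
  shows "(\<Sum>g\<in>carrier G. (cmod (chi E g))\<^sup>2) = card (carrier G)"
proof -
  have E': "E * E = E" "commuting E" "projection E" "supported (carrier G) E" "E \<noteq> 0"
    using E by (auto simp: minimal_def projection_def commuting_def)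
  let ?C = "carrier G" and ?n = "of_nat (card (carrier G)) :: complex"
  have trE: "tr E \<noteq> 0" using projection_tr[OF E'(3)] E'(5) by (metis of_nat_eq_0_iff)
  have *: "(\<Sum>g\<in>?C. entry (E * rho g) k k * entry (rho (inv g) * E) l l)
      = ?n / tr E * (entry E l k * entry E k l)" if "k \<in> ?C" "l \<in> ?C" for k l
  proof -
    let ?X = "elem_mat k l"
    have X: "supported ?C ?X" using that by (rule supported_elem_mat)
    let ?S = "\<Sum>g\<in>?C. rho g * ?X * rho (inv g)"
    have "E * ?S * E = (tr (?S * E) / tr E) \<star> E"
      using schur[OF E commuting_average[OF X]] .
    also have "tr (?S * E) = ?n * entry E l k"
      using tr_average[OF E'(2) X] tr_elem_mat_mult[OF finite_carrier that] by simp
    finally have "entry (E * ?S * E) k l = ?n / tr E * (entry E l k * entry E k l)"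
      by simp
    also have "E * ?S * E = (\<Sum>g\<in>?C. (E * rho g) * ?X * (rho (inv g) * E))"
      by (simp add: sum_distrib_left sum_distrib_right mult.assoc)
    finally show ?thesis by (simp add: entry_mult_elem_mat)
  qed
  have "(\<Sum>g\<in>?C. chi E g * cnj (chi E g)) = (\<Sum>g\<in>?C. tr (E * rho g) * tr (rho (inv g) * E))"
  proof (intro sum.cong refl)
    fix g assume g: "g \<in> ?C"
    show "chi E g * cnj (chi E g) = tr (E * rho g) * tr (rho (inv g) * E)"
      unfolding chi_inv[OF E'(3) g, symmetric] unfolding chi_def tr_mult_commute[of "rho g" E] ..
  qed
  also have "\<dots> = (\<Sum>g\<in>?C. \<Sum>k\<in>?C. \<Sum>l\<in>?C. entry (E * rho g) k k * entry (rho (inv g) * E) l l)"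
    using E' by (simp add: tr_eq[OF finite_carrier] sum_product)
  also have "\<dots> = (\<Sum>k\<in>?C. \<Sum>g\<in>?C. \<Sum>l\<in>?C. entry (E * rho g) k k * entry (rho (inv g) * E) l l)"
    by (rule sum.swap)
  also have "\<dots> = (\<Sum>k\<in>?C. \<Sum>l\<in>?C. \<Sum>g\<in>?C. entry (E * rho g) k k * entry (rho (inv g) * E) l l)"
    by (intro sum.cong refl sum.swap)
  also have "\<dots> = (\<Sum>k\<in>?C. \<Sum>l\<in>?C. ?n / tr E * (entry E l k * entry E k l))"
    by (intro sum.cong refl *)
  also have "\<dots> = ?n / tr E * tr (E * E)"
  proof -
    have "tr (E * E) = (\<Sum>k\<in>?C. \<Sum>l\<in>?C. entry E k l * entry E l k)"
      unfolding tr_eq[OF finite_carrier supported_mult[OF E'(4) E'(4)]] entry_mult[OF finite_carrier E'(4)] ..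
    then show ?thesis by (simp only: sum_distrib_left) (intro sum.cong refl, simp only: mult.commute)
  qed
  also have "\<dots> = ?n" using trE by (simp add: E')
  finally have "of_real (\<Sum>g\<in>?C. (cmod (chi E g))\<^sup>2) = (of_real (card ?C) :: complex)"
    by (simp only: of_real_sum complex_norm_square of_real_of_nat_eq)
  then show ?thesis by (simp only: of_real_eq_iff)
qed

lemma commuting_class_sum:
  assumes K: "K \<subseteq> carrier G" and conj: "\<And>g x. g \<in> carrier G \<Longrightarrow> x \<in> K \<Longrightarrow> g \<otimes> x \<otimes> inv g \<in> K"
  shows "commuting (\<Sum>x\<in>K. rho x)"
  unfolding commuting_def
proof (intro conjI ballI)
  fix g assume g: "g \<in> carrier G"
  have "(\<Sum>x\<in>K. rho g * rho x) = (\<Sum>x\<in>K. rho x * rho g)"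
  proof (rule sum.reindex_bij_witness[of _ "\<lambda>x. inv g \<otimes> x \<otimes> g" "\<lambda>x. g \<otimes> x \<otimes> inv g"])
    fix x assume x: "x \<in> K"
    then have xC: "x \<in> carrier G" using K by auto
    show "g \<otimes> x \<otimes> inv g \<in> K" "inv g \<otimes> x \<otimes> g \<in> K"
      using conj[OF g x] conj[of "inv g" x] g x by auto
    show "inv g \<otimes> (g \<otimes> x \<otimes> inv g) \<otimes> g = x" "g \<otimes> (inv g \<otimes> x \<otimes> g) \<otimes> inv g = x"
      using g xC by (simp_all add: m_assoc) (simp_all add: m_assoc[symmetric])
    show "rho (g \<otimes> x \<otimes> inv g) * rho g = rho g * rho x"
      using g xC by (simp add: rho_mult[symmetric] m_assoc)
  qed
  then show "(\<Sum>x\<in>K. rho x) * rho g = rho g * (\<Sum>x\<in>K. rho x)"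
    by (simp add: sum_distrib_left sum_distrib_right)
qed auto

lemma schur_central:
  assumes E: "minimal E" and A: "commuting A" "A * E = E * A"
  shows "A * E = (tr (A * E) / tr E) \<star> E"
proof -
  have "E * E = E" using E by (auto simp: minimal_def projection_def)
  then have "E * A * E = A * E"
    using A(2) by (metis mult.assoc)
  then show ?thesis using schur[OF E A(1)] by simp
qed

lemma minimal_sum_rho_commute:
  assumes "minimal E" "S \<subseteq> carrier G"
  shows "(\<Sum>x\<in>S. rho x) * E = E * (\<Sum>x\<in>S. rho x)"
  unfolding sum_distrib_left sum_distrib_right
  using assms by (intro sum.cong) (auto simp: minimal_def projection_def commuting_def)

text \<open>If \<open>p\<close> divides the degree, \<open>\<chi>(c\<^sup>i)/p\<close> is an algebraic integer, while orthonormality bounds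
  \<open>\<Sum>\<^sub>i \<bar>\<chi>(c\<^sup>i)/p\<bar>\<^sup>2\<close>, a rational number, by a number less than \<open>1\<close>.\<close>

lemma chi_eq_0:
  assumes p: "Factorial_Ring.prime p" "card (carrier G) = p * m" "\<not> p dvd m"
    and c: "c \<in> carrier G" "c [^] p = \<one>"
    and H: "H \<subseteq> carrier G" "card H = m"
    and cover: "\<And>g. g \<in> carrier G \<Longrightarrow> \<exists>h\<in>H. \<exists>j::nat. g = h \<otimes> c [^] j"
    and inj: "\<And>i. 0 < i \<Longrightarrow> i < p \<Longrightarrow> inj_on (\<lambda>h. h \<otimes> c [^] i \<otimes> inv h) H"
    and E: "minimal E" and dvd: "tr E = of_nat (p * d)"
  shows "chi E c = 0"
proof -
  have E': "E * E = E" "commuting E" "projection E" "supported (carrier G) E" "E \<noteq> 0"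
    using E by (auto simp: minimal_def projection_def commuting_def)
  have p1: "1 < p" using p(1) by (rule prime_gt_1_nat)
  have d: "d > 0" using projection_tr[OF E'(3)] E'(5) dvd by (metis gr0I mult_0_right of_nat_eq_0_iff)
  have finH: "finite H" using H(1) finite_carrier finite_subset by blast
  have m: "m > 0" using p(3) by (cases m) auto
  have p0: "p > 0" using p1 by simp
  have "coprime (int m) (int p)"
    using prime_imp_coprime[OF p(1,3)] by (simp add: coprime_commute)
  \<comment> \<open>This combination will turn the integrality of \<open>m * chi / p\<close> and of
    \<open>chi\<close> into that of \<open>chi / p\<close>.\<close>
  then obtain u v where uv: "u * int m + v * int p = 1"
    using bezout_int[of "int m" "int p"] by (auto simp: coprime_iff_gcd_eq_1)
  have ci: "c [^] i \<in> carrier G" for i :: nat using c by simp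
  have bound: "(cmod (chi E (c [^] i)))\<^sup>2 \<le> p" and alg: "algebraic_int (chi E (c [^] i) / of_nat p)"
    if i: "0 < i" "i < p" for i
  proof -
    let ?f = "\<lambda>h. h \<otimes> c [^] i \<otimes> inv h"
    have fH: "?f ` H \<subseteq> carrier G" using H(1) ci by auto
    have chif: "chi E (?f h) = chi E (c [^] i)" if "h \<in> H" for h
      using chi_conj[OF E'(2) _ ci] that H(1) by auto
    \<comment> \<open>Orthonormality restricted to the \<open>m\<close> distinct conjugates of
      \<open>c [^] i\<close>, on all of which the character takes the same value.\<close>
    have "real m * (cmod (chi E (c [^] i)))\<^sup>2 = (\<Sum>h\<in>H. (cmod (chi E (?f h)))\<^sup>2)"
      using chif H(2) by simp
    also have "\<dots> = (\<Sum>g\<in>?f ` H. (cmod (chi E g))\<^sup>2)"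
      using inj[OF i] by (simp add: sum.reindex)
    also have "\<dots> \<le> (\<Sum>g\<in>carrier G. (cmod (chi E g))\<^sup>2)"
      using fH by (intro sum_mono2) auto
    also have "\<dots> = real m * p" by (simp add: chi_orthonormal[OF E] p(2))
    finally show "(cmod (chi E (c [^] i)))\<^sup>2 \<le> p" using m by simp
    \<comment> \<open>The conjugates by elements of \<open>H\<close> already make up the full class:
      the remaining factor of a group element is a power of \<open>c\<close>, which commutes with
      \<open>c [^] i\<close>.\<close>
    have conj: "g \<otimes> x \<otimes> inv g \<in> ?f ` H" if g: "g \<in> carrier G" and x: "x \<in> ?f ` H" for g x
    proof -
      obtain h where h: "h \<in> H" "h \<in> carrier G" "x = ?f h"
        using x H(1) by auto
      obtain h' j where h': "h' \<in> H" "h' \<in> carrier G" "g \<otimes> h = h' \<otimes> c [^] (j::nat)"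
        using cover[of "g \<otimes> h"] g h H(1) by auto
      have "g \<otimes> x \<otimes> inv g = g \<otimes> h \<otimes> c [^] i \<otimes> inv (g \<otimes> h)"
        using g h ci by (simp add: inv_mult_group m_assoc)
      also have "\<dots> = h' \<otimes> (c [^] j \<otimes> c [^] i) \<otimes> inv (c [^] j) \<otimes> inv h'"
        unfolding h'(3) using h' ci by (simp add: inv_mult_group m_assoc)
      also have "c [^] j \<otimes> c [^] i = c [^] i \<otimes> c [^] j"
        using c by (simp add: nat_pow_mult add.commute)
      also have "h' \<otimes> (c [^] i \<otimes> c [^] j) \<otimes> inv (c [^] j) \<otimes> inv h' = ?f h'"
        using h' ci by (simp add: m_assoc)
      finally show ?thesis using h'(1) by blast
    qed
    let ?S = "\<Sum>x\<in>?f ` H. rho x"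
    have "?S * E = (tr (?S * E) / tr E) \<star> E"
      by (intro schur_central[OF E] commuting_class_sum minimal_sum_rho_commute[OF E] fH conj)
    moreover have "tr (?S * E) = of_nat m * chi E (c [^] i)"
      using chif inj[OF i] H(2) by (simp add: sum_distrib_right chi_def[symmetric] sum.reindex)
    moreover have "entry ?S x y \<in> \<int>" for x y
      by (auto simp: entry_rho)
    ultimately have "algebraic_int (of_nat m * chi E (c [^] i) / tr E)"
      using fmat_eigen_algebraic_int(1)[OF finite_carrier _ E'(4) _ _ E'(5)] by (metis supported_sum supported_rho)
    \<comment> \<open>Since \<open>tr E = p * d\<close>, multiplying the class sum eigenvalue by
      \<open>d\<close> leaves \<open>m * chi / p\<close>.\<close>
    then have 1: "algebraic_int (of_nat d * (of_nat m * chi E (c [^] i) / tr E))"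
      by (intro algebraic_int_mult) auto
    have "of_int u * (of_nat d * (of_nat m * chi E (c [^] i) / tr E)) + of_int v * chi E (c [^] i)
        = of_int (u * int m + v * int p) * chi E (c [^] i) / of_nat p"
      using d p1 by (simp add: dvd field_simps)
    moreover have "algebraic_int (of_int u * (of_nat d * (of_nat m * chi E (c [^] i) / tr E)) + of_int v * chi E (c [^] i))"
      by (intro algebraic_int_add algebraic_int_mult[OF _ 1] algebraic_int_mult[OF _ algebraic_int_chi[OF E'(3) ci]]) auto
    ultimately show "algebraic_int (chi E (c [^] i) / of_nat p)"
      by (simp only: uv of_int_1 mult_1)
  qed
  define s where "s = (\<Sum>i\<in>{1..<p}. (cmod (chi E (c [^] i) / of_nat p))\<^sup>2)"
  have s_eq: "of_real s = (\<Sum>i\<in>{1..<p}. (chi E (c [^] i) / of_nat p) * cnj (chi E (c [^] i) / of_nat p))"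
    unfolding s_def of_real_sum complex_norm_square ..
  have "algebraic_int (of_real s :: complex)"
    unfolding s_eq using alg by (intro algebraic_int_sum algebraic_int_mult algebraic_int_cnj) auto
  \<comment> \<open>Expanding in \<open>p\<close>-th roots of unity and summing over all exponents
    below \<open>p\<close>, orthogonality leaves a natural number. The term for exponent 0, which
    \<open>s\<close> omits, is the square of the degree.\<close>
  moreover have "s \<in> \<rat>"
  proof -
    obtain w :: "nat \<Rightarrow> nat"
      where w: "\<And>i. chi E (c [^] i) = (\<Sum>j<p. of_nat (w j) * cis (2 * pi * j / p) ^ i)"
      by (rule chi_powers[OF E'(3) c p0]) (rule that)
    have "(\<Sum>i<p. chi E (c [^] i) * cnj (chi E (c [^] i))) =
        (\<Sum>i<p. \<Sum>j<p. \<Sum>k<p. of_nat (w j * w k) * cis (2 * pi * (int j - int k) / p) ^ i)"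
    proof (intro sum.cong refl)
      fix i
      have "cis (2 * pi * j / p) ^ i * cnj (cis (2 * pi * k / p) ^ i) = cis (2 * pi * (int j - int k) / p) ^ i" for j k :: nat
      proof -
        have "2 * pi * (int j - int k) / p = 2 * pi * j / p + - (2 * pi * k / p)"
          by (simp add: diff_divide_distrib right_diff_distrib)
        then show ?thesis
          by (simp only: complex_cnj_power cis_cnj power_mult_distrib[symmetric] cis_mult)
      qed
      then show "chi E (c [^] i) * cnj (chi E (c [^] i)) =
        (\<Sum>j<p. \<Sum>k<p. of_nat (w j * w k) * cis (2 * pi * (int j - int k) / p) ^ i)"
        unfolding w cnj_sum sum_product by (intro sum.cong refl) (simp add: mult_ac)
    qed
    also have "\<dots> = (\<Sum>j<p. \<Sum>k<p. of_nat (w j * w k) * (\<Sum>i<p. cis (2 * pi * (int j - int k) / p) ^ i))"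
      unfolding sum_distrib_left by (subst sum.swap) (intro sum.cong refl sum.swap)
    also have "\<dots> = of_nat (\<Sum>j<p. \<Sum>k<p. w j * w k * (if int p dvd int j - int k then p else 0))"
      unfolding of_nat_sum sum_cis_powers[OF p0] by (intro sum.cong refl) simp
    finally obtain n :: nat where n: "(\<Sum>i<p. chi E (c [^] i) * cnj (chi E (c [^] i))) = of_nat n" ..
    have "{..<p} = insert 0 {1..<p}" using p1 by auto
    then have "(\<Sum>i\<in>{1..<p}. chi E (c [^] i) * cnj (chi E (c [^] i))) = of_nat n - of_nat (p * d) * of_nat (p * d)"
      using n c dvd by (simp add: chi_one[OF E'(2)] eq_diff_eq add.commute del: of_nat_mult)
    then have "of_real s = (of_nat n - of_nat (p * d) * of_nat (p * d)) / (of_nat p * of_nat p :: complex)"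
      unfolding s_eq by (simp add: sum_divide_distrib[symmetric])
    also have "\<dots> = of_real ((of_nat n - of_nat (p * d) * of_nat (p * d)) / (of_nat p * of_nat p))"
      by simp
    finally have "s = (of_nat n - of_nat (p * d) * of_nat (p * d)) / (of_nat p * of_nat p)"
      by (simp only: of_real_eq_iff)
    then show ?thesis by simp
  qed
  ultimately have "s \<in> \<int>"
    by (intro rational_algebraic_int_is_int) auto
  moreover have "s \<ge> 0" unfolding s_def by (intro sum_nonneg) auto
  \<comment> \<open>There are only \<open>p - 1\<close> terms, each at most
    \<open>1 / p\<close>.\<close>
  moreover have "s < 1"
  proof -
    have "s \<le> (\<Sum>i\<in>{1..<p}. 1 / real p)"
      unfolding s_def
    proof (intro sum_mono)
      fix i assume "i \<in> {1..<p}"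
      then have "(cmod (chi E (c [^] i)))\<^sup>2 \<le> p" using bound by auto
      then show "(cmod (chi E (c [^] i) / of_nat p))\<^sup>2 \<le> 1 / real p"
        using p1 by (simp add: norm_divide power_divide divide_simps power2_eq_square)
    qed
    also have "\<dots> < 1" using p1 by (simp add: field_simps of_nat_diff)
    finally show ?thesis .
  qed
  ultimately have "s = 0" by (auto elim!: Ints_cases)
  then have "(cmod (chi E (c [^] (1::nat)) / of_nat p))\<^sup>2 = 0"
    unfolding s_def using p1 by (subst (asm) sum_nonneg_eq_0_iff) (auto simp del: nat_pow_Suc One_nat_def)
  then show ?thesis using p1 by (simp add: nat_pow_eone[OF c(1)] del: nat_pow_Suc One_nat_def)
qed

section \<open>Conjugacy classes of prime power size\<close>

text \<open>The class sum acts on \<open>E\<close> as the scalar \<open>p * \<tau>\<close>, so the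
  trace is the squared modulus of that scalar times \<open>chi E c\<close>. If \<open>p\<close>
  divides the degree, the last factor vanishes. If not, \<tau> is an algebraic integer, and \<tau>
  \<noteq> 0 would force every element of \<open>K\<close> to act on \<open>E\<close> as the scalar
  \<tau>. Then all quotients of elements of \<open>K\<close> would act trivially, contrary to
  \<open>nontriv\<close>.\<close>

lemma trace_eq_0:
  assumes p: "Factorial_Ring.prime p" "card (carrier G) = p * m" "\<not> p dvd m"
    and c: "c \<in> carrier G" "c [^] p = \<one>"
    and H: "H \<subseteq> carrier G" "card H = m"
    and cover: "\<And>g. g \<in> carrier G \<Longrightarrow> \<exists>h\<in>H. \<exists>j::nat. g = h \<otimes> c [^] j"
    and inj: "\<And>i. 0 < i \<Longrightarrow> i < p \<Longrightarrow> inj_on (\<lambda>h. h \<otimes> c [^] i \<otimes> inv h) H"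
    and K: "K \<subseteq> carrier G" "card K = p"
    and conj: "\<And>g x. g \<in> carrier G \<Longrightarrow> x \<in> K \<Longrightarrow> g \<otimes> x \<otimes> inv g \<in> K"
    and trans: "\<And>x y. x \<in> K \<Longrightarrow> y \<in> K \<Longrightarrow> \<exists>g\<in>carrier G. g \<otimes> x \<otimes> inv g = y"
    and E: "minimal E"
    and nontriv: "\<not> (\<forall>x\<in>K. \<forall>y\<in>K. rho (x \<otimes> inv y) * E = E)"
  shows "tr (E * ((\<Sum>x\<in>K. rho x) * adj (\<Sum>x\<in>K. rho x) * rho c)) = 0"
proof -
  have E': "E * E = E" "commuting E" "projection E" "supported (carrier G) E" "E \<noteq> 0" "adj E = E"
    using E by (auto simp: minimal_def projection_def commuting_def)
  have p0: "p > 0" using prime_gt_0_nat[OF p(1)] .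
  have xC: "x \<in> carrier G" if "x \<in> K" for x using that K by auto
  have finK: "finite K" using K(2) p0 card_gt_0_iff by metis
  obtain z where z: "z \<in> K" using K(2) p0 by (metis card.empty equals0I less_numeral_extra(3))
  let ?S = "\<Sum>x\<in>K. rho x"
  obtain d :: nat where d: "tr E = of_nat d" "d \<noteq> 0"
    using projection_tr[OF E'(3)] E'(5) by metis
  define \<tau> where "\<tau> = chi E z / of_nat d"
  have chiK: "chi E x = of_nat d * \<tau>" if x: "x \<in> K" for x
  proof -
    obtain g where "g \<in> carrier G" "g \<otimes> z \<otimes> inv g = x"
      using trans[OF z x] by blast
    then show ?thesis
      using chi_conj[OF E'(2) _ xC[OF z]] d by (auto simp: \<tau>_def)
  qed
  have SE: "?S * E = (of_nat p * \<tau>) \<star> E"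
  proof -
    have "tr (?S * E) = (\<Sum>x\<in>K. chi E x)"
      by (simp add: sum_distrib_right chi_def)
    then have "tr (?S * E) = of_nat d * (of_nat p * \<tau>)"
      using chiK K(2) by simp
    then show ?thesis
      using schur_central[OF E commuting_class_sum[OF K(1) conj] minimal_sum_rho_commute[OF E K(1)]] d
      by simp
  qed
  have ES: "E * ?S = (of_nat p * \<tau>) \<star> E"
    using SE minimal_sum_rho_commute[OF E K(1)] by simp
  have "E * adj ?S = cnj (of_nat p * \<tau>) \<star> E"
    using arg_cong[OF SE, of adj] by (simp only: adj_mult adj_simps E'(6))
  then have "E * (?S * adj ?S * rho c) = (of_nat p * \<tau> * cnj (of_nat p * \<tau>)) \<star> (E * rho c)"
    by (simp only: mult.assoc[symmetric] ES smul_mult_left) simp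
  then have goal: "tr (E * (?S * adj ?S * rho c)) = of_nat p * \<tau> * cnj (of_nat p * \<tau>) * chi E c"
    by (simp only: tr_simps chi_def tr_mult_commute[of E])
  show ?thesis
  proof (cases "p dvd d")
    case True
    then obtain d' where "d = p * d'" by (elim dvdE)
    then have "chi E c = 0"
      using chi_eq_0[OF p c H cover inj E] d by metis
    then show ?thesis by (simp only: goal mult_zero_right)
  next
    case False
    have int: "entry ?S i j \<in> \<int>" for i j by (auto simp: entry_rho)
    have supp: "supported (carrier G) ?S" by simp
    have alg_p: "algebraic_int (of_nat p * \<tau>)"
      using fmat_eigen_algebraic_int(1)[OF finite_carrier supp E'(4) int SE E'(5)] .
    have alg: "algebraic_int \<tau>"
    proof -
      have "coprime (int d) (int p)"
        using prime_imp_coprime[OF p(1) False] by (simp add: coprime_commute)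
      then obtain u v where uv: "u * int d + v * int p = 1"
        using bezout_int[of "int d" "int p"] by (auto simp: coprime_iff_gcd_eq_1)
      \<comment> \<open>Both \<open>d * \<tau>\<close>, a character value, and
        \<open>p * \<tau>\<close>, a class sum eigenvalue, are algebraic integers, and
        \<open>d\<close> is coprime to \<open>p\<close>.\<close>
      have "of_int u * chi E z + of_int v * (of_nat p * \<tau>) = of_int (u * int d + v * int p) * \<tau>"
        by (simp add: chiK[OF z] algebra_simps)
      moreover have "algebraic_int (of_int u * chi E z + of_int v * (of_nat p * \<tau>))"
        by (intro algebraic_int_add algebraic_int_mult[OF _ alg_p]
            algebraic_int_mult[OF _ algebraic_int_chi[OF E'(3) xC[OF z]]]) auto
      ultimately show ?thesis by (simp only: uv of_int_1 mult_1)
    qed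
    have "\<tau> = 0"
    proof (rule ccontr)
      assume \<tau>0: "\<tau> \<noteq> 0"
      \<comment> \<open>Each \<open>rho x\<close> has a single 1 in every row, and the class has
        \<open>p\<close> elements.\<close>
      have rows: "(\<Sum>j\<in>carrier G. cmod (entry ?S i j)) \<le> p" if i: "i \<in> carrier G" for i
      proof -
        have one: "(\<Sum>j\<in>carrier G. cmod (entry (rho x) i j)) \<le> 1" if x: "x \<in> K" for x
        proof -
          have "(\<Sum>j\<in>carrier G. cmod (entry (rho x) i j)) = (\<Sum>j\<in>carrier G. if j = inv x \<otimes> i then 1 else 0)"
            using i xC[OF x] by (intro sum.cong) (auto simp: entry_rho m_assoc[symmetric])
          then show ?thesis by simp
        qed
        have "(\<Sum>j\<in>carrier G. cmod (entry ?S i j)) \<le> (\<Sum>j\<in>carrier G. \<Sum>x\<in>K. cmod (entry (rho x) i j))"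
          by (intro sum_mono) (simp add: norm_sum)
        also have "\<dots> = (\<Sum>x\<in>K. \<Sum>j\<in>carrier G. cmod (entry (rho x) i j))"
          by (rule sum.swap)
        also have "\<dots> \<le> (\<Sum>x\<in>K. 1)" by (intro sum_mono one)
        finally show ?thesis using K(2) by simp
      qed
      have ge1: "cmod \<tau> \<ge> 1"
        using fmat_eigen_algebraic_int(2)[OF finite_carrier supp E'(4) int SE E'(5) refl p0 alg \<tau>0 rows] .
      \<comment> \<open>The squared norm of \<open>Y x\<close> is
        \<open>d * (1 - (cmod \<tau>)\<^sup>2)\<close>. It cannot be negative, and
        \<open>ge1\<close> makes it at most 0, so \<open>Y x\<close> vanishes.\<close>
      define Y where "Y = (\<lambda>x. rho x * E - \<tau> \<star> E)"
      have trY: "tr (adj (Y x) * Y x) = of_real (d * (1 - (cmod \<tau>)\<^sup>2))" if x: "x \<in> K" for x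
      proof -
        have "rho (inv x) * rho x = rho \<one>"
          using xC[OF x] by (simp add: rho_mult[symmetric])
        then have 1: "E * rho (inv x) * (rho x * E) = E"
          using E' by (metis mult.assoc rho_unit(3))
        have "adj (Y x) = E * rho (inv x) - cnj \<tau> \<star> E"
          by (simp add: Y_def E' adj_rho xC[OF x])
        then have "adj (Y x) * Y x = E - \<tau> \<star> (E * rho (inv x) * E) - cnj \<tau> \<star> (E * rho x * E) + (\<tau> * cnj \<tau>) \<star> E"
          by (simp add: Y_def algebra_simps 1[unfolded mult.assoc] E' smul_distrib)
        moreover have "tr (E * rho y * E) = chi E y" for y
          unfolding chi_def by (metis tr_mult_commute mult.assoc E'(1))
        ultimately have "tr (adj (Y x) * Y x) = of_nat d - \<tau> * cnj (of_nat d * \<tau>) - cnj \<tau> * (of_nat d * \<tau>)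
            + \<tau> * cnj \<tau> * of_nat d"
          using chi_inv[OF E'(3) xC[OF x]] by (simp add: chiK[OF x] d)
        also have "\<dots> = of_nat d * (1 - \<tau> * cnj \<tau>)"
          by (simp add: algebra_simps)
        also have "\<dots> = of_real (d * (1 - (cmod \<tau>)\<^sup>2))"
          by (simp only: complex_norm_square[symmetric] of_real_mult of_real_diff of_real_1 of_real_of_nat_eq)
        finally show ?thesis .
      qed
      have Re0: "Re (tr (adj (Y x) * Y x)) = 0" if "x \<in> K" for x
      proof -
        have "d * (1 - (cmod \<tau>)\<^sup>2) \<le> 0"
          using ge1 by (intro mult_nonneg_nonpos) (auto simp: one_le_power)
        then show ?thesis using trY[OF that] tr_adj_mult_nonneg(1)[of "Y x"] by simp
      qed
      have Y0: "rho x * E = \<tau> \<star> E" if "x \<in> K" for x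
        using tr_adj_mult_eq_0[OF Re0[OF that]] by (simp add: Y_def)
      have "rho (x \<otimes> inv y) * E = E" if x: "x \<in> K" and y: "y \<in> K" for x y
      proof -
        have "rho (inv y) * rho y = rho \<one>"
          using xC[OF y] by (simp add: rho_mult[symmetric])
        then have "E = rho (inv y) * (rho y * E)"
          using E' by (metis mult.assoc rho_unit(3))
        then have "E = \<tau> \<star> (rho (inv y) * E)" by (simp add: Y0[OF y])
        moreover have "rho (x \<otimes> inv y) * E = rho x * (rho (inv y) * E)"
          using xC x y by (simp add: rho_mult mult.assoc)
        ultimately have "\<tau> \<star> (rho (x \<otimes> inv y) * E) = \<tau> \<star> E"
          by (metis Y0[OF x] smul_mult_right)
        then show ?thesis using smul_cancel[OF \<tau>0] by blast
      qed
      then show False using nontriv by blast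
    qed
    then show ?thesis by (simp only: goal mult_zero_right mult_zero_left)
  qed
qed

text \<open>The trace of \<open>?A\<close> is computed twice. In the regular representation it
  counts the pairs with \<open>x \<otimes> inv y \<otimes> c = \<one>\<close>. By
  \<open>trace_eq_0\<close> only the \<open>D\<close>-fixed part contributes, and there all
  \<open>p * p\<close> summands of \<open>?A\<close> act trivially. Comparing gives
  \<open>N * card D = p * p\<close>; the order of \<open>D\<close> exceeds 1 because of
  \<open>c\<close>, and it cannot be \<open>p * p\<close> by Lagrange.\<close>

theorem card_generate_quotients_of_class:
  assumes p: "Factorial_Ring.prime p" "card (carrier G) = p * m" "\<not> p dvd m"
    and c: "c \<in> carrier G" "c [^] p = \<one>" "c \<noteq> \<one>"
    and H: "H \<subseteq> carrier G" "card H = m"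
    and cover: "\<And>g. g \<in> carrier G \<Longrightarrow> \<exists>h\<in>H. \<exists>j::nat. g = h \<otimes> c [^] j"
    and inj: "\<And>i. 0 < i \<Longrightarrow> i < p \<Longrightarrow> inj_on (\<lambda>h. h \<otimes> c [^] i \<otimes> inv h) H"
    and K: "K \<subseteq> carrier G" "card K = p"
    and conj: "\<And>g x. g \<in> carrier G \<Longrightarrow> x \<in> K \<Longrightarrow> g \<otimes> x \<otimes> inv g \<in> K"
    and trans: "\<And>x y. x \<in> K \<Longrightarrow> y \<in> K \<Longrightarrow> \<exists>g\<in>carrier G. g \<otimes> x \<otimes> inv g = y"
    and D: "subgroup D G" "c \<in> D"
    and normal: "\<And>g d. g \<in> carrier G \<Longrightarrow> d \<in> D \<Longrightarrow> g \<otimes> d \<otimes> inv g \<in> D"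
    and quot: "\<And>x y. x \<in> K \<Longrightarrow> y \<in> K \<Longrightarrow> x \<otimes> inv y \<in> D"
    and gen: "\<And>E. subgroup E G \<Longrightarrow> (\<And>x y. x \<in> K \<Longrightarrow> y \<in> K \<Longrightarrow> x \<otimes> inv y \<in> E) \<Longrightarrow> D \<subseteq> E"
  shows "card D = p"
proof -
  have p0: "p > 0" using prime_gt_0_nat[OF p(1)] .
  have DC: "D \<subseteq> carrier G" using D(1) subgroup.subset by blast
  have finD: "finite D" using DC finite_carrier finite_subset by blast
  have D0: "card D > 0" using D finD card_gt_0_iff by blast
  have finK: "finite K" using K(2) p0 card_gt_0_iff by metis
  let ?S = "\<Sum>x\<in>K. rho x"
  let ?A = "?S * adj ?S * rho c"
  \<comment> \<open>The projection onto the vectors fixed by \<open>D\<close>, which is central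
    because \<open>D\<close> is normal.\<close>
  define Q where "Q = (1 / of_nat (card D)) \<star> (\<Sum>d\<in>D. rho d)"
  have absorb: "rho d * Q = Q" if d: "d \<in> D" for d
  proof -
    have "(\<Sum>e\<in>D. rho (d \<otimes> e)) = (\<Sum>e\<in>D. rho e)"
      by (rule sum.reindex_bij_witness[of _ "\<lambda>e. inv d \<otimes> e" "\<lambda>e. d \<otimes> e"])
        (use d D(1) DC in \<open>auto simp: m_assoc[symmetric] subgroup.m_closed subgroup.m_inv_closed subset_eq\<close>)
    moreover have "(\<Sum>e\<in>D. rho d * rho e) = (\<Sum>e\<in>D. rho (d \<otimes> e))"
      using d DC by (intro sum.cong refl) (auto simp: rho_mult subset_eq)
    ultimately show ?thesis by (simp add: Q_def sum_distrib_left)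
  qed
  have "(\<Sum>d\<in>D. rho d) * Q = of_nat (card D) \<star> Q"
  proof -
    have "(\<Sum>d\<in>D. rho d) * Q = (\<Sum>d\<in>D. Q)" by (simp add: sum_distrib_right absorb)
    also have "\<dots> = of_nat (card D) \<star> Q" by (rule fmat_eqI) simp
    finally show ?thesis .
  qed
  then have QQ: "Q * Q = Q"
    using D0 by (subst (1) Q_def) simp
  have Qc: "commuting Q"
    unfolding Q_def by (intro commuting_simps commuting_class_sum DC normal)
  have adjQ: "adj Q = Q"
  proof -
    have "(\<Sum>d\<in>D. adj (rho d)) = (\<Sum>d\<in>D. rho (inv d))"
      using DC by (intro sum.cong refl) (auto simp: adj_rho)
    also have "\<dots> = (\<Sum>d\<in>D. rho d)"
      by (rule sum.reindex_bij_witness[of _ "\<lambda>e. inv e" "\<lambda>e. inv e"])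
        (use D(1) DC in \<open>auto simp: subgroup.m_inv_closed subset_eq\<close>)
    finally show ?thesis by (simp add: Q_def)
  qed
  define E0 where "E0 = rho \<one> - Q"
  have one: "commuting (rho \<one>)" "adj (rho \<one>) = rho \<one>" "rho \<one> * rho \<one> = rho \<one>"
    by (auto simp: commuting_def rho_unit adj_rho)
  have supQ: "supported (carrier G) Q" using Qc by (simp add: commuting_def)
  have E0: "projection E0"
    unfolding projection_def E0_def using one Qc adjQ QQ rho_unit(3,4)[OF supQ] by (auto simp: algebra_simps)
  have "tr (E0 * ?A) = 0"
  proof (rule projection_induct[OF E0])
    fix F assume F: "minimal F" "F * E0 = F"
    have F': "F \<noteq> 0" "supported (carrier G) F" "commuting F"
      using F(1) by (auto simp: minimal_def projection_def commuting_def)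
    have FQ: "F * Q = 0"
      using F(2) rho_unit(4)[OF F'(2)] by (simp add: E0_def right_diff_distrib)
    have "\<not> (\<forall>x\<in>K. \<forall>y\<in>K. rho (x \<otimes> inv y) * F = F)"
    proof
      assume *: "\<forall>x\<in>K. \<forall>y\<in>K. rho (x \<otimes> inv y) * F = F"
      \<comment> \<open>The elements acting trivially on \<open>F\<close> would form a subgroup
        containing all quotients, hence \<open>D\<close>. Then \<open>Q\<close> would fix
        \<open>F\<close>, although \<open>F\<close> lies under the complement \<open>E0\<close> of
        \<open>Q\<close>.\<close>
      let ?E = "{g \<in> carrier G. rho g * F = F}"
      have sub: "subgroup ?E G"
      proof
        fix g h assume "g \<in> ?E" "h \<in> ?E"
        then show "g \<otimes> h \<in> ?E" by (simp add: rho_mult mult.assoc)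
      next
        fix g assume g: "g \<in> ?E"
        then have "rho (inv g) * (rho g * F) = rho (inv g \<otimes> g) * F"
          by (simp only: rho_mult mult.assoc inv_closed mem_Collect_eq)
        then show "inv g \<in> ?E" using g F'(2) by (simp add: rho_unit)
      qed (use F'(2) in \<open>auto simp: rho_unit\<close>)
      have "D \<subseteq> ?E"
        by (rule gen[OF sub]) (use * K(1) in \<open>auto simp: subset_eq\<close>)
      then have "Q * F = (1 / of_nat (card D)) \<star> (\<Sum>d\<in>D. F)"
        unfolding Q_def by (simp add: sum_distrib_right subset_eq)
      also have "(\<Sum>d\<in>D. F) = of_nat (card D) \<star> F" by (rule fmat_eqI) simp
      finally have "Q * F = F" using D0 by simp
      moreover have "Q * F = F * Q"
        using minimal_sum_rho_commute[OF F(1) DC] by (simp add: Q_def)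
      ultimately show False using FQ F'(1) by simp
    qed
    then show "tr (F * ?A) = 0"
      using trace_eq_0[OF p c(1,2) H cover inj K conj trans F(1)] by blast
  qed
  moreover have "rho \<one> * ?A = ?A" by (intro rho_unit supported_mult) auto
  ultimately have tr_eq: "tr ?A = tr (Q * ?A)"
    by (simp add: E0_def left_diff_distrib)
  have A: "?A = (\<Sum>x\<in>K. \<Sum>y\<in>K. rho (x \<otimes> inv y \<otimes> c))"
  proof -
    have "adj ?S = (\<Sum>y\<in>K. rho (inv y))"
      using K by (auto simp: adj_rho intro!: sum.cong)
    then have "?A = (\<Sum>x\<in>K. \<Sum>y\<in>K. rho x * rho (inv y)) * rho c"
      by (simp only: sum_product)
    also have "\<dots> = (\<Sum>x\<in>K. \<Sum>y\<in>K. rho x * rho (inv y) * rho c)"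
      by (simp only: sum_distrib_right)
    also have "\<dots> = (\<Sum>x\<in>K. \<Sum>y\<in>K. rho (x \<otimes> inv y \<otimes> c))"
      using K(1) c(1) by (intro sum.cong refl) (auto simp: rho_mult subset_eq)
    finally show ?thesis .
  qed
  have Dc: "x \<otimes> inv y \<otimes> c \<in> D" if "x \<in> K" "y \<in> K" for x y
    using quot[OF that] D subgroup.m_closed by metis
  define N where "N = card {(x, y). x \<in> K \<and> y \<in> K \<and> x \<otimes> inv y \<otimes> c = \<one>}"
  have 1: "tr ?A = of_nat (N * card (carrier G))"
  proof -
    let ?P = "\<lambda>(x, y). x \<otimes> inv y \<otimes> c = \<one>"
    have "tr ?A = (\<Sum>s\<in>K \<times> K. tr (rho (fst s \<otimes> inv snd s \<otimes> c)))"
      unfolding A sum.cartesian_product tr_sum by (simp add: case_prod_beta)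
    also have "\<dots> = (\<Sum>s\<in>K \<times> K. if ?P s then of_nat (card (carrier G)) else 0)"
      using K(1) c(1) by (intro sum.cong refl) (auto simp: tr_rho subset_eq)
    also have "\<dots> = (\<Sum>s\<in>{s \<in> K \<times> K. ?P s}. of_nat (card (carrier G)))"
      using finK by (intro sum.inter_filter[symmetric]) auto
    also have "{s \<in> K \<times> K. ?P s} = {(x, y). x \<in> K \<and> y \<in> K \<and> x \<otimes> inv y \<otimes> c = \<one>}" by auto
    finally show ?thesis by (simp add: N_def)
  qed
  have "Q * rho d = Q" if "d \<in> D" for d
    using absorb[OF that] Qc that DC by (auto simp: commuting_def)
  then have "Q * ?A = (\<Sum>x\<in>K. \<Sum>y\<in>K. Q)"
    unfolding A sum_distrib_left by (intro sum.cong refl) (use Dc in auto)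
  then have "tr (Q * ?A) = of_nat (p * p) * tr Q" by (simp add: K(2))
  \<comment> \<open>In the regular representation only the identity has nonzero trace.\<close>
  also have "tr Q = 1 / of_nat (card D) * (\<Sum>d\<in>D. if d = \<one> then of_nat (card (carrier G)) else 0)"
    unfolding Q_def tr_simps tr_sum using DC by (intro arg_cong2[where f = times] sum.cong refl tr_rho) auto
  also have "(\<Sum>d\<in>D. if d = \<one> then of_nat (card (carrier G)) else (0::complex)) = of_nat (card (carrier G))"
    using subgroup.one_closed[OF D(1)] finD by simp
  finally have "(of_nat (N * card (carrier G) * card D) :: complex) = of_nat (p * p * card (carrier G))"
    using tr_eq 1 D0 by (simp add: field_simps)
  then have "N * card (carrier G) * card D = p * p * card (carrier G)" by (simp only: of_nat_eq_iff)
  moreover have "card (carrier G) > 0" using finite_carrier one_closed card_gt_0_iff by blast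
  ultimately have "N * card D = p * p" by (simp only: mult.commute[of _ "card (carrier G)"] mult.assoc)
    (metis mult_left_cancel not_gr0)
  then have "card D dvd p ^ 2" by (metis dvd_triv_right power2_eq_square)
  then obtain k where k: "k \<le> 2" "card D = p ^ k"
    using divides_primepow_nat[OF p(1)] by blast
  have "card D \<noteq> 1"
  proof
    assume "card D = 1"
    then obtain a where "D = {a}" by (rule card_1_singletonE)
    then show False using subgroup.one_closed[OF D(1)] D(2) c(3) by auto
  qed
  then have "k \<noteq> 0" using k by auto
  moreover have "k \<noteq> 2"
  proof
    assume "k = 2"
    then have "p * p dvd p * m"
      using lagrange[OF D(1)] k p(2) by (simp add: Coset.order_def power2_eq_square) (metis dvd_triv_right)
    then show False using p(3) p0 by simp
  qed
  ultimately have "k = 1" using k(1) by linarith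
  then show ?thesis using k by simp
qed

end

section \<open>Permutations and finite quandles\<close>

text \<open>Unlike in \<open>BijGroup\<close>, elements are total functions that move only points of
  \<open>S\<close>, so multiplication is plain composition and powers are \<open>^^\<close>.\<close>

definition perms_on :: "'a set \<Rightarrow> ('a \<Rightarrow> 'a) monoid"
  where "perms_on S = \<lparr>carrier = {f. f permutes S}, monoid.mult = (\<circ>), one = id\<rparr>"

lemma perms_on_simps [simp]:
  "carrier (perms_on S) = {f. f permutes S}" "f \<otimes>\<^bsub>perms_on S\<^esub> g = f \<circ> g" "\<one>\<^bsub>perms_on S\<^esub> = id"
  by (simp_all add: perms_on_def)

abbreviation finv :: "('a \<Rightarrow> 'a) \<Rightarrow> 'a \<Rightarrow> 'a"
  where "finv \<equiv> inv_into UNIV"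

lemma group_perms_on: "group (perms_on S)"
proof (rule groupI)
  fix f assume "f \<in> carrier (perms_on S)"
  then show "\<exists>g\<in>carrier (perms_on S). g \<otimes>\<^bsub>perms_on S\<^esub> f = \<one>\<^bsub>perms_on S\<^esub>"
    by (auto intro!: exI[of _ "finv f"] simp: permutes_inv permutes_inv_o)
qed (auto simp: permutes_compose permutes_id o_assoc)

lemma inv_perms_on [simp]: "f permutes S \<Longrightarrow> inv\<^bsub>perms_on S\<^esub> f = finv f"
  by (rule group.inv_equality[OF group_perms_on]) (auto simp: permutes_inv permutes_inv_o)

lemma pow_perms_on_carrier [simp]: "f [^]\<^bsub>perms_on S\<lparr>carrier := A\<rparr>\<^esub> (n :: nat) = f ^^ n"
  by (induction n) (simp_all add: nat_pow_def perms_on_def funpow_Suc_right del: funpow.simps(2))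

lemma finite_perms_on: "finite S \<Longrightarrow> finite (carrier (perms_on S))"
  by (simp add: finite_permutations)

context quandle
begin

definition closed :: "'a set \<Rightarrow> bool"
  where "closed S \<longleftrightarrow> S \<subseteq> carrier Q \<and> (\<forall>a\<in>carrier Q. \<forall>x\<in>S. a \<triangleright> x \<in> S)"

definition L :: "'a \<Rightarrow> 'a \<Rightarrow> 'a"
  where "L a = (\<lambda>b. if b \<in> carrier Q then a \<triangleright> b else b)"

lemma L_apply: "b \<in> carrier Q \<Longrightarrow> L a b = a \<triangleright> b"
  by (simp add: L_def)

lemma L_permutes: "a \<in> carrier Q \<Longrightarrow> L a permutes carrier Q"
proof (rule bij_imp_permutes)
  assume a: "a \<in> carrier Q"
  have "bij_betw (L a) (carrier Q) (carrier Q) \<longleftrightarrow> bij_betw (\<lambda>b. a \<triangleright> b) (carrier Q) (carrier Q)"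
    by (rule bij_betw_cong) (simp add: L_def)
  then show "bij_betw (L a) (carrier Q) (carrier Q)" using left_translation_bij[OF a] by simp
qed (simp add: L_def)

text \<open>The orbit of a point under the left multiplication group is closed under left
  translations.\<close>

lemma connectedI:
  assumes "\<And>S. closed S \<Longrightarrow> S \<noteq> {} \<Longrightarrow> S = carrier Q"
  shows "connected_quandle Q"
proof
  fix a b assume ab: "a \<in> carrier Q" "b \<in> carrier Q"
  interpret B: group "BijGroup (carrier Q)" by (rule group_BijGroup)
  have lt: "left_translation Q x \<in> carrier (BijGroup (carrier Q))" if "x \<in> carrier Q" for x
    using left_translation_bij[OF that]
    by (auto simp: BijGroup_def Bij_def left_translation_def cong: bij_betw_cong)
  have sub: "left_mult_group Q \<subseteq> carrier (BijGroup (carrier Q))"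
    unfolding left_mult_group_def by (rule B.generate_incl) (auto intro: lt)
  let ?S = "{h a | h. h \<in> left_mult_group Q}"
  have inC: "h x \<in> carrier Q" if "h \<in> left_mult_group Q" "x \<in> carrier Q" for h x
    using that sub by (auto simp: BijGroup_def Bij_def bij_betw_def)
  have "closed ?S"
    unfolding closed_def
  proof (intro conjI ballI)
    fix c x assume c: "c \<in> carrier Q" and "x \<in> ?S"
    then obtain h where h: "h \<in> left_mult_group Q" "x = h a" by blast
    have lc: "left_translation Q c \<in> left_mult_group Q"
      unfolding left_mult_group_def using c by (intro generate.incl) auto
    then have "left_translation Q c \<otimes>\<^bsub>BijGroup (carrier Q)\<^esub> h \<in> left_mult_group Q"
      using h unfolding left_mult_group_def by (intro generate.eng)
    moreover have "(left_translation Q c \<otimes>\<^bsub>BijGroup (carrier Q)\<^esub> h) a = c \<triangleright> x"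
      using lc h sub ab(1) inC[OF h(1) ab(1)]
      by (auto simp: BijGroup_def compose_def left_translation_def subset_eq)
    ultimately show "c \<triangleright> x \<in> ?S" by (metis (mono_tags, lifting) mem_Collect_eq)
  qed (use inC ab in auto)
  moreover have "a \<in> ?S"
  proof -
    have "\<one>\<^bsub>BijGroup (carrier Q)\<^esub> \<in> left_mult_group Q"
      unfolding left_mult_group_def by (rule generate.one)
    moreover have "\<one>\<^bsub>BijGroup (carrier Q)\<^esub> a = a" using ab by (simp add: BijGroup_def)
    ultimately show ?thesis by (metis (mono_tags, lifting) mem_Collect_eq)
  qed
  ultimately have "?S = carrier Q" using assms by blast
  then have "b \<in> ?S" using ab by simp
  then show "\<exists>h\<in>left_mult_group Q. h a = b" by auto
qed

end

locale finite_connected_quandle = connected_quandle +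
  assumes finite: "finite (carrier Q)"
begin

text \<open>On a finite set the injective left translations map a closed set onto itself, so
  inverses preserve it too, and with them the whole left multiplication group. Transitivity does the
  rest.\<close>

lemma closed_eq:
  assumes S: "closed S" "S \<noteq> {}"
  shows "S = carrier Q"
proof -
  have SC: "S \<subseteq> carrier Q" using S by (auto simp: closed_def)
  have finS: "finite S" using SC finite finite_subset by blast
  have img: "(\<lambda>x. a \<triangleright> x) ` S = S" if a: "a \<in> carrier Q" for a
  proof (rule endo_inj_surj[OF finS])
    show "(\<lambda>x. a \<triangleright> x) ` S \<subseteq> S" using S a by (auto simp: closed_def)
    show "inj_on (\<lambda>x. a \<triangleright> x) S"
      using left_translation_bij[OF a] SC by (auto simp: bij_betw_def intro: inj_on_subset)
  qed
  have lt: "left_translation Q x \<in> Bij (carrier Q)" if "x \<in> carrier Q" for x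
    using left_translation_bij[OF that]
    by (auto simp: Bij_def left_translation_def cong: bij_betw_cong)
  have gen: "h \<in> Bij (carrier Q) \<and> (\<forall>x\<in>S. h x \<in> S)" if "h \<in> left_mult_group Q" for h
    using that unfolding left_mult_group_def
  proof (induction rule: generate.induct)
    case one
    have "\<one>\<^bsub>BijGroup (carrier Q)\<^esub> = (\<lambda>x\<in>carrier Q. x)" by (simp add: BijGroup_def)
    moreover have "\<forall>x\<in>S. (\<lambda>x\<in>carrier Q. x) x \<in> S" using SC by auto
    ultimately show ?case using id_Bij[of "carrier Q"] by metis
  next
    case (incl h)
    then show ?case using lt S(1) SC by (auto simp: left_translation_def closed_def)
  next
    case (inv h)
    then obtain a where a: "a \<in> carrier Q" "h = left_translation Q a" by blast
    have hB: "h \<in> Bij (carrier Q)" using lt a by simp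
    have "inv\<^bsub>BijGroup (carrier Q)\<^esub> h = (\<lambda>x\<in>carrier Q. inv_into (carrier Q) h x)"
      using hB by (rule inv_BijGroup)
    moreover have "inv_into (carrier Q) h x \<in> S" if x: "x \<in> S" for x
    proof -
      obtain y where y: "y \<in> S" "x = a \<triangleright> y" using img[OF a(1)] x by blast
      then have "h y = x" "y \<in> carrier Q" using a SC by (auto simp: left_translation_def)
      then show ?thesis
        using y hB inv_into_f_f[of h "carrier Q" y] by (auto simp: Bij_def bij_betw_def)
    qed
    moreover from this have "\<forall>x\<in>S. (\<lambda>x\<in>carrier Q. inv_into (carrier Q) h x) x \<in> S"
      using SC by auto
    ultimately show ?case
      using restrict_inv_into_Bij[OF hB] by metis
  next
    case (eng h1 h2)
    have "h1 \<otimes>\<^bsub>BijGroup (carrier Q)\<^esub> h2 = compose (carrier Q) h1 h2"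
      using eng.IH by (simp add: BijGroup_def)
    then show ?case
      using SC eng.IH compose_Bij[of h1 "carrier Q" h2] by (simp add: compose_eq subset_eq)
  qed
  obtain x where x: "x \<in> S" using S(2) by blast
  have "b \<in> S" if b: "b \<in> carrier Q" for b
    using transitive[of x b] x SC b gen by blast
  then show ?thesis using SC by blast
qed

text \<open>An induction principle for connected quandles: a property holds everywhere once it holds
  at one point and is inherited under left translations.\<close>

lemma eq_carrierI:
  assumes "S \<subseteq> carrier Q" "x \<in> S" "\<And>a y. a \<in> carrier Q \<Longrightarrow> y \<in> S \<Longrightarrow> a \<triangleright> y \<in> S"
  shows "S = carrier Q"
proof (rule closed_eq)
  show "closed S" unfolding closed_def using assms(1,3) by blast
  show "S \<noteq> {}" using assms(2) by blast
qed

end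

lemma finite_connected_quandleI:
  "connected_quandle Q \<Longrightarrow> finite (carrier Q) \<Longrightarrow> finite_connected_quandle Q"
  by (intro finite_connected_quandle.intro finite_connected_quandle_axioms.intro)

section \<open>Congruences of finite quandles\<close>

context quandle
begin

definition congr :: "('a \<times> 'a) set \<Rightarrow> bool"
  where "congr r \<longleftrightarrow> equiv (carrier Q) r \<and>
    (\<forall>a a' b b'. (a, a') \<in> r \<longrightarrow> (b, b') \<in> r \<longrightarrow> (a \<triangleright> b, a' \<triangleright> b') \<in> r)"

lemma congrD:
  assumes "congr r"
  shows "equiv (carrier Q) r" "(a, a') \<in> r \<Longrightarrow> (b, b') \<in> r \<Longrightarrow> (a \<triangleright> b, a' \<triangleright> b') \<in> r"
    "(a, b) \<in> r \<Longrightarrow> a \<in> carrier Q \<and> b \<in> carrier Q" "a \<in> carrier Q \<Longrightarrow> (a, a) \<in> r"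
    "(a, b) \<in> r \<Longrightarrow> (b, a) \<in> r" "(a, b) \<in> r \<Longrightarrow> (b, c) \<in> r \<Longrightarrow> (a, c) \<in> r"
proof -
  show eq: "equiv (carrier Q) r" using assms by (simp add: congr_def)
  show "(a, a') \<in> r \<Longrightarrow> (b, b') \<in> r \<Longrightarrow> (a \<triangleright> b, a' \<triangleright> b') \<in> r"
    using assms by (simp add: congr_def)
  show "(a, b) \<in> r \<Longrightarrow> a \<in> carrier Q \<and> b \<in> carrier Q"
    using equiv_type[OF eq] by blast
  show "a \<in> carrier Q \<Longrightarrow> (a, a) \<in> r"
    using eq by (simp add: equiv_def refl_on_def)
  show "(a, b) \<in> r \<Longrightarrow> (b, a) \<in> r"
    using eq unfolding equiv_def by (blast dest: symD)
  show "(a, b) \<in> r \<Longrightarrow> (b, c) \<in> r \<Longrightarrow> (a, c) \<in> r"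
    using eq unfolding equiv_def by (blast dest: transD)
qed

lemma quandle_congruence_imp_congr: "quandle_congruence Q r \<Longrightarrow> congr r"
  by (auto simp: quandle_congruence_def congr_def)

text \<open>A left translation acts injectively on the finite set \<open>r\<close> of pairs, hence
  surjectively, so the pair has a preimage inside \<open>r\<close>. This is why compatibility with
  left division comes for free in finite quandles.\<close>

lemma congr_cancel:
  assumes fin: "finite (carrier Q)" and r: "congr r"
    and abc: "a \<in> carrier Q" "b \<in> carrier Q" "c \<in> carrier Q" "(a \<triangleright> b, a \<triangleright> c) \<in> r"
  shows "(b, c) \<in> r"
proof -
  have rC: "r \<subseteq> carrier Q \<times> carrier Q" using congrD(3)[OF r] by auto
  have inj: "inj_on (\<lambda>x. a \<triangleright> x) (carrier Q)"
    using left_translation_bij[OF abc(1)] by (simp add: bij_betw_def)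
  let ?f = "\<lambda>(x, y). (a \<triangleright> x, a \<triangleright> y)"
  have "?f ` r = r"
  proof (rule endo_inj_surj)
    show "finite r" using rC fin finite_subset by blast
    show "?f ` r \<subseteq> r" using congrD(2)[OF r congrD(4)[OF r abc(1)]] by auto
    show "inj_on ?f r" using inj rC by (auto simp: inj_on_def subset_eq)
  qed
  then have "(a \<triangleright> b, a \<triangleright> c) \<in> ?f ` r" using abc(4) by simp
  then obtain x y where "(x, y) \<in> r" "a \<triangleright> x = a \<triangleright> b" "a \<triangleright> y = a \<triangleright> c" by auto
  moreover from this have "x = b" "y = c"
    using inj rC abc by (auto dest: inj_onD)
  ultimately show ?thesis by simp
qed

lemma left_div:
  assumes "a \<in> carrier Q" "b \<in> carrier Q"
  shows "left_div Q a b \<in> carrier Q" "a \<triangleright> left_div Q a b = b"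
proof -
  have "b \<in> (\<lambda>c. a \<triangleright> c) ` carrier Q"
    using left_translation_bij[OF assms(1)] assms(2) by (simp add: bij_betw_def)
  then show "left_div Q a b \<in> carrier Q" "a \<triangleright> left_div Q a b = b"
    unfolding left_div_def by (auto intro: inv_into_into f_inv_into_f)
qed

lemma congr_iff:
  assumes fin: "finite (carrier Q)"
  shows "quandle_congruence Q r \<longleftrightarrow> congr r"
proof
  assume r: "congr r"
  have "(left_div Q a b, left_div Q a' b') \<in> r" if "(a, a') \<in> r" "(b, b') \<in> r" for a a' b b'
  proof -
    have C: "a \<in> carrier Q" "a' \<in> carrier Q" "b \<in> carrier Q" "b' \<in> carrier Q"
      using congrD(3)[OF r] that by auto
    note ld = left_div[OF C(1,3)] left_div[OF C(2,4)]
    have "(a \<triangleright> left_div Q a' b', b') \<in> r"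
      using congrD(2)[OF r that(1) congrD(4)[OF r ld(3)]] ld(4) by simp
    then have "(a \<triangleright> left_div Q a b, a \<triangleright> left_div Q a' b') \<in> r"
      using that(2) ld(2) congrD(5,6)[OF r] by metis
    then show ?thesis using congr_cancel[OF fin r C(1) ld(1,3)] by blast
  qed
  then show "quandle_congruence Q r"
    using r by (auto simp: quandle_congruence_def congr_def)
qed (rule quandle_congruence_imp_congr)

end

section \<open>Quotients and displacement groups\<close>

lemma subgroup_perms_onI:
  assumes "\<And>f. f \<in> A \<Longrightarrow> f permutes S" "id \<in> A" "\<And>f g. f \<in> A \<Longrightarrow> g \<in> A \<Longrightarrow> f \<circ> g \<in> A"
    "\<And>f. f \<in> A \<Longrightarrow> finv f \<in> A"
  shows "subgroup A (perms_on S)"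
  using assms by (intro group.subgroupI[OF group_perms_on]) (auto simp: subset_eq)

lemma perms_on_subgroupD:
  assumes "subgroup A (perms_on S)"
  shows "f \<in> A \<Longrightarrow> f permutes S" "id \<in> A" "f \<in> A \<Longrightarrow> g \<in> A \<Longrightarrow> f \<circ> g \<in> A"
    "f \<in> A \<Longrightarrow> finv f \<in> A" "f \<in> A \<Longrightarrow> f ^^ n \<in> A"
proof -
  show 1: "f permutes S" if "f \<in> A" for f
    using subgroup.subset[OF assms] that by auto
  show 2: "id \<in> A" using subgroup.one_closed[OF assms] by simp
  show 3: "f \<circ> g \<in> A" if "f \<in> A" "g \<in> A" for f g
    using subgroup.m_closed[OF assms that] by simp
  show "finv f \<in> A" if "f \<in> A"
    using subgroup.m_inv_closed[OF assms that] 1[OF that] by simp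
  show "f ^^ n \<in> A" if "f \<in> A"
    by (induction n) (use 2 3[OF that] in \<open>simp_all only: funpow.simps\<close>)
qed

context finite_connected_quandle
begin

lemma card_ne_2: "card (carrier Q) \<noteq> 2"
proof
  assume "card (carrier Q) = 2"
  then obtain x y where xy: "carrier Q = {x, y}" "x \<noteq> y"
    by (auto simp: card_2_iff)
  have inj: "inj_on (\<lambda>b. a \<triangleright> b) (carrier Q)" if "a \<in> carrier Q" for a
    using left_translation_bij[OF that] by (simp add: bij_betw_def)
  have "y \<triangleright> x \<noteq> y"
    using inj_onD[OF inj[of y], of x y] xy idem[of y] by auto
  then have "y \<triangleright> x = x" using qop_closed[of y x] xy by auto
  then have "{x} = carrier Q"
    using xy idem[of x] by (intro eq_carrierI[of _ x]) auto
  then show False using xy by auto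
qed

text \<open>A left translation embeds the class of \<open>y\<close> into the class of
  \<open>a \<triangleright> y\<close>, so class sizes cannot drop along translations. Connectedness
  then gives the inequality between any two classes, in both directions.\<close>

lemma class_card:
  assumes r: "congr r" and "x \<in> carrier Q" "y \<in> carrier Q"
  shows "card (r `` {x}) = card (r `` {y})"
proof -
  have "card (r `` {x}) \<le> card (r `` {y})" if xy: "x \<in> carrier Q" "y \<in> carrier Q" for x y
  proof -
    let ?S = "{y \<in> carrier Q. card (r `` {x}) \<le> card (r `` {y})}"
    have "?S = carrier Q"
    proof (rule eq_carrierI[of _ x])
      fix a y assume a: "a \<in> carrier Q" and y: "y \<in> ?S"
      have sub: "r `` {z} \<subseteq> carrier Q" for z using congrD(3)[OF r] by auto
      have "card (r `` {y}) = card ((\<lambda>b. a \<triangleright> b) ` (r `` {y}))"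
        using left_translation_bij[OF a] sub[of y]
        by (intro card_image[symmetric]) (auto simp: bij_betw_def intro: inj_on_subset)
      also have "\<dots> \<le> card (r `` {a \<triangleright> y})"
        using sub congrD(2)[OF r congrD(4)[OF r a]] finite by (intro card_mono) (auto intro: finite_subset)
      finally show "a \<triangleright> y \<in> ?S" using a y qop_closed by auto
    qed (use xy in auto)
    then show ?thesis using xy by auto
  qed
  then show ?thesis using assms by (simp add: le_antisym)
qed

lemma card_quotient:
  assumes r: "congr r" and x: "x \<in> carrier Q"
  shows "card (carrier Q // r) * card (r `` {x}) = card (carrier Q)"
proof -
  have eq: "equiv (carrier Q) r" using congrD(1)[OF r] .
  have "card (r `` {x}) * card (carrier Q // r) = card (\<Union> (carrier Q // r))"
  proof (rule card_partition)
    show "finite (carrier Q // r)" using finite_quotient[OF finite equiv_type[OF eq]] .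
    show "finite (\<Union> (carrier Q // r))" using finite Union_quotient[OF eq] by simp
    show "card c = card (r `` {x})" if "c \<in> carrier Q // r" for c
      using that class_card[OF r _ x] by (auto elim!: quotientE)
    show "c1 \<inter> c2 = {}" if "c1 \<in> carrier Q // r" "c2 \<in> carrier Q // r" "c1 \<noteq> c2" for c1 c2
      using quotient_disj[OF eq that(1,2)] that(3) by blast
  qed
  then show ?thesis using Union_quotient[OF eq] by (simp add: mult.commute)
qed

definition quot :: "('a \<times> 'a) set \<Rightarrow> 'a set quandle"
  where "quot r = \<lparr>carrier = carrier Q // r,
    qop = (\<lambda>A B. r `` {(SOME x. x \<in> A) \<triangleright> (SOME y. y \<in> B)})\<rparr>"

lemma quot_op:
  assumes r: "congr r" and ab: "a \<in> carrier Q" "b \<in> carrier Q"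
  shows "r `` {a} \<triangleright>\<^bsub>quot r\<^esub> r `` {b} = r `` {a \<triangleright> b}"
proof -
  have "(SOME x. x \<in> r `` {c}) \<in> r `` {c}" if "c \<in> carrier Q" for c
    using congrD(4)[OF r that] by (intro someI[of "\<lambda>x. x \<in> r `` {c}"]) auto
  then have "(a, SOME x. x \<in> r `` {a}) \<in> r" "(b, SOME x. x \<in> r `` {b}) \<in> r"
    using ab by blast+
  then have "(a \<triangleright> b, (SOME x. x \<in> r `` {a}) \<triangleright> (SOME x. x \<in> r `` {b})) \<in> r"
    by (rule congrD(2)[OF r])
  then show ?thesis
    unfolding quot_def using equiv_class_eq[OF congrD(1)[OF r]] by simp
qed

lemma quot_connected:
  assumes r: "congr r"
  shows "finite_connected_quandle (quot r)"
proof (rule finite_connected_quandleI)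
  have eq: "equiv (carrier Q) r" using congrD(1)[OF r] .
  have car: "carrier (quot r) = (\<lambda>x. r `` {x}) ` carrier Q"
    by (auto simp: quot_def quotient_def)
  have fin: "finite (carrier (quot r))" using finite by (simp add: car)
  then show "finite (carrier (quot r))" .
  interpret R: quandle "quot r"
  proof
    fix A assume "A \<in> carrier (quot r)"
    then obtain a where a: "a \<in> carrier Q" "A = r `` {a}" by (auto simp: car)
    have "(\<lambda>B. A \<triangleright>\<^bsub>quot r\<^esub> B) ` carrier (quot r) = (\<lambda>x. r `` {x}) ` (\<lambda>b. a \<triangleright> b) ` carrier Q"
      unfolding car image_image using a quot_op[OF r a(1)] by (intro image_cong) auto
    also have "(\<lambda>b. a \<triangleright> b) ` carrier Q = carrier Q"
      using left_translation_bij[OF a(1)] by (simp add: bij_betw_def)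
    finally have surj: "(\<lambda>B. A \<triangleright>\<^bsub>quot r\<^esub> B) ` carrier (quot r) = carrier (quot r)"
      by (simp add: car)
    moreover have "inj_on (\<lambda>B. A \<triangleright>\<^bsub>quot r\<^esub> B) (carrier (quot r))"
      by (rule eq_card_imp_inj_on[OF fin]) (simp only: surj)
    ultimately show "bij_betw (\<lambda>B. A \<triangleright>\<^bsub>quot r\<^esub> B) (carrier (quot r)) (carrier (quot r))"
      by (simp only: bij_betw_def)
  qed (auto simp: car quot_op[OF r] qop_closed left_distrib[symmetric] idem)
  show "connected_quandle (quot r)"
  proof (rule R.connectedI)
    fix S assume S: "R.closed S" "S \<noteq> {}"
    let ?T = "{x \<in> carrier Q. r `` {x} \<in> S}"
    have Scar: "S \<subseteq> carrier (quot r)" using S(1) by (simp add: R.closed_def)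
    obtain x where x: "x \<in> ?T" using S(2) Scar by (auto simp: car)
    have "?T = carrier Q"
    proof (rule eq_carrierI[OF _ x])
      fix a y assume ay: "a \<in> carrier Q" "y \<in> ?T"
      then have "r `` {a} \<triangleright>\<^bsub>quot r\<^esub> r `` {y} \<in> S"
        using S(1) unfolding R.closed_def car by blast
      then show "a \<triangleright> y \<in> ?T" using ay quot_op[OF r] qop_closed by auto
    qed auto
    then show "S = carrier (quot r)" using Scar unfolding car by blast
  qed
qed

section \<open>The left multiplication group and its displacement subgroup\<close>

abbreviation Sym where "Sym \<equiv> perms_on (carrier Q)"

definition lmult :: "('a \<Rightarrow> 'a) set"
  where "lmult = generate Sym (L ` carrier Q)"

definition dis :: "('a \<Rightarrow> 'a) set"
  where "dis = generate Sym {L a \<circ> finv (L b) | a b. a \<in> carrier Q \<and> b \<in> carrier Q}"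

lemma lmult_subgroup: "subgroup lmult Sym"
  unfolding lmult_def by (rule group.generate_is_subgroup[OF group_perms_on]) (auto simp: L_permutes)

lemma dis_subgroup: "subgroup dis Sym"
  unfolding dis_def
  by (rule group.generate_is_subgroup[OF group_perms_on])
    (auto intro!: permutes_compose permutes_inv L_permutes)

lemma L_lmult: "a \<in> carrier Q \<Longrightarrow> L a \<in> lmult"
  unfolding lmult_def by (rule generate.incl) auto

lemma dis_gen: "a \<in> carrier Q \<Longrightarrow> b \<in> carrier Q \<Longrightarrow> L a \<circ> finv (L b) \<in> dis"
  unfolding dis_def by (rule generate.incl) auto

lemma lmult_subset:
  assumes "subgroup A Sym" "\<And>a. a \<in> carrier Q \<Longrightarrow> L a \<in> A"
  shows "lmult \<subseteq> A"
  unfolding lmult_def using assms by (intro group.generate_subgroup_incl[OF group_perms_on]) auto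

lemma dis_subset:
  assumes "subgroup A Sym" "\<And>a b. a \<in> carrier Q \<Longrightarrow> b \<in> carrier Q \<Longrightarrow> L a \<circ> finv (L b) \<in> A"
  shows "dis \<subseteq> A"
  unfolding dis_def using assms by (intro group.generate_subgroup_incl[OF group_perms_on]) auto

lemmas lmultD = perms_on_subgroupD[OF lmult_subgroup]
lemmas disD = perms_on_subgroupD[OF dis_subgroup]

lemma dis_lmult: "dis \<subseteq> lmult"
  by (intro dis_subset lmult_subgroup lmultD L_lmult)

lemma lmult_closed: "g \<in> lmult \<Longrightarrow> x \<in> carrier Q \<Longrightarrow> g x \<in> carrier Q"
  using permutes_in_image[OF lmultD(1)] by simp

lemma perm_inv: "g \<in> lmult \<Longrightarrow> g (finv g x) = x" "g \<in> lmult \<Longrightarrow> finv g (g x) = x"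
  using permutes_inverses[OF lmultD(1)] by auto

lemma lmult_hom:
  assumes "g \<in> lmult" "a \<in> carrier Q" "b \<in> carrier Q"
  shows "g (a \<triangleright> b) = g a \<triangleright> g b"
proof -
  let ?A = "{g. g permutes carrier Q \<and> (\<forall>a\<in>carrier Q. \<forall>b\<in>carrier Q. g (a \<triangleright> b) = g a \<triangleright> g b)}"
  have "lmult \<subseteq> ?A"
  proof (rule lmult_subset[OF subgroup_perms_onI])
    fix f g assume "f \<in> ?A" "g \<in> ?A"
    then show "f \<circ> g \<in> ?A" by (auto simp: permutes_compose permutes_in_image)
  next
    fix f assume f: "f \<in> ?A"
    then have fp: "f permutes carrier Q" by simp
    have "finv f (a \<triangleright> b) = finv f a \<triangleright> finv f b" if "a \<in> carrier Q" "b \<in> carrier Q" for a b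
    proof -
      have "finv f a \<in> carrier Q" "finv f b \<in> carrier Q"
        using that permutes_in_image[OF permutes_inv[OF fp]] by auto
      then have "f (finv f a \<triangleright> finv f b) = a \<triangleright> b"
        using f permutes_inverses(1)[OF fp] by simp
      then show ?thesis using permutes_inverses(2)[OF fp] by metis
    qed
    then show "finv f \<in> ?A" using permutes_inv[OF fp] by simp
  next
    fix a assume a: "a \<in> carrier Q"
    have "L a (b \<triangleright> c) = L a b \<triangleright> L a c" if "b \<in> carrier Q" "c \<in> carrier Q" for b c
      using left_distrib[OF a that] that by (simp add: L_apply qop_closed)
    then show "L a \<in> ?A" using L_permutes[OF a] by simp
  qed (auto simp: permutes_id)
  then show ?thesis using assms by blast
qed

lemma lmult_conj:
  assumes g: "g \<in> lmult" and a: "a \<in> carrier Q"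
  shows "g \<circ> L a \<circ> finv g = L (g a)"
proof
  fix x
  have gp: "g permutes carrier Q" using lmultD(1)[OF g] .
  show "(g \<circ> L a \<circ> finv g) x = L (g a) x"
  proof (cases "x \<in> carrier Q")
    case True
    then have "finv g x \<in> carrier Q" using permutes_in_image[OF permutes_inv[OF gp]] by simp
    then show ?thesis using True lmult_hom[OF g a] perm_inv[OF g] by (simp add: L_apply)
  next
    case False
    then have "finv g x = x" using permutes_not_in[OF permutes_inv[OF gp]] by simp
    then show ?thesis using False permutes_not_in[OF gp] by (simp add: L_def)
  qed
qed

lemma dis_normal:
  assumes g: "g \<in> lmult" and d: "d \<in> dis"
  shows "g \<circ> d \<circ> finv g \<in> dis"
proof -
  have gp: "g permutes carrier Q" using lmultD(1)[OF g] .
  have gg: "finv g \<circ> g = id" "g \<circ> finv g = id" using permutes_inv_o[OF gp] by auto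
  let ?A = "{d. d permutes carrier Q \<and> g \<circ> d \<circ> finv g \<in> dis}"
  have "dis \<subseteq> ?A"
  proof (rule dis_subset[OF subgroup_perms_onI])
    show "id \<in> ?A" using disD(2) gg by (simp add: permutes_id)
  next
    fix f h assume "f \<in> ?A" "h \<in> ?A"
    moreover have "g \<circ> (f \<circ> h) \<circ> finv g = (g \<circ> f \<circ> finv g) \<circ> (g \<circ> h \<circ> finv g)"
      using perm_inv[OF g] by (auto simp: fun_eq_iff)
    ultimately show "f \<circ> h \<in> ?A"
      using disD(3) by (auto intro: permutes_compose simp del: comp_apply)
  next
    fix f assume f: "f \<in> ?A"
    then have fp: "f permutes carrier Q" by simp
    have "finv (g \<circ> f \<circ> finv g) = g \<circ> finv f \<circ> finv g"
    proof (rule inv_unique_comp)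
      show "g \<circ> f \<circ> finv g \<circ> (g \<circ> finv f \<circ> finv g) = id"
        "g \<circ> finv f \<circ> finv g \<circ> (g \<circ> f \<circ> finv g) = id"
        using perm_inv[OF g] permutes_inverses[OF fp] by (auto simp: fun_eq_iff)
    qed
    then show "finv f \<in> ?A"
      using f disD(4) permutes_inv[OF fp] by (metis (mono_tags, lifting) mem_Collect_eq)
  next
    fix a b assume ab: "a \<in> carrier Q" "b \<in> carrier Q"
    have "finv (g \<circ> L b \<circ> finv g) = g \<circ> finv (L b) \<circ> finv g"
    proof (rule inv_unique_comp)
      show "g \<circ> L b \<circ> finv g \<circ> (g \<circ> finv (L b) \<circ> finv g) = id"
        "g \<circ> finv (L b) \<circ> finv g \<circ> (g \<circ> L b \<circ> finv g) = id"
        using perm_inv[OF g] permutes_inverses[OF L_permutes[OF ab(2)]] by (auto simp: fun_eq_iff)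
    qed
    then have "g \<circ> (L a \<circ> finv (L b)) \<circ> finv g = L (g a) \<circ> finv (L (g b))"
      unfolding lmult_conj[OF g ab(1), symmetric] lmult_conj[OF g ab(2), symmetric]
      using perm_inv[OF g] by (auto simp: fun_eq_iff)
    then show "L a \<circ> finv (L b) \<in> ?A"
      using dis_gen[OF lmult_closed[OF g ab(1)] lmult_closed[OF g ab(2)]] ab
      by (auto intro!: permutes_compose permutes_inv L_permutes)
  qed auto
  then show ?thesis using d by blast
qed

lemma dis_transitive:
  assumes "x \<in> carrier Q" "y \<in> carrier Q"
  shows "\<exists>d\<in>dis. d x = y"
proof -
  let ?S = "{d x | d. d \<in> dis}"
  have "?S = carrier Q"
  proof (rule eq_carrierI[of _ x])
    show "?S \<subseteq> carrier Q" using lmult_closed dis_lmult assms(1) by auto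
    have "id x \<in> ?S" using disD(2) by blast
    then show "x \<in> ?S" by simp
    fix a y assume a: "a \<in> carrier Q" and "y \<in> ?S"
    then obtain d where d: "d \<in> dis" "y = d x" by blast
    \<comment> \<open>\<open>L x\<close> fixes \<open>x\<close>, so this product sends
      \<open>x\<close> to \<open>a \<triangleright> y\<close>. The first factor is a conjugate of a
      displacement and the second a generator.\<close>
    let ?e = "(L a \<circ> d \<circ> finv (L a)) \<circ> (L a \<circ> finv (L x))"
    have "finv (L x) x = x"
      using idem[OF assms(1)] L_apply[OF assms(1), of x] permutes_inverses(2)[OF L_permutes[OF assms(1)]] by metis
    then have "?e x = L a (d x)"
      using permutes_inverses(2)[OF L_permutes[OF a]] by simp
    also have "\<dots> = a \<triangleright> y" using d lmult_closed dis_lmult assms(1) by (auto simp: L_apply)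
    finally have "a \<triangleright> y = ?e x" ..
    moreover have "?e \<in> dis"
      using dis_normal[OF L_lmult[OF a] d(1)] dis_gen[OF a assms(1)] by (rule disD(3))
    ultimately show "a \<triangleright> y \<in> ?S" by blast
  qed
  then have "y \<in> ?S" using assms(2) by simp
  then show ?thesis by blast
qed

lemma lmult_congr:
  assumes r: "congr r" and g: "g \<in> lmult" and xy: "(x, y) \<in> r"
  shows "(g x, g y) \<in> r"
proof -
  \<comment> \<open>Stated as an equivalence, so that the set is closed under inverses.\<close>
  let ?A = "{g. g permutes carrier Q \<and> (\<forall>x y. (x, y) \<in> r \<longleftrightarrow> (g x, g y) \<in> r)}"
  have "lmult \<subseteq> ?A"
  proof (rule lmult_subset[OF subgroup_perms_onI])
    fix f assume f: "f \<in> ?A"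
    then have "finv f permutes carrier Q" "\<And>x. f (finv f x) = x"
      using permutes_inv permutes_inverses(1) by auto
    moreover have "(finv f x, finv f y) \<in> r \<longleftrightarrow> (f (finv f x), f (finv f y)) \<in> r" for x y
      using f by blast
    ultimately show "finv f \<in> ?A" by simp
  next
    fix a assume a: "a \<in> carrier Q"
    have "(x, y) \<in> r \<longleftrightarrow> (L a x, L a y) \<in> r" for x y
    proof
      assume "(x, y) \<in> r"
      then show "(L a x, L a y) \<in> r"
        using congrD(2)[OF r congrD(4)[OF r a]] congrD(3)[OF r] by (auto simp: L_apply)
    next
      assume *: "(L a x, L a y) \<in> r"
      then have "x \<in> carrier Q" "y \<in> carrier Q"
        using congrD(3)[OF r] permutes_in_image[OF L_permutes[OF a]] by blast+
      then show "(x, y) \<in> r" using * congr_cancel[OF finite r a] by (simp add: L_apply)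
    qed
    then show "L a \<in> ?A" using L_permutes[OF a] by blast
  qed (auto simp: permutes_id permutes_compose)
  then show ?thesis using g xy by blast
qed

end

section \<open>Connected quandles of prime size and of size 4\<close>

text \<open>The period of \<open>x\<close> divides \<open>p\<close> and is not 1, so the orbit of
  \<open>x\<close> exhausts the \<open>p\<close> points. Bezout excludes any smaller period.\<close>

lemma prime_order_permutation:
  assumes p: "Factorial_Ring.prime (p :: nat)" and f: "f permutes S" "f ^^ p = id"
    and S: "finite S" "card S = p" and x: "x \<in> S" "f x \<noteq> x"
  shows "inj_on (\<lambda>i. (f ^^ i) x) {..<p}" "(\<lambda>i. (f ^^ i) x) ` {..<p} = S"
proof -
  have fix1: "d = 0" if d: "d < p" "(f ^^ d) x = x" for d
  proof (rule ccontr)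
    assume "d \<noteq> 0"
    then have "\<not> p dvd d" using d(1) by (auto dest: dvd_imp_le)
    then have "coprime d p" using prime_imp_coprime[OF p] by (simp add: coprime_commute)
    then obtain u v where uv: "d * u = p * v + 1"
      using bezout_nat[OF \<open>d \<noteq> 0\<close>, of p] by auto
    have "((f ^^ d) ^^ u) x = x" using d(2) by (induction u) auto
    moreover have "(f ^^ p) ^^ v = id" using f(2) by simp
    ultimately show False
      using x(2) uv by (simp add: funpow_mult mult.commute[of _ u] mult.commute[of v])
  qed
  show inj: "inj_on (\<lambda>i. (f ^^ i) x) {..<p}"
  proof (rule linorder_inj_onI')
    fix i j assume ij: "i \<in> {..<p}" "j \<in> {..<p}" "i < j"
    show "(f ^^ i) x \<noteq> (f ^^ j) x"
    proof
      assume "(f ^^ i) x = (f ^^ j) x"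
      also have "(f ^^ j) x = (f ^^ i) ((f ^^ (j - i)) x)"
        using ij funpow_add[of i "j - i" f] by simp
      finally have "(f ^^ (j - i)) x = x"
        using permutes_inj[OF permutes_funpow[OF f(1)], of i] by (simp add: inj_eq)
      moreover have "j - i < p" using ij by auto
      ultimately have "j - i = 0" using fix1 by blast
      then show False using ij by simp
    qed
  qed
  have "(\<lambda>i. (f ^^ i) x) ` {..<p} \<subseteq> S"
    using permutes_in_image[OF permutes_funpow[OF f(1)]] x(1) by auto
  then show "(\<lambda>i. (f ^^ i) x) ` {..<p} = S"
    using S inj by (intro card_subset_eq) (auto simp: card_image)
qed

lemma prime_order_permutation_moves:
  assumes p: "Factorial_Ring.prime (p :: nat)" and f: "f permutes S" "f ^^ p = id" "f \<noteq> id"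
    and S: "finite S" "card S = p" and x: "x \<in> S"
  shows "f x \<noteq> x"
proof -
  obtain y where y: "f y \<noteq> y" using f(3) by (auto simp: fun_eq_iff)
  then have yS: "y \<in> S" using permutes_not_in[OF f(1)] by blast
  obtain i where i: "x = (f ^^ i) y"
    using prime_order_permutation(2)[OF p f(1,2) S yS y] x by blast
  show ?thesis
  proof
    assume "f x = x"
    then have "(f ^^ i) (f y) = (f ^^ i) y" by (simp add: i funpow_swap1)
    then show False
      using permutes_inj[OF permutes_funpow[OF f(1)], of i] y by (simp add: inj_eq)
  qed
qed

lemma perms_on_subgroup_group:
  assumes "subgroup A (perms_on S)"
  shows "group (perms_on S\<lparr>carrier := A\<rparr>)"
  using subgroup.subgroup_is_group[OF assms group_perms_on] .

lemma perms_on_cauchy: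
  assumes S: "finite S" and A: "subgroup A (perms_on S)" and p: "Factorial_Ring.prime (p :: nat)" "p dvd card A"
  obtains c where "c \<in> A" "c \<noteq> id" "c ^^ p = id"
proof -
  let ?A = "perms_on S\<lparr>carrier := A\<rparr>"
  interpret group ?A using perms_on_subgroup_group[OF A] .
  have fin: "finite A" using subgroup.subset[OF A] finite_perms_on[OF S] finite_subset by blast
  obtain k where k: "card A = p * k" using p(2) by (elim dvdE)
  obtain P where P: "subgroup P ?A" "card P = p"
    \<comment> \<open>Exponent 1 suffices: the theorem provides a subgroup of order exactly
      \<open>p\<close>, whose nontrivial elements have \<open>p\<close>-th power 1.\<close>
    using sylow_thm[of p ?A 1 k] p(1) k fin is_group by (auto simp: Coset.order_def)
  have "P \<noteq> {id}" using P(2) prime_gt_1_nat[OF p(1)] by auto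
  moreover have "id \<in> P" using subgroup.one_closed[OF P(1)] by simp
  ultimately obtain c where c: "c \<in> P" "c \<noteq> id" by blast
  interpret P: group "?A\<lparr>carrier := P\<rparr>" using subgroup.subgroup_is_group[OF P(1) is_group] .
  have "c ^^ p = id"
    using P.pow_order_eq_1[of c] c P(2) by (simp add: Coset.order_def)
  moreover have "c \<in> A" using c subgroup.subset[OF P(1)] by auto
  ultimately show ?thesis using that c by blast
qed

text \<open>With a transversal \<open>t\<close> moving \<open>x\<close> to each point, every group
  element factors uniquely as an element of the transversal after one of the stabilizer.\<close>

lemma orbit_stabilizer:
  assumes S: "finite S" and A: "subgroup A (perms_on S)" and x: "x \<in> S"
    and trans: "\<And>y. y \<in> S \<Longrightarrow> \<exists>g\<in>A. g x = y"
  shows "card A = card S * card {h \<in> A. h x = x}"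
proof -
  note AD = perms_on_subgroupD[OF A]
  obtain t where t: "\<And>y. y \<in> S \<Longrightarrow> t y \<in> A \<and> t y x = y"
    using trans by metis
  have "bij_betw (\<lambda>(y, h). t y \<circ> h) (S \<times> {h \<in> A. h x = x}) A"
  proof (rule bij_betwI[where g = "\<lambda>g. (g x, finv (t (g x)) \<circ> g)"])
    show "(\<lambda>(y, h). t y \<circ> h) \<in> S \<times> {h \<in> A. h x = x} \<rightarrow> A"
      using t AD(3) by auto
    show "(\<lambda>g. (g x, finv (t (g x)) \<circ> g)) \<in> A \<rightarrow> S \<times> {h \<in> A. h x = x}"
    proof
      fix g assume g: "g \<in> A"
      then have gx: "g x \<in> S" using AD(1) permutes_in_image x by metis
      then have "finv (t (g x)) (t (g x) x) = x"
        using t AD(1) permutes_inverses(2) by metis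
      then show "(g x, finv (t (g x)) \<circ> g) \<in> S \<times> {h \<in> A. h x = x}"
        using gx g t AD(3,4) by auto
    qed
    fix s assume "s \<in> S \<times> {h \<in> A. h x = x}"
    then obtain y h where s: "s = (y, h)" "y \<in> S" "h \<in> A" "h x = x" by auto
    have "finv (t y) \<circ> (t y \<circ> h) = h"
      using permutes_inverses(2)[OF AD(1)] t[OF s(2)] by (auto simp: fun_eq_iff)
    then show "(\<lambda>g. (g x, finv (t (g x)) \<circ> g)) ((\<lambda>(y, h). t y \<circ> h) s) = s"
      using s t by simp
  next
    fix g assume g: "g \<in> A"
    then have "g x \<in> S" using AD(1) permutes_in_image x by metis
    then have "t (g x) permutes S" using AD(1) t by blast
    from permutes_inverses(1)[OF this]
    show "(\<lambda>(y, h). t y \<circ> h) ((\<lambda>g. (g x, finv (t (g x)) \<circ> g)) g) = g"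
      by (simp add: fun_eq_iff)
  qed
  from bij_betw_same_card[OF this] show ?thesis by (simp add: card_cartesian_product)
qed

lemma equiv_kernel: "equiv A {(a, b). a \<in> A \<and> b \<in> A \<and> f a = f b}"
  by (intro equivI refl_onI symI transI) auto

context finite_connected_quandle
begin

lemma singleton_not_closed:
  assumes "card (carrier Q) > 1" "x \<in> carrier Q"
  obtains a where "a \<in> carrier Q" "a \<triangleright> x \<noteq> x"
proof -
  have "card {x} \<noteq> card (carrier Q)" using assms(1) by simp
  then have "{x} \<noteq> carrier Q" by metis
  then show ?thesis using eq_carrierI[of "{x}" x] assms(2) that by blast
qed

text \<open>Equality of left translations is a congruence, since
  \<open>L (a \<triangleright> b)\<close> is a conjugate of \<open>L b\<close>. Its class size
  divides a prime; if there were only one class,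
  \<open>a \<triangleright> x = x \<triangleright> x = x\<close> for all \<open>a\<close>, against
  connectedness.\<close>

lemma inj_L:
  assumes p: "Factorial_Ring.prime (card (carrier Q))"
  shows "inj_on L (carrier Q)"
proof -
  let ?p = "card (carrier Q)"
  let ?r = "{(a, b). a \<in> carrier Q \<and> b \<in> carrier Q \<and> L a = L b}"
  have p1: "?p > 1" using prime_gt_1_nat[OF p] .
  obtain x where x: "x \<in> carrier Q" using p1 by fastforce
  have conj: "L (a \<triangleright> b) = L a \<circ> L b \<circ> finv (L a)" if "a \<in> carrier Q" "b \<in> carrier Q" for a b
    using lmult_conj[OF L_lmult[OF that(1)] that(2)] L_apply[OF that(2), of a] by simp
  have r: "congr ?r"
    unfolding congr_def
  proof (intro conjI allI impI)
    show "equiv (carrier Q) ?r"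
      by (rule equiv_kernel)
    fix a a' b b' assume "(a, a') \<in> ?r" "(b, b') \<in> ?r"
    then have C: "a \<in> carrier Q" "a' \<in> carrier Q" "b \<in> carrier Q" "b' \<in> carrier Q"
      and eq: "L a = L a'" "L b = L b'" by (simp_all only: mem_Collect_eq case_prod_conv)
    have "L (a \<triangleright> b) = L (a' \<triangleright> b')"
      unfolding conj[OF C(1,3)] conj[OF C(2,4)] eq ..
    then show "(a \<triangleright> b, a' \<triangleright> b') \<in> ?r" using C qop_closed by simp
  qed
  have "card (?r `` {x}) dvd ?p" unfolding card_quotient[OF r x, symmetric] by (rule dvd_triv_right)
  then consider "card (?r `` {x}) = 1" | "card (?r `` {x}) = ?p"
    using p by (auto simp: prime_nat_iff)
  then show ?thesis
  proof cases
    case 1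
    show ?thesis
    proof (rule inj_onI)
      fix a b assume ab: "a \<in> carrier Q" "b \<in> carrier Q" "L a = L b"
      have "card (?r `` {a}) = 1" using 1 class_card[OF r x ab(1)] by simp
      then obtain z where z: "?r `` {a} = {z}" by (rule card_1_singletonE)
      have "a \<in> ?r `` {a}" "b \<in> ?r `` {a}" using ab by auto
      then show "a = b" using z by (metis singletonD)
    qed
  next
    case 2
    have "?r `` {x} = carrier Q"
      using 2 finite by (intro card_subset_eq) auto
    then have eq: "L x = L a" if "a \<in> carrier Q" for a
      using that by auto
    obtain a where "a \<in> carrier Q" "a \<triangleright> x \<noteq> x"
      using singleton_not_closed[OF p1 x] by blast
    then show ?thesis using eq[of a] idem[OF x] L_apply[OF x] by metis
  qed
qed

text \<open>Conjugation identifies \<open>L ` carrier Q\<close> with \<open>carrier Q\<close>, and a point stabilizer is a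
  complement of a cyclic regular subgroup.\<close>

lemma card_dis_prime:
  assumes p: "Factorial_Ring.prime p" "card (carrier Q) = p"
  obtains c where "c \<in> dis" "c \<noteq> id" "c ^^ p = id" "card dis = p"
proof -
  have p1: "p > 1" using prime_gt_1_nat[OF p(1)] .
  obtain x where x: "x \<in> carrier Q" using p1 p(2) by fastforce
  have "card dis = p * card {h \<in> dis. h x = x}"
    using orbit_stabilizer[OF finite dis_subgroup x dis_transitive[OF x]] p(2) by simp
  then have "p dvd card dis" by simp
  then obtain c where c: "c \<in> dis" "c \<noteq> id" "c ^^ p = id"
    using perms_on_cauchy[OF finite dis_subgroup p(1)] by metis
  let ?G = "Sym\<lparr>carrier := lmult\<rparr>"
  have lm: "\<exists>g\<in>lmult. g x = y" if "y \<in> carrier Q" for y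
    using dis_transitive[OF x that] dis_lmult by blast
  have finL: "finite lmult"
    using subgroup.subset[OF lmult_subgroup] finite_perms_on[OF finite] finite_subset by blast
  interpret G: finite_group ?G
    using perms_on_subgroup_group[OF lmult_subgroup] finL
    by (simp add: finite_group_def finite_group_axioms_def)
  have inv: "inv\<^bsub>?G\<^esub> g = finv g" if "g \<in> lmult" for g
    using G.inv_equality[of "finv g" g] that lmultD(4) permutes_inv_o(2)[OF lmultD(1)]
    by (simp add: perms_on_def)
  note pow = pow_perms_on_carrier
  have mult: "g \<otimes>\<^bsub>?G\<^esub> h = g \<circ> h" "\<one>\<^bsub>?G\<^esub> = id" "carrier ?G = lmult" for g h
    by (simp_all add: perms_on_def)
  define H where "H = {h \<in> lmult. h x = x}"
  have HC: "H \<subseteq> lmult" by (auto simp: H_def)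
  have cardG: "card lmult = p * card H"
    using orbit_stabilizer[OF finite lmult_subgroup x lm] p(2) by (simp add: H_def)
  have H: "subgroup H Sym"
  proof (rule subgroup_perms_onI)
    fix f assume f: "f \<in> H"
    then show "finv f \<in> H" using lmultD(4) perm_inv(2)[of f x] by (auto simp: H_def)
  qed (use lmultD in \<open>auto simp: H_def\<close>)
  \<comment> \<open>An element of order \<open>p\<close> moves all \<open>p\<close> points, so none
    fixes \<open>x\<close>.\<close>
  have notdvd: "\<not> p dvd card H"
  proof
    assume "p dvd card H"
    then obtain h where h: "h \<in> H" "h \<noteq> id" "h ^^ p = id"
      using perms_on_cauchy[OF finite H p(1)] by metis
    then have "h x \<noteq> x"
      using prime_order_permutation_moves[OF p(1) lmultD(1) h(3,2) finite p(2) x] HC by blast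
    then show False using h(1) by (simp add: H_def)
  qed
  have cL: "c \<in> lmult" using c(1) dis_lmult by blast
  have moves: "c y \<noteq> y" if "y \<in> carrier Q" for y
    using prime_order_permutation_moves[OF p(1) lmultD(1)[OF cL] c(3,2) finite p(2) that] .
  have cover: "\<exists>h\<in>H. \<exists>j::nat. g = h \<circ> c ^^ j" if g: "g \<in> lmult" for g
  proof -
    have "finv g x \<in> carrier Q" using lmult_closed[OF lmultD(4)[OF g] x] .
    then obtain j where j: "finv g x = (c ^^ j) x"
      using prime_order_permutation(2)[OF p(1) lmultD(1)[OF cL] c(3) finite p(2) x moves[OF x]] by blast
    have cj: "c ^^ j \<in> lmult" using lmultD(5)[OF cL] .
    have "g \<circ> c ^^ j \<in> H" using lmultD(3)[OF g cj] perm_inv(1)[OF g, of x] j by (simp add: H_def)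
    \<comment> \<open>\<open>c ^^ k\<close> is the inverse of \<open>c ^^ j\<close>, with a natural
      exponent.\<close>
    define k where "k = (p - 1) * j"
    have "j + k = p * j" using p1 by (cases p) (simp_all add: k_def)
    then have "c ^^ j \<circ> c ^^ k = (c ^^ p) ^^ j"
      by (simp only: funpow_add[symmetric] funpow_mult)
    then have "c ^^ j \<circ> c ^^ k = id" by (simp add: c(3))
    then have "g = (g \<circ> c ^^ j) \<circ> c ^^ k" by (simp add: o_assoc[symmetric])
    then show ?thesis using \<open>g \<circ> c ^^ j \<in> H\<close> by blast
  qed
  have inj: "inj_on (\<lambda>h. h \<circ> c ^^ i \<circ> finv h) H" if i: "0 < i" "i < p" for i
  proof (rule inj_onI)
    fix h h' assume h: "h \<in> H" "h' \<in> H" and eq: "h \<circ> c ^^ i \<circ> finv h = h' \<circ> c ^^ i \<circ> finv h'"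
    have hL: "h \<in> lmult" "h' \<in> lmult" using h HC by auto
    \<comment> \<open>\<open>k\<close> commutes with \<open>c ^^ i\<close>, whose powers already
      reach every point from \<open>x\<close>. Fixing \<open>x\<close>, it fixes everything.\<close>
    define k where "k = finv h' \<circ> h"
    have kL: "k \<in> lmult" using hL lmultD(3,4) by (simp add: k_def)
    have kx: "k x = x" using h perm_inv(2)[OF hL(2), of x] by (simp add: k_def H_def)
    have "k ((c ^^ i) y) = (c ^^ i) (k y)" for y
      using fun_cong[OF eq, of "h y"] perm_inv[OF hL(1)] perm_inv[OF hL(2)] by (simp add: k_def)
    then have comm: "k (((c ^^ i) ^^ j) y) = ((c ^^ i) ^^ j) (k y)" for j y
      by (induction j) auto
    have ci: "c ^^ i permutes carrier Q" "(c ^^ i) ^^ p = id"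
      using permutes_funpow[OF lmultD(1)[OF cL]] c(3)
      by (auto simp: funpow_mult mult.commute[of i]) (simp add: funpow_mult[symmetric])
    have "(c ^^ i) x \<noteq> x"
      using inj_onD[OF prime_order_permutation(1)[OF p(1) lmultD(1)[OF cL] c(3) finite p(2) x moves[OF x]], of i 0] i
      by auto
    then have "y \<in> (\<lambda>j. ((c ^^ i) ^^ j) x) ` {..<p}" if "y \<in> carrier Q" for y
      using prime_order_permutation(2)[OF p(1) ci finite p(2) x] that by simp
    then have "k y = y" if "y \<in> carrier Q" for y
      using that comm kx by force
    then have "k = id"
      using permutes_not_in[OF lmultD(1)[OF kL]] by (metis eq_id_iff)
    then show "h = h'"
      using perm_inv(1)[OF hL(2)] by (metis comp_apply eq_id_iff k_def ext)
  qed
  have "card dis = p"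
  proof (rule G.card_generate_quotients_of_class[where m = "card H" and c = c and H = H and K = "L ` carrier Q", OF p(1), unfolded mult pow])
    show "card lmult = p * card H" by (rule cardG)
    show "\<exists>h\<in>H. \<exists>j::nat. g = h \<circ> c ^^ j" if "g \<in> lmult" for g using cover[OF that] .
    show "inj_on (\<lambda>h. h \<circ> c ^^ i \<circ> inv\<^bsub>?G\<^esub> h) H" if "0 < i" "i < p" for i
      using inj[OF that] HC inv by (auto simp: inj_on_def subset_eq)
    show "L ` carrier Q \<subseteq> lmult" using L_lmult by auto
    show "card (L ` carrier Q) = p" using inj_L p by (simp add: card_image)
    show "g \<circ> f \<circ> inv\<^bsub>?G\<^esub> g \<in> L ` carrier Q" if "g \<in> lmult" "f \<in> L ` carrier Q" for g f
      using that lmult_conj lmult_closed inv by auto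
    show "\<exists>g\<in>lmult. g \<circ> f \<circ> inv\<^bsub>?G\<^esub> g = f'" if ff: "f \<in> L ` carrier Q" "f' \<in> L ` carrier Q" for f f'
    proof -
      obtain a b where ab: "a \<in> carrier Q" "b \<in> carrier Q" "f = L a" "f' = L b" using ff by blast
      obtain g where "g \<in> lmult" "g a = b" using dis_transitive[OF ab(1,2)] dis_lmult by blast
      then show ?thesis using lmult_conj[of g a] ab inv by auto
    qed
    show "subgroup dis ?G"
      using group.subgroup_incl[OF group_perms_on dis_subgroup lmult_subgroup dis_lmult] .
    show "g \<circ> d \<circ> inv\<^bsub>?G\<^esub> g \<in> dis" if "g \<in> lmult" "d \<in> dis" for g d
      using dis_normal[OF that] inv that by simp
    show "f \<circ> inv\<^bsub>?G\<^esub> f' \<in> dis" if "f \<in> L ` carrier Q" "f' \<in> L ` carrier Q" for f f'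
      using that dis_gen L_lmult inv by auto
    show "dis \<subseteq> E" if E: "subgroup E ?G" "\<And>f f'. f \<in> L ` carrier Q \<Longrightarrow> f' \<in> L ` carrier Q \<Longrightarrow> f \<circ> inv\<^bsub>?G\<^esub> f' \<in> E" for E
    proof (rule dis_subset)
      show "subgroup E Sym" using group.incl_subgroup[OF group_perms_on lmult_subgroup E(1)] .
      show "L a \<circ> finv (L b) \<in> E" if "a \<in> carrier Q" "b \<in> carrier Q" for a b
        using E(2)[of "L a" "L b"] that L_lmult inv by auto
    qed
  qed (use c cL HC notdvd in auto)
  then show ?thesis using that c by blast
qed

end

section \<open>The affine quandles of prime size and of size 4\<close>

definition zmul :: "nat \<Rightarrow> nat \<Rightarrow> int \<Rightarrow> int"
  where "zmul n u = (\<lambda>x\<in>carrier (integer_mod_group n). (int u * x) mod int n)"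

text \<open>The companion matrix of the polynomial \<open>X\<^sup>2 + X + 1\<close> over the field
  with two elements, that is, multiplication by a generator of the field with four elements. The
  restriction makes it extensional, as members of \<open>AutoGroup\<close> have to be.\<close>

definition omega :: "int \<times> int \<Rightarrow> int \<times> int"
  where "omega = (\<lambda>x\<in>carrier Z2_squared. (snd x, (fst x + snd x) mod 2))"

lemma Aff_simps [simp]:
  "carrier (Aff A f) = carrier A"
  "a \<triangleright>\<^bsub>Aff A f\<^esub> b = a \<otimes>\<^bsub>A\<^esub> f (b \<otimes>\<^bsub>A\<^esub> inv\<^bsub>A\<^esub> a)"
  by (simp_all add: Aff_def)

lemma carrier_Z2_squared: "carrier Z2_squared = {(0, 0), (1, 0), (0, 1), (1, 1)}"
proof -
  have "{0..<2::int} = {0, 1}" by auto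
  then show ?thesis by (auto simp: DirProd_def carrier_integer_mod_group)
qed

lemma mult_Z2_squared: "x \<otimes>\<^bsub>Z2_squared\<^esub> y = ((fst x + fst y) mod 2, (snd x + snd y) mod 2)"
  by (simp add: DirProd_def case_prod_beta)

lemma inv_Z2_squared: "x \<in> carrier Z2_squared \<Longrightarrow> inv\<^bsub>Z2_squared\<^esub> x = x"
proof (rule group.inv_equality)
  show "group Z2_squared" by (intro DirProd_group) simp_all
qed (auto simp: carrier_Z2_squared mult_Z2_squared)

lemma Aff_omega:
  assumes "x \<in> carrier Z2_squared" "y \<in> carrier Z2_squared"
  shows "x \<triangleright>\<^bsub>Aff Z2_squared omega\<^esub> y
    = ((fst x + snd x + snd y) mod 2, (fst x + fst y + snd y) mod 2)"
  using assms unfolding Aff_simps inv_Z2_squared[OF assms(1)] unfolding carrier_Z2_squared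
  by (elim insertE emptyE; simp add: mult_Z2_squared omega_def carrier_Z2_squared)

lemma Aff_zmul:
  assumes "n > 0" "x \<in> carrier (integer_mod_group n)" "y \<in> carrier (integer_mod_group n)"
  shows "x \<triangleright>\<^bsub>Aff (integer_mod_group n) (zmul n u)\<^esub> y = (x + int u * (y - x)) mod int n"
proof -
  have "(y + - x mod int n) mod int n = (y - x) mod int n"
    by (simp add: mod_simps)
  moreover have "(y - x) mod int n \<in> carrier (integer_mod_group n)"
    using assms(1) by (simp add: carrier_integer_mod_group)
  ultimately show ?thesis
    using assms by (simp add: zmul_def mod_simps)
qed

context finite_connected_quandle
begin

text \<open>The displacement group consists of the powers of \<open>c\<close>, which carry
  \<open>x\<close> to each point once, so exponents serve as coordinates. \<open>L x\<close>
  normalizes this group, conjugating \<open>c\<close> to \<open>c ^^ u\<close>; in coordinates it is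
  multiplication by \<open>u\<close>, and conjugation by powers of \<open>c\<close> gives the other
  left translations.\<close>

theorem prime_affine:
  assumes p: "Factorial_Ring.prime p" "card (carrier Q) = p"
  obtains u h where "1 < u" "u < p" "h \<in> quandle_iso Q (Aff (integer_mod_group p) (zmul p u))"
proof -
  have p1: "p > 1" using prime_gt_1_nat[OF p(1)] .
  obtain c where c: "c \<in> dis" "c \<noteq> id" "c ^^ p = id" and D: "card dis = p"
    using card_dis_prime[OF p] by metis
  obtain x where x: "x \<in> carrier Q" using p1 p(2) by fastforce
  have cp: "c permutes carrier Q" using disD(1)[OF c(1)] .
  have cL: "c ^^ n \<in> lmult" for n using disD(5)[OF c(1)] dis_lmult by blast
  have cx: "c x \<noteq> x"
    using prime_order_permutation_moves[OF p(1) cp c(3,2) finite p(2) x] .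
  note orbit = prime_order_permutation[OF p(1) cp c(3) finite p(2) x cx]
  have bij: "bij_betw (\<lambda>i. (c ^^ i) x) {..<p} (carrier Q)"
    using orbit by (simp add: bij_betw_def)
  have cmod: "c ^^ m = c ^^ n" if "m mod p = n mod p" for m n
  proof -
    have "c ^^ k = c ^^ (k mod p)" for k
    proof -
      have "c ^^ k = c ^^ (k mod p + p * (k div p))" by simp
      also have "\<dots> = c ^^ (k mod p) \<circ> (c ^^ p) ^^ (k div p)"
        by (simp only: funpow_add funpow_mult)
      finally show ?thesis by (simp add: c(3))
    qed
    then show ?thesis using that by metis
  qed
  have "(\<lambda>i. c ^^ i) ` {..<p} = dis"
  proof (rule card_subset_eq)
    show "finite dis" using D p1 by (metis card.infinite not_one_less_zero)
    show "(\<lambda>i. c ^^ i) ` {..<p} \<subseteq> dis" using disD(5)[OF c(1)] by auto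
    have "inj_on (\<lambda>i. c ^^ i) {..<p}"
      using orbit(1) by (auto simp: inj_on_def)
    then show "card ((\<lambda>i. c ^^ i) ` {..<p}) = card dis" by (simp add: card_image D)
  qed
  moreover have "L x \<circ> c \<circ> finv (L x) \<in> dis"
    using dis_normal[OF L_lmult[OF x] c(1)] .
  ultimately obtain u where u: "u < p" "L x \<circ> c \<circ> finv (L x) = c ^^ u" by blast
  have Lc: "L x (c y) = (c ^^ u) (L x y)" for y
    using fun_cong[OF u(2), of "L x y"] permutes_inverses(2)[OF L_permutes[OF x]] by simp
  have Lcn: "L x ((c ^^ n) y) = (c ^^ (u * n)) (L x y)" for n y
    by (induction n) (simp_all add: Lc funpow_add)
  \<comment> \<open>\<open>k\<close> is any natural number congruent to \<open>j - i\<close>, which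
    keeps exponents free of truncated subtraction.\<close>
  have op: "(c ^^ i) x \<triangleright> (c ^^ j) x = (c ^^ (i + u * k)) x" if "(i + k) mod p = j mod p" for i j k
  proof -
    have ck: "(c ^^ k) x \<in> carrier Q" using lmult_closed[OF cL x] .
    have "(c ^^ j) x = (c ^^ i) ((c ^^ k) x)"
      using cmod[OF that] by (metis comp_apply funpow_add)
    then have "(c ^^ i) x \<triangleright> (c ^^ j) x = (c ^^ i) (x \<triangleright> (c ^^ k) x)"
      using lmult_hom[OF cL x ck] by simp
    also have "x \<triangleright> (c ^^ k) x = (c ^^ (u * k)) x"
      using Lcn[of k x] L_apply[OF ck] L_apply[OF x] idem[OF x] by simp
    finally show ?thesis by (simp add: funpow_add)
  qed
  have "u \<noteq> 0"
  proof
    assume "u = 0"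
    then have "L x (c x) = L x x" using Lc[of x] by simp
    then show False using permutes_inj[OF L_permutes[OF x]] cx by (simp add: inj_eq)
  qed
  \<comment> \<open>With \<open>u = 1\<close> every left translation would fix
    \<open>x\<close>.\<close>
  moreover have "u \<noteq> 1"
  proof
    assume u1: "u = 1"
    obtain a where a: "a \<in> carrier Q" "a \<triangleright> x \<noteq> x"
      using singleton_not_closed[OF _ x] p1 p(2) by blast
    obtain i where i: "i < p" "a = (c ^^ i) x" using a(1) orbit(2) by auto
    have "a \<triangleright> x = (c ^^ (i + 1 * (p - i))) x"
      using op[of i "p - i" 0] i u1 by simp
    then show False using a(2) i c(3) by simp
  qed
  ultimately have u1: "1 < u" by simp
  define h where "h = (\<lambda>y. int (inv_into {..<p} (\<lambda>i. (c ^^ i) x) y))"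
  have hc: "h ((c ^^ n) x) = int (n mod p)" for n
  proof -
    have "(c ^^ n) x = (c ^^ (n mod p)) x" using cmod[of n "n mod p"] by simp
    then show ?thesis
      using bij_betw_inv_into_left[OF bij, of "n mod p"] p1 by (simp add: h_def)
  qed
  have hb: "bij_betw h (carrier Q) (carrier (integer_mod_group p))"
  proof -
    have "bij_betw int {..<p} {0..<int p}"
      by (rule bij_betwI[where g = nat]) auto
    then have "bij_betw (int \<circ> inv_into {..<p} (\<lambda>i. (c ^^ i) x)) (carrier Q) {0..<int p}"
      using bij_betw_trans[OF bij_betw_inv_into[OF bij]] by blast
    then show ?thesis using p1 by (simp add: h_def comp_def carrier_integer_mod_group)
  qed
  have "h (a \<triangleright> b) = h a \<triangleright>\<^bsub>Aff (integer_mod_group p) (zmul p u)\<^esub> h b"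
    if ab: "a \<in> carrier Q" "b \<in> carrier Q" for a b
  proof -
    obtain i j where ij: "i < p" "a = (c ^^ i) x" "j < p" "b = (c ^^ j) x"
      using ab unfolding orbit(2)[symmetric] by blast
    define k where "k = p + j - i"
    have k: "int k = int j - int i + int p" using ij by (simp add: k_def)
    have "a \<triangleright> b = (c ^^ (i + u * k)) x"
      unfolding ij by (rule op) (use ij in \<open>simp add: k_def\<close>)
    then have "h (a \<triangleright> b) = (int i + int u * (int j - int i + int p)) mod int p"
      by (simp add: hc zmod_int k)
    also have "\<dots> = (int i + int u * (int j - int i)) mod int p"
      by (simp add: distrib_left add.assoc[symmetric])
    also have "\<dots> = h a \<triangleright>\<^bsub>Aff (integer_mod_group p) (zmul p u)\<^esub> h b"
      using bij_betwE[OF hb] ab p1 ij hc[of i] hc[of j] by (subst Aff_zmul) auto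
    finally show ?thesis .
  qed
  then have "h \<in> quandle_iso Q (Aff (integer_mod_group p) (zmul p u))"
    using hb by (simp add: quandle_iso_def)
  then show ?thesis using that u1 u(1) by blast
qed

text \<open>Suppose \<open>a \<triangleright> b = b\<close> with \<open>a \<noteq> b\<close>. By
  connectedness every point then fixes another one, and only one, since a nontrivial permutation of
  four points cannot fix three. This partner relation is symmetric, so it pairs up the four points,
  and every left translation preserves \<open>{a, b}\<close>, a proper closed subset.\<close>

lemma card_4_fixed:
  assumes four: "card (carrier Q) = 4" and ab: "a \<in> carrier Q" "b \<in> carrier Q" "a \<triangleright> b = b"
  shows "a = b"
proof (rule ccontr)
  assume "a \<noteq> b"
  have inj: "y = z" if "x \<in> carrier Q" "y \<in> carrier Q" "z \<in> carrier Q" "x \<triangleright> y = x \<triangleright> z" for x y z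
    using left_translation_bij[OF that(1)] that by (auto simp: bij_betw_def dest: inj_onD)
  have surj: "\<exists>z\<in>carrier Q. x \<triangleright> z = y" if "x \<in> carrier Q" "y \<in> carrier Q" for x y
    using left_div[OF that] by blast
  have fourth: "\<exists>w. carrier Q = {x, y, z, w} \<and> w \<notin> {x, y, z}"
    if "x \<in> carrier Q" "y \<in> carrier Q" "z \<in> carrier Q" "distinct [x, y, z]" for x y z
  proof -
    have "card (carrier Q - {x, y, z}) = 1"
      using that four finite by (subst card_Diff_subset) auto
    then obtain w where "carrier Q - {x, y, z} = {w}" by (rule card_1_singletonE)
    then show ?thesis using that by blast
  qed
  \<comment> \<open>The points with trivial left translation form a closed set, so one of them would
    make all left translations trivial.\<close>
  have notrivial: "\<exists>y\<in>carrier Q. x \<triangleright> y \<noteq> y" if x: "x \<in> carrier Q" for x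
  proof (rule ccontr)
    assume *: "\<not> ?thesis"
    let ?S = "{x \<in> carrier Q. \<forall>y\<in>carrier Q. x \<triangleright> y = y}"
    have "?S = carrier Q"
    proof (rule eq_carrierI[of _ x])
      fix c z assume c: "c \<in> carrier Q" "z \<in> ?S"
      have "(c \<triangleright> z) \<triangleright> y = y" if y: "y \<in> carrier Q" for y
      proof -
        obtain y' where y': "y' \<in> carrier Q" "c \<triangleright> y' = y" using surj[OF c(1) y] by blast
        then show ?thesis using left_distrib[of c z y'] c by auto
      qed
      then show "c \<triangleright> z \<in> ?S" using c qop_closed by auto
    qed (use x * in auto)
    moreover obtain a where "a \<in> carrier Q" "a \<triangleright> x \<noteq> x"
      using singleton_not_closed[OF _ x] four by auto
    ultimately show False using x by blast
  qed
  have uniq: "y = z"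
    if "x \<in> carrier Q" "y \<in> carrier Q" "z \<in> carrier Q" "x \<triangleright> y = y" "x \<triangleright> z = z" "y \<noteq> x" "z \<noteq> x" for x y z
  proof (rule ccontr)
    assume "y \<noteq> z"
    then have "distinct [x, y, z]" using that(6,7) by auto
    from fourth[OF that(1-3) this]
    obtain w where w: "carrier Q = {x, y, z, w}" "w \<notin> {x, y, z}" by blast
    have "x \<triangleright> w \<in> carrier Q" using qop_closed that(1) w by blast
    moreover have "x \<triangleright> w \<noteq> v" if "v \<in> {x, y, z}" for v
    proof
      assume "x \<triangleright> w = v"
      moreover have "x \<triangleright> v = v"
        using that idem \<open>x \<in> carrier Q\<close> \<open>x \<triangleright> y = y\<close> \<open>x \<triangleright> z = z\<close> by auto
      ultimately have "w = v" using inj[of x w v] w that by auto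
      then show False using w that by blast
    qed
    ultimately have "x \<triangleright> w = w" using w by blast
    then show False using notrivial[OF that(1)] w idem[OF that(1)] that(4,5) by auto
  qed
  have partner: "\<exists>y\<in>carrier Q. y \<noteq> x \<and> x \<triangleright> y = y" if x: "x \<in> carrier Q" for x
  proof -
    let ?S = "{x \<in> carrier Q. \<exists>y\<in>carrier Q. y \<noteq> x \<and> x \<triangleright> y = y}"
    have "?S = carrier Q"
    proof (rule eq_carrierI[of _ a])
      fix c z assume c: "c \<in> carrier Q" and "z \<in> ?S"
      then obtain y where z: "z \<in> carrier Q" "y \<in> carrier Q" "y \<noteq> z" "z \<triangleright> y = y" by blast
      have "c \<triangleright> y \<noteq> c \<triangleright> z" using inj[OF c z(2,1)] z(3) by blast
      moreover have "(c \<triangleright> z) \<triangleright> (c \<triangleright> y) = c \<triangleright> y" using left_distrib[OF c z(1,2)] z(4) by simp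
      ultimately show "c \<triangleright> z \<in> ?S" using c z qop_closed by blast
    qed (use ab \<open>a \<noteq> b\<close> in auto)
    then show ?thesis using x by blast
  qed
  have sym: "y \<triangleright> x = x" if xy: "x \<in> carrier Q" "y \<in> carrier Q" "x \<triangleright> y = y" "x \<noteq> y" for x y
  proof -
    obtain y' where y': "y' \<in> carrier Q" "y' \<noteq> y" "y \<triangleright> y' = y'" using partner[OF xy(2)] by blast
    have "y \<triangleright> (x \<triangleright> y') = x \<triangleright> y'" using left_distrib[OF xy(1,2) y'(1)] xy(3) y'(3) by simp
    moreover have "x \<triangleright> y' \<noteq> y" using inj[OF xy(1) y'(1) xy(2)] xy(3) y'(2) by auto
    \<comment> \<open>Distributivity makes \<open>x \<triangleright> y'\<close> a point fixed by
      \<open>y\<close>, and \<open>y\<close> fixes only one other point. Then \<open>x\<close> fixes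
      both \<open>y\<close> and \<open>y'\<close>, which forces \<open>y' = x\<close>.\<close>
    ultimately have "x \<triangleright> y' = y'"
      using uniq[OF xy(2) qop_closed[OF xy(1) y'(1)] y'(1)] y' by blast
    then have "y' = x" using uniq[OF xy(1) y'(1) xy(2)] xy y' by blast
    then show ?thesis using y'(3) by simp
  qed
  have ba: "b \<triangleright> a = a" using sym[OF ab] \<open>a \<noteq> b\<close> by blast
  have "{a, b} = carrier Q"
  proof (rule eq_carrierI[of _ a])
    fix c y assume c: "c \<in> carrier Q" and y: "y \<in> {a, b}"
    show "c \<triangleright> y \<in> {a, b}"
    proof (cases "c \<in> {a, b}")
      case True
      then show ?thesis using y ab ba idem by auto
    next
      case False
      obtain d where d: "d \<in> carrier Q" "d \<noteq> c" "c \<triangleright> d = d" using partner[OF c] by blast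
      have "d \<triangleright> c = c" using sym[OF c d(1,3)] d(2) by blast
      then have "d \<notin> {a, b}"
        using uniq[OF ab(1,2) c] uniq[OF ab(2,1) c] ab ba \<open>a \<noteq> b\<close> False by auto
      have y': "y \<in> carrier Q" using y ab by auto
      have "carrier Q = {a, b, c, d}"
        using fourth[of a b c] ab c d \<open>a \<noteq> b\<close> False \<open>d \<notin> {a, b}\<close> by auto
      moreover have "c \<triangleright> y \<noteq> c" "c \<triangleright> y \<noteq> d"
        using inj[OF c y' c] inj[OF c y' d(1)] idem[OF c] d(3) y False \<open>d \<notin> {a, b}\<close> by auto
      ultimately show ?thesis using qop_closed[OF c y'] by blast
    qed
  qed (use ab in auto)
  moreover have "card {a, b} \<le> 2" by (simp add: card_insert_if)
  ultimately show False using four by simp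
qed

text \<open>Every left translation fixes only its own point, hence is a 3-cycle on the others.
  Naming the points along the cycle of \<open>x\<close>, one value of \<open>L y\<close> remains to
  be decided, and distributivity rules out the wrong orientation.\<close>

theorem card_4_affine:
  assumes four: "card (carrier Q) = 4"
  obtains h where "h \<in> quandle_iso Q (Aff Z2_squared omega)"
proof -
  note fixed = card_4_fixed[OF four]
  have inj: "y = z" if "x \<in> carrier Q" "y \<in> carrier Q" "z \<in> carrier Q" "x \<triangleright> y = x \<triangleright> z" for x y z
    using left_translation_bij[OF that(1)] that by (auto simp: bij_betw_def dest: inj_onD)
  have "\<not> card (carrier Q) \<le> 1" using four by simp
  then obtain x y where xy: "x \<in> carrier Q" "y \<in> carrier Q" "x \<noteq> y"
    using card_le_Suc0_iff_eq[OF finite] by auto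
  define z where "z = x \<triangleright> y"
  define w where "w = x \<triangleright> z"
  have z: "z \<in> carrier Q" "z \<noteq> x" "z \<noteq> y"
    using xy qop_closed fixed[OF xy(1,2)] inj[OF xy(1,2,1)] idem[OF xy(1)] by (auto simp: z_def)
  have w: "w \<in> carrier Q" "w \<noteq> x" "w \<noteq> z"
    using xy z(1) qop_closed fixed[OF xy(1) z(1)] inj[OF xy(1) z(1) xy(1)] idem[OF xy(1)] z by (auto simp: w_def)
  have wy: "w \<noteq> y"
  proof
    \<comment> \<open>\<open>L x\<close> would exchange \<open>y\<close> and \<open>z\<close> and
      thus fix the fourth point.\<close>
    assume "w = y"
    have "card (carrier Q - {x, y, z}) = 1"
      using xy z four finite by (subst card_Diff_subset) auto
    then obtain v where v: "carrier Q - {x, y, z} = {v}" by (rule card_1_singletonE)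
    then have vC: "v \<in> carrier Q" "v \<notin> {x, y, z}" by auto
    have "x \<triangleright> v \<noteq> x" "x \<triangleright> v \<noteq> y" "x \<triangleright> v \<noteq> z" "x \<triangleright> v \<noteq> v"
      using inj[OF xy(1) vC(1) xy(1)] inj[OF xy(1) vC(1) z(1)] inj[OF xy(1) vC(1) xy(2)] fixed[OF xy(1) vC(1)]
        idem[OF xy(1)] vC \<open>w = y\<close> by (auto simp: z_def w_def)
    then show False using v qop_closed[OF xy(1) vC(1)] by blast
  qed
  have C: "carrier Q = {x, y, z, w}"
    using xy z w wy four finite by (intro card_subset_eq[symmetric]) auto
  have neq: "x \<noteq> y" "x \<noteq> z" "x \<noteq> w" "y \<noteq> z" "y \<noteq> w" "z \<noteq> w"
    using xy z w wy by auto
  have mem: "x \<in> carrier Q" "y \<in> carrier Q" "z \<in> carrier Q" "w \<in> carrier Q" using C by auto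
  have xs: "x \<triangleright> x = x" "x \<triangleright> y = z" "x \<triangleright> z = w"
    using idem mem by (auto simp: z_def w_def)
  have xw: "x \<triangleright> w = y"
    using qop_closed[OF mem(1,4)] inj[OF mem(1,4,1)] inj[OF mem(1,4,2)] inj[OF mem(1,4,3)] xs neq
    unfolding C by auto
  have yx: "y \<triangleright> x = w"
  proof (rule ccontr)
    assume "y \<triangleright> x \<noteq> w"
    then have yx: "y \<triangleright> x = z"
      using qop_closed[OF mem(2,1)] fixed[OF mem(2,1)] inj[OF mem(2,1,2)] idem[OF mem(2)] neq unfolding C by auto
    have yz: "y \<triangleright> z = w"
    proof -
      have "y \<triangleright> z \<noteq> y" "y \<triangleright> z \<noteq> z" "y \<triangleright> z \<noteq> x \<or> y \<triangleright> w = w"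
        using fixed[OF mem(2,3)] inj[OF mem(2,3,2)] idem[OF mem(2)] neq
          qop_closed[OF mem(2,4)] inj[OF mem(2,4,2)] inj[OF mem(2,4,1)] inj[OF mem(2,4,3)] yx unfolding C by auto
      then show ?thesis using qop_closed[OF mem(2,3)] fixed[OF mem(2,4)] neq unfolding C by auto
    qed
    have yw: "y \<triangleright> w = x"
      using qop_closed[OF mem(2,4)] inj[OF mem(2,4,2)] inj[OF mem(2,4,1)] inj[OF mem(2,4,3)] yx yz idem[OF mem(2)] neq
      unfolding C by auto
    have "z \<triangleright> w = y" using left_distrib[OF mem(1,2,3)] xs xw yz by simp
    moreover have "y \<triangleright> (x \<triangleright> z) = (y \<triangleright> x) \<triangleright> (y \<triangleright> z)" using left_distrib[OF mem(2,1,3)] .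
    ultimately show False using xs yx yz yw neq by simp
  qed
  have yz: "y \<triangleright> z = x"
  proof -
    have "y \<triangleright> z \<noteq> y" "y \<triangleright> z \<noteq> z" "y \<triangleright> z \<noteq> w"
      using fixed[OF mem(2,3)] inj[OF mem(2,3,2)] inj[OF mem(2,3,1)] idem[OF mem(2)] neq yx by auto
    then show ?thesis using qop_closed[OF mem(2,3)] unfolding C by auto
  qed
  have yw: "y \<triangleright> w = z"
    using qop_closed[OF mem(2,4)] inj[OF mem(2,4,2)] inj[OF mem(2,4,1)] inj[OF mem(2,4,3)] yx yz idem[OF mem(2)] neq
    unfolding C by auto
  have zs: "z \<triangleright> x = y" "z \<triangleright> y = w" "z \<triangleright> w = x"
    using left_distrib[OF mem(1,2,1)] left_distrib[OF mem(1,2,4)] left_distrib[OF mem(1,2,3)] xs xw yx yz yw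
    by auto
  have ws: "w \<triangleright> x = z" "w \<triangleright> z = y" "w \<triangleright> y = x"
    using left_distrib[OF mem(1,3,1)] left_distrib[OF mem(1,3,2)] left_distrib[OF mem(1,3,4)] xs xw zs
    by auto
  define h where "h = (\<lambda>v. if v = x then (0, 0) else if v = y then (1, 0) else if v = z then (0, 1) else (1::int, 1::int))"
  have hs: "h x = (0, 0)" "h y = (1, 0)" "h z = (0, 1)" "h w = (1, 1)"
    using neq by (auto simp: h_def)
  have "bij_betw h (carrier Q) (carrier Z2_squared)"
    unfolding C carrier_Z2_squared bij_betw_def inj_on_def by (auto simp: hs)
  moreover have "h (a \<triangleright> b) = h a \<triangleright>\<^bsub>Aff Z2_squared omega\<^esub> h b" if "a \<in> carrier Q" "b \<in> carrier Q" for a b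
  proof -
    have "h a \<in> carrier Z2_squared" "h b \<in> carrier Z2_squared"
      using that unfolding C by (auto simp: hs carrier_Z2_squared)
    note eq = Aff_omega[OF this]
    have "a = x \<or> a = y \<or> a = z \<or> a = w" "b = x \<or> b = y \<or> b = z \<or> b = w"
      using that unfolding C by auto
    then show ?thesis
      unfolding eq
      by (elim disjE; simp only: hs xs xw yx yz yw zs ws idem[OF mem(2)] idem[OF mem(3)] idem[OF mem(4)]; simp)
  qed
  ultimately have "h \<in> quandle_iso Q (Aff Z2_squared omega)"
    by (simp add: quandle_iso_def)
  then show ?thesis using that by blast
qed

end

section \<open>Affine quotients\<close>

text \<open>Multiplication by \<open>t\<close> is invertible modulo \<open>p\<close>, so natural
  multiples of \<open>t\<close> reach every residue.\<close>

lemma prime_translation_covers: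
  fixes a t v :: int
  assumes p: "Factorial_Ring.prime (p :: nat)" and t: "\<not> int p dvd t"
  shows "\<exists>i :: nat. int p dvd a + int i * t - v"
proof -
  have "coprime (int p) t"
    using p t by (intro prime_imp_coprime) auto
  then obtain x y where "x * int p + y * t = 1"
    using bezout_int[of "int p" t] by (auto simp: coprime_iff_gcd_eq_1)
  then have xy: "y * t = 1 - x * int p" by simp
  define m where "m = (v - a) * y"
  have "a + (m mod int p) * t - v = a + (v - a) * (y * t) - v - int p * (m div int p * t)"
    unfolding minus_div_mult_eq_mod[symmetric] by (simp add: m_def algebra_simps)
  also have "\<dots> = int p * ((a - v) * x - m div int p * t)"
    unfolding xy by (simp add: algebra_simps)
  finally have "int p dvd a + int (nat (m mod int p)) * t - v"
    using prime_gt_0_nat[OF p] by simp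
  then show ?thesis by blast
qed

text \<open>The regrouping that brings inverse factors together when one affine left translation is
  composed with the inverse of another.\<close>

lemma (in comm_group) mult_rearrange:
  assumes "a \<in> carrier G" "b \<in> carrier G" "c \<in> carrier G" "d \<in> carrier G" "e \<in> carrier G"
    "f \<in> carrier G" "g \<in> carrier G"
  shows "(a \<otimes> b) \<otimes> (c \<otimes> d) \<otimes> (e \<otimes> (f \<otimes> g)) = a \<otimes> (f \<otimes> b) \<otimes> ((c \<otimes> e) \<otimes> (d \<otimes> g))"
  using assms by (simp add: m_ac)

lemma zmul_hom: "zmul n u \<in> hom (integer_mod_group n) (integer_mod_group n)"
proof (rule homI)
  fix x y assume xy: "x \<in> carrier (integer_mod_group n)" "y \<in> carrier (integer_mod_group n)"
  then show "zmul n u x \<in> carrier (integer_mod_group n)"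
    by (auto simp: zmul_def carrier_integer_mod_group)
  have "x \<otimes>\<^bsub>integer_mod_group n\<^esub> y \<in> carrier (integer_mod_group n)"
    using xy group.is_monoid[OF group_integer_mod_group] monoid.m_closed by metis
  then show "zmul n u (x \<otimes>\<^bsub>integer_mod_group n\<^esub> y)
      = zmul n u x \<otimes>\<^bsub>integer_mod_group n\<^esub> zmul n u y"
    using xy by (simp add: zmul_def mod_simps distrib_left)
qed

lemma omega_hom: "omega \<in> hom Z2_squared Z2_squared"
proof (rule homI)
  fix x y assume xy: "x \<in> carrier Z2_squared" "y \<in> carrier Z2_squared"
  from xy(1) show "omega x \<in> carrier Z2_squared"
    unfolding carrier_Z2_squared
    by (elim insertE emptyE; simp only: omega_def restrict_apply' carrier_Z2_squared) simp_all
  show "omega (x \<otimes>\<^bsub>Z2_squared\<^esub> y) = omega x \<otimes>\<^bsub>Z2_squared\<^esub> omega y"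
    using xy unfolding carrier_Z2_squared
    by (elim insertE emptyE; simp add: mult_Z2_squared omega_def carrier_Z2_squared)
qed

lemma comm_group_Z2_squared: "comm_group Z2_squared"
proof (rule group.group_comm_groupI)
  show "group Z2_squared" by (intro DirProd_group) simp_all
  fix x y
  show "x \<otimes>\<^bsub>Z2_squared\<^esub> y = y \<otimes>\<^bsub>Z2_squared\<^esub> x"
    by (simp only: mult_Z2_squared add.commute)
qed

context finite_connected_quandle
begin

definition aff_map :: "('c, 'd) monoid_scheme \<Rightarrow> ('c \<Rightarrow> 'c) \<Rightarrow> ('a \<Rightarrow> 'c) \<Rightarrow> bool"
  where "aff_map A f \<pi> \<longleftrightarrow> comm_group A \<and> f \<in> hom A A \<and> \<pi> ` carrier Q = carrier A \<and>
    (\<forall>a\<in>carrier Q. \<forall>b\<in>carrier Q. \<pi> (a \<triangleright> b) = \<pi> a \<triangleright>\<^bsub>Aff A f\<^esub> \<pi> b)"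

definition semiregular_on :: "('a \<times> 'a) set \<Rightarrow> bool"
  where "semiregular_on r \<longleftrightarrow>
    (\<forall>d\<in>dis. \<forall>x\<in>carrier Q. (d x, x) \<in> r \<longrightarrow> (\<forall>y\<in>carrier Q. (d y, y) \<in> r))"

text \<open>In additive notation, \<open>L a \<circ> finv (L b)\<close> acts on an affine quotient
  as translation by \<open>(1 - f) (\<pi> a - \<pi> b)\<close>; the permutations inducing
  translations form a subgroup.\<close>

lemma aff_map_translation:
  assumes "aff_map A f \<pi>" and d: "d \<in> dis"
  shows "\<exists>t\<in>carrier A. \<forall>x\<in>carrier Q. \<pi> (d x) = t \<otimes>\<^bsub>A\<^esub> \<pi> x"
proof -
  interpret A: comm_group A using assms(1) by (simp add: aff_map_def)
  have f: "f \<in> hom A A" and im: "\<pi> ` carrier Q = carrier A"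
    and hom: "\<And>a b. a \<in> carrier Q \<Longrightarrow> b \<in> carrier Q \<Longrightarrow> \<pi> (a \<triangleright> b) = \<pi> a \<triangleright>\<^bsub>Aff A f\<^esub> \<pi> b"
    using assms(1) by (auto simp: aff_map_def)
  have \<pi>: "\<pi> x \<in> carrier A" if "x \<in> carrier Q" for x using im that by blast
  have fc: "f x \<in> carrier A" if "x \<in> carrier A" for x using f that by (auto simp: hom_def)
  interpret f: group_hom A A f using f by unfold_locales
  let ?A = "{d. d permutes carrier Q \<and> (\<exists>t\<in>carrier A. \<forall>x\<in>carrier Q. \<pi> (d x) = t \<otimes>\<^bsub>A\<^esub> \<pi> x)}"
  have "dis \<subseteq> ?A"
  proof (rule dis_subset[OF subgroup_perms_onI])
    show "id \<in> ?A" using \<pi> by (auto simp: permutes_id intro!: bexI[of _ "\<one>\<^bsub>A\<^esub>"])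
  next
    fix g h assume "g \<in> ?A" "h \<in> ?A"
    then obtain s t where st: "g permutes carrier Q" "h permutes carrier Q" "s \<in> carrier A" "t \<in> carrier A"
      "\<And>x. x \<in> carrier Q \<Longrightarrow> \<pi> (g x) = s \<otimes>\<^bsub>A\<^esub> \<pi> x" "\<And>x. x \<in> carrier Q \<Longrightarrow> \<pi> (h x) = t \<otimes>\<^bsub>A\<^esub> \<pi> x"
      by auto
    then have "\<pi> ((g \<circ> h) x) = (s \<otimes>\<^bsub>A\<^esub> t) \<otimes>\<^bsub>A\<^esub> \<pi> x" if "x \<in> carrier Q" for x
      using that \<pi> permutes_in_image[OF st(2)] by (simp add: A.m_assoc)
    then show "g \<circ> h \<in> ?A" using st A.m_closed permutes_compose by blast
  next
    fix g assume "g \<in> ?A"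
    then obtain s where s: "g permutes carrier Q" "s \<in> carrier A"
      "\<And>x. x \<in> carrier Q \<Longrightarrow> \<pi> (g x) = s \<otimes>\<^bsub>A\<^esub> \<pi> x"
      by auto
    have "\<pi> (finv g x) = inv\<^bsub>A\<^esub> s \<otimes>\<^bsub>A\<^esub> \<pi> x" if x: "x \<in> carrier Q" for x
    proof -
      have "finv g x \<in> carrier Q" using permutes_in_image[OF permutes_inv[OF s(1)]] x by simp
      from s(3)[OF this] have "\<pi> x = s \<otimes>\<^bsub>A\<^esub> \<pi> (finv g x)"
        by (simp add: permutes_inverses(1)[OF s(1)])
      then show ?thesis
        using s(2) \<pi> \<open>finv g x \<in> carrier Q\<close> by (simp add: A.m_assoc[symmetric])
    qed
    then show "finv g \<in> ?A" using permutes_inv[OF s(1)] s(2) A.inv_closed by blast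
  next
    fix a b assume ab: "a \<in> carrier Q" "b \<in> carrier Q"
    let ?t = "(\<pi> a \<otimes>\<^bsub>A\<^esub> inv\<^bsub>A\<^esub> f (\<pi> a)) \<otimes>\<^bsub>A\<^esub> (inv\<^bsub>A\<^esub> \<pi> b \<otimes>\<^bsub>A\<^esub> f (\<pi> b))"
    have "\<pi> ((L a \<circ> finv (L b)) x) = ?t \<otimes>\<^bsub>A\<^esub> \<pi> x" if x: "x \<in> carrier Q" for x
    proof -
      define y where "y = finv (L b) x"
      have y: "y \<in> carrier Q" "b \<triangleright> y = x"
        using permutes_in_image[OF permutes_inv[OF L_permutes[OF ab(2)]]] x
          permutes_inverses(1)[OF L_permutes[OF ab(2)], of x] by (auto simp: y_def L_apply[symmetric])
      note mem = \<pi>[OF ab(1)] \<pi>[OF ab(2)] \<pi>[OF y(1)] fc[OF \<pi>[OF ab(1)]] fc[OF \<pi>[OF ab(2)]] fc[OF \<pi>[OF y(1)]]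
      have 1: "\<pi> x = \<pi> b \<otimes>\<^bsub>A\<^esub> (f (\<pi> y) \<otimes>\<^bsub>A\<^esub> inv\<^bsub>A\<^esub> f (\<pi> b))"
        using hom[OF ab(2) y(1)] mem by (simp add: y(2))
      have 2: "\<pi> (a \<triangleright> y) = \<pi> a \<otimes>\<^bsub>A\<^esub> (f (\<pi> y) \<otimes>\<^bsub>A\<^esub> inv\<^bsub>A\<^esub> f (\<pi> a))"
        using hom[OF ab(1) y(1)] mem by simp
      have "?t \<otimes>\<^bsub>A\<^esub> \<pi> x = \<pi> a \<otimes>\<^bsub>A\<^esub> (f (\<pi> y) \<otimes>\<^bsub>A\<^esub> inv\<^bsub>A\<^esub> f (\<pi> a))
          \<otimes>\<^bsub>A\<^esub> ((inv\<^bsub>A\<^esub> \<pi> b \<otimes>\<^bsub>A\<^esub> \<pi> b) \<otimes>\<^bsub>A\<^esub> (f (\<pi> b) \<otimes>\<^bsub>A\<^esub> inv\<^bsub>A\<^esub> f (\<pi> b)))"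
        unfolding 1 using mem by (intro A.mult_rearrange) simp_all
      then have "?t \<otimes>\<^bsub>A\<^esub> \<pi> x = \<pi> (a \<triangleright> y)" using mem 2 by simp
      then show ?thesis using y(1) by (simp add: y_def[symmetric] L_apply)
    qed
    moreover have "?t \<in> carrier A" using \<pi> fc ab by simp
    ultimately show "L a \<circ> finv (L b) \<in> ?A"
      using permutes_compose[OF permutes_inv[OF L_permutes[OF ab(2)]] L_permutes[OF ab(1)]] by blast
  qed auto
  then show ?thesis using d by blast
qed

text \<open>A translation with a fixed point is the identity.\<close>

lemma aff_map_semiregular:
  assumes \<pi>: "aff_map A f \<pi>"
    and r: "\<And>x y. (x, y) \<in> r \<longleftrightarrow> x \<in> carrier Q \<and> y \<in> carrier Q \<and> \<pi> x = \<pi> y"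
  shows "semiregular_on r"
  unfolding semiregular_on_def
proof (intro ballI impI)
  fix d x y assume d: "d \<in> dis" and x: "x \<in> carrier Q" "(d x, x) \<in> r" and y: "y \<in> carrier Q"
  interpret A: comm_group A using \<pi> by (simp add: aff_map_def)
  have mem: "\<pi> x \<in> carrier A" "\<pi> y \<in> carrier A" using \<pi> x y by (auto simp: aff_map_def)
  obtain t where t: "t \<in> carrier A" "\<And>x. x \<in> carrier Q \<Longrightarrow> \<pi> (d x) = t \<otimes>\<^bsub>A\<^esub> \<pi> x"
    using aff_map_translation[OF \<pi> d] by blast
  have "t \<otimes>\<^bsub>A\<^esub> \<pi> x = \<pi> x" using t(2)[OF x(1)] x(2) r by simp
  then have "t = \<one>\<^bsub>A\<^esub>" using A.r_cancel_one[OF mem(1) t(1)] by simp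
  then have "\<pi> (d y) = \<pi> y" using t(2)[OF y] A.l_one[OF mem(2)] by simp
  moreover have "d y \<in> carrier Q" using lmult_closed d dis_lmult y by blast
  ultimately show "(d y, y) \<in> r" using r y by blast
qed

lemma iso_imp_aff_map:
  assumes r: "congr r" and A: "comm_group A" "f \<in> hom A A" and h: "h \<in> quandle_iso (quot r) (Aff A f)"
  shows "aff_map A f (\<lambda>x. h (r `` {x}))"
    and "(x, y) \<in> r \<longleftrightarrow> x \<in> carrier Q \<and> y \<in> carrier Q \<and> h (r `` {x}) = h (r `` {y})"
proof -
  have car: "carrier (quot r) = (\<lambda>x. r `` {x}) ` carrier Q"
    by (auto simp: quot_def quotient_def)
  have bij: "bij_betw h (carrier (quot r)) (carrier A)"
    and hom: "\<And>a b. a \<in> carrier (quot r) \<Longrightarrow> b \<in> carrier (quot r) \<Longrightarrow>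
      h (a \<triangleright>\<^bsub>quot r\<^esub> b) = h a \<triangleright>\<^bsub>Aff A f\<^esub> h b"
    using h by (auto simp: quandle_iso_def)
  have "(\<lambda>x. h (r `` {x})) ` carrier Q = carrier A"
    using bij unfolding car bij_betw_def by (simp add: image_image)
  moreover have "h (r `` {a \<triangleright> b}) = h (r `` {a}) \<triangleright>\<^bsub>Aff A f\<^esub> h (r `` {b})"
    if "a \<in> carrier Q" "b \<in> carrier Q" for a b
    using hom[of "r `` {a}" "r `` {b}"] that quot_op[OF r that] by (auto simp: car)
  ultimately show "aff_map A f (\<lambda>x. h (r `` {x}))"
    using A by (simp add: aff_map_def del: Aff_simps)
  show "(x, y) \<in> r \<longleftrightarrow> x \<in> carrier Q \<and> y \<in> carrier Q \<and> h (r `` {x}) = h (r `` {y})"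
  proof
    assume "(x, y) \<in> r"
    then show "x \<in> carrier Q \<and> y \<in> carrier Q \<and> h (r `` {x}) = h (r `` {y})"
      using congrD(3)[OF r] equiv_class_eq[OF congrD(1)[OF r]] by metis
  next
    assume *: "x \<in> carrier Q \<and> y \<in> carrier Q \<and> h (r `` {x}) = h (r `` {y})"
    then have "r `` {x} = r `` {y}"
      using inj_onD[OF bij_betw_imp_inj_on[OF bij], of "r `` {x}" "r `` {y}"] by (auto simp: car)
    then show "(x, y) \<in> r" using * eq_equiv_class_iff[OF congrD(1)[OF r]] by blast
  qed
qed

lemma prime_quotient:
  assumes p: "Factorial_Ring.prime p" and r: "congr r" "card (carrier Q // r) = p"
  obtains u \<pi> where "1 < u" "u < p" "aff_map (integer_mod_group p) (zmul p u) \<pi>"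
    "\<And>x y. (x, y) \<in> r \<longleftrightarrow> x \<in> carrier Q \<and> y \<in> carrier Q \<and> \<pi> x = \<pi> y"
proof -
  interpret R: finite_connected_quandle "quot r" using quot_connected[OF r(1)] .
  have "card (carrier (quot r)) = p" using r(2) by (simp add: quot_def)
  then obtain u h where uh: "1 < u" "u < p" "h \<in> quandle_iso (quot r) (Aff (integer_mod_group p) (zmul p u))"
    using R.prime_affine[OF p] by blast
  show ?thesis
    using that[OF uh(1,2) iso_imp_aff_map[OF r(1) abelian_integer_mod_group zmul_hom uh(3)]] .
qed

lemma card_4_quotient:
  assumes r: "congr r" "card (carrier Q // r) = 4"
  obtains \<pi> where "aff_map Z2_squared omega \<pi>"
    "\<And>x y. (x, y) \<in> r \<longleftrightarrow> x \<in> carrier Q \<and> y \<in> carrier Q \<and> \<pi> x = \<pi> y"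
proof -
  interpret R: finite_connected_quandle "quot r" using quot_connected[OF r(1)] .
  have "card (carrier (quot r)) = 4" using r(2) by (simp add: quot_def)
  then obtain h where h: "h \<in> quandle_iso (quot r) (Aff Z2_squared omega)"
    using R.card_4_affine by blast
  show ?thesis
    using that[OF iso_imp_aff_map[OF r(1) comm_group_Z2_squared omega_hom h]] .
qed

text \<open>The displacements that fix all classes of \<open>\<beta>\<close> are transitive on each of them, so \<open>\<alpha>\<close> and
  \<open>\<beta>\<close> permute.\<close>

lemma permuting_congruences:
  assumes \<alpha>: "congr \<alpha>" and \<beta>: "congr \<beta>" and reg: "semiregular_on \<beta>"
    and disj: "\<And>x y. (x, y) \<in> \<alpha> \<Longrightarrow> (x, y) \<in> \<beta> \<Longrightarrow> x = y"
  obtains \<theta> where "congr \<theta>" "\<And>x. x \<in> carrier Q \<Longrightarrow> card (\<theta> `` {x}) = card (\<alpha> `` {x}) * card (\<beta> `` {x})"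
proof -
  define \<theta> where "\<theta> = \<beta> O \<alpha>"
  note A = congrD[OF \<alpha>] and B = congrD[OF \<beta>]
  have swap: "(x, z) \<in> \<alpha> O \<beta>" if xz: "(x, z) \<in> \<beta> O \<alpha>" for x z
  proof -
    obtain y where y: "(x, y) \<in> \<beta>" "(y, z) \<in> \<alpha>" using xz by blast
    then have C: "x \<in> carrier Q" "y \<in> carrier Q" "z \<in> carrier Q" using A(3) B(3) by blast+
    obtain d where d: "d \<in> dis" "d y = x" using dis_transitive C by blast
    have "(d z, z) \<in> \<beta>"
      using reg d y(1) C unfolding semiregular_on_def by blast
    moreover have "(d y, d z) \<in> \<alpha>"
      using lmult_congr[OF \<alpha> _ y(2)] d(1) dis_lmult by blast
    ultimately show ?thesis using d(2) by blast
  qed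
  have conv: "(z, x) \<in> \<beta> O \<alpha>" if "(x, z) \<in> \<alpha> O \<beta>" for x z
    using that by (elim relcompE) (auto intro: A(5) B(5))
  have "congr \<theta>"
    unfolding congr_def
  proof (intro conjI allI impI)
    show "equiv (carrier Q) \<theta>"
    proof (intro equivI refl_onI symI transI)
      show "\<theta> \<subseteq> carrier Q \<times> carrier Q"
      proof (intro subrelI SigmaI)
        fix x y assume "(x, y) \<in> \<theta>"
        then obtain z where "(x, z) \<in> \<beta>" "(z, y) \<in> \<alpha>" by (auto simp: \<theta>_def)
        then show "x \<in> carrier Q" "y \<in> carrier Q" using A(3) B(3) by simp_all
      qed
      show "(x, x) \<in> \<theta>" if "x \<in> carrier Q" for x using A(4) B(4) that by (auto simp: \<theta>_def)
      show "(y, x) \<in> \<theta>" if "(x, y) \<in> \<theta>" for x y using conv swap that by (auto simp: \<theta>_def)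
      fix x y z assume "(x, y) \<in> \<theta>" "(y, z) \<in> \<theta>"
      then obtain v w where vw: "(x, v) \<in> \<beta>" "(v, y) \<in> \<alpha>" "(y, w) \<in> \<beta>" "(w, z) \<in> \<alpha>"
        by (auto simp: \<theta>_def)
      from vw(2,3) have "(v, w) \<in> \<alpha> O \<beta>" by (rule relcompI)
      from conv[OF swap[OF conv[OF this]]] have "(v, w) \<in> \<beta> O \<alpha>" .
      then obtain s where "(v, s) \<in> \<beta>" "(s, w) \<in> \<alpha>" by blast
      then have "(x, s) \<in> \<beta>" "(s, z) \<in> \<alpha>" using B(6)[OF vw(1)] A(6)[OF _ vw(4)] by simp_all
      then show "(x, z) \<in> \<theta>" unfolding \<theta>_def by (rule relcompI)
    qed
    fix a a' b b' assume "(a, a') \<in> \<theta>" "(b, b') \<in> \<theta>"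
    then obtain v w where "(a, v) \<in> \<beta>" "(v, a') \<in> \<alpha>" "(b, w) \<in> \<beta>" "(w, b') \<in> \<alpha>"
      by (auto simp: \<theta>_def)
    then have "(a \<triangleright> b, v \<triangleright> w) \<in> \<beta>" "(v \<triangleright> w, a' \<triangleright> b') \<in> \<alpha>" using A(2) B(2) by simp_all
    then show "(a \<triangleright> b, a' \<triangleright> b') \<in> \<theta>" unfolding \<theta>_def by (rule relcompI)
  qed
  moreover have "card (\<theta> `` {x}) = card (\<alpha> `` {x}) * card (\<beta> `` {x})" if x: "x \<in> carrier Q" for x
  proof -
    have sub: "\<alpha> `` {y} \<subseteq> carrier Q" "\<beta> `` {y} \<subseteq> carrier Q" for y
      using A(3)[of y] B(3)[of y] by (simp_all add: subset_iff)
    have "\<theta> `` {x} = (\<Union>y\<in>\<beta> `` {x}. \<alpha> `` {y})" by (auto simp: \<theta>_def)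
    also have "card \<dots> = (\<Sum>y\<in>\<beta> `` {x}. card (\<alpha> `` {y}))"
    proof (rule card_UN_disjoint)
      show "finite (\<beta> `` {x})" "\<forall>y\<in>\<beta> `` {x}. finite (\<alpha> `` {y})"
        using finite_subset[OF sub(1) finite] finite_subset[OF sub(2) finite] by simp_all
      show "\<forall>y\<in>\<beta> `` {x}. \<forall>z\<in>\<beta> `` {x}. y \<noteq> z \<longrightarrow> \<alpha> `` {y} \<inter> \<alpha> `` {z} = {}"
      proof (intro ballI impI)
        fix y z assume yz: "y \<in> \<beta> `` {x}" "z \<in> \<beta> `` {x}" "y \<noteq> z"
        then have "(y, x) \<in> \<beta>" "(x, z) \<in> \<beta>" using B(5) by simp_all
        then have "(y, z) \<in> \<beta>" by (rule B(6))
        then have "(y, z) \<notin> \<alpha>" using disj yz(3) by blast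
        then show "\<alpha> `` {y} \<inter> \<alpha> `` {z} = {}" using A(6)[OF _ A(5)] by auto
      qed
    qed
    also have "\<dots> = (\<Sum>y\<in>\<beta> `` {x}. card (\<alpha> `` {x}))"
      using class_card[OF \<alpha> _ x] sub(2)[of x] by (intro sum.cong refl) blast
    finally show ?thesis by simp
  qed
  ultimately show ?thesis using that by blast
qed

lemma congr_swap:
  assumes r: "congr r" and two: "\<And>x. x \<in> carrier Q \<Longrightarrow> card (r `` {x}) = 2"
  obtains s where "\<And>x. x \<in> carrier Q \<Longrightarrow> r `` {x} = {x, s x}" "\<And>x. x \<in> carrier Q \<Longrightarrow> s x \<noteq> x"
    "\<And>x. x \<in> carrier Q \<Longrightarrow> s x \<in> carrier Q" "\<And>x. x \<in> carrier Q \<Longrightarrow> s (s x) = x"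
    "\<And>g x. g \<in> lmult \<Longrightarrow> x \<in> carrier Q \<Longrightarrow> g (s x) = s (g x)"
proof -
  note R = congrD[OF r]
  have "\<exists>y. r `` {x} = {x, y} \<and> y \<noteq> x" if x: "x \<in> carrier Q" for x
  proof -
    obtain a b where "r `` {x} = {a, b}" "a \<noteq> b" using two[OF x] by (auto simp: card_2_iff)
    moreover have "x \<in> r `` {x}" using R(4)[OF x] by blast
    ultimately show ?thesis by auto
  qed
  then obtain s where s: "\<And>x. x \<in> carrier Q \<Longrightarrow> r `` {x} = {x, s x}" "\<And>x. x \<in> carrier Q \<Longrightarrow> s x \<noteq> x"
    by metis
  have mem: "(x, s x) \<in> r" if "x \<in> carrier Q" for x using s(1)[OF that] by blast
  have sC: "s x \<in> carrier Q" if "x \<in> carrier Q" for x using mem[OF that] R(3) by blast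
  have uniq: "y = s x" if "(x, y) \<in> r" "y \<noteq> x" for x y
    using s(1)[of x] that R(3) by blast
  have "s (s x) = x" if "x \<in> carrier Q" for x
    using uniq[of "s x" x] R(5)[OF mem[OF that]] s(2)[OF that] by metis
  moreover have "g (s x) = s (g x)" if "g \<in> lmult" "x \<in> carrier Q" for g x
  proof (rule uniq)
    show "(g x, g (s x)) \<in> r" using lmult_congr[OF r that(1) mem[OF that(2)]] .
    show "g (s x) \<noteq> g x" using s(2)[OF that(2)] perm_inv(2)[OF that(1)] by metis
  qed
  ultimately show ?thesis using that s sC by blast
qed

section \<open>Connected quandles of size \<open>2 p\<close>\<close>

text \<open>Restates the affine quotient with integer representatives and divisibility by
  \<open>p\<close>, so that later calculations are plain integer arithmetic instead of group
  operations.\<close>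

lemma prime_quotient_coordinate:
  assumes p: "Factorial_Ring.prime p" and r: "congr r" "card (carrier Q // r) = p"
  obtains u and \<pi> :: "'a \<Rightarrow> int" where "1 < u" "u < p"
    "\<And>x. x \<in> carrier Q \<Longrightarrow> 0 \<le> \<pi> x \<and> \<pi> x < int p"
    "\<And>v. 0 \<le> v \<Longrightarrow> v < int p \<Longrightarrow> \<exists>x\<in>carrier Q. \<pi> x = v"
    "\<And>a b. a \<in> carrier Q \<Longrightarrow> b \<in> carrier Q \<Longrightarrow> int p dvd \<pi> (a \<triangleright> b) - (\<pi> a + int u * (\<pi> b - \<pi> a))"
    "\<And>x y. x \<in> carrier Q \<Longrightarrow> y \<in> carrier Q \<Longrightarrow> (x, y) \<in> r \<longleftrightarrow> int p dvd \<pi> x - \<pi> y"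
    "\<And>d. d \<in> dis \<Longrightarrow> \<exists>t. \<forall>x\<in>carrier Q. int p dvd \<pi> (d x) - (t + \<pi> x)"
proof -
  obtain u \<pi> where u: "1 < u" "u < p" and \<pi>: "aff_map (integer_mod_group p) (zmul p u) \<pi>"
    and ker: "\<And>x y. (x, y) \<in> r \<longleftrightarrow> x \<in> carrier Q \<and> y \<in> carrier Q \<and> \<pi> x = \<pi> y"
    using prime_quotient[OF p r] by metis
  have p0: "p > 0" using prime_gt_0_nat[OF p] .
  have im: "\<pi> ` carrier Q = {0..<int p}"
    and op: "\<And>a b. a \<in> carrier Q \<Longrightarrow> b \<in> carrier Q \<Longrightarrow>
      \<pi> (a \<triangleright> b) = \<pi> a \<triangleright>\<^bsub>Aff (integer_mod_group p) (zmul p u)\<^esub> \<pi> b"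
    using \<pi> p0 by (auto simp: aff_map_def carrier_integer_mod_group simp del: Aff_simps)
  have rng: "0 \<le> \<pi> x \<and> \<pi> x < int p" if "x \<in> carrier Q" for x
  proof -
    have "\<pi> x \<in> {0..<int p}" using im that by blast
    then show ?thesis by simp
  qed
  have dvd_mod: "int p dvd m mod int p - m" for m
    unfolding minus_div_mult_eq_mod[symmetric] by simp
  show ?thesis
  proof (rule that[OF u])
    show "\<And>x. x \<in> carrier Q \<Longrightarrow> 0 \<le> \<pi> x \<and> \<pi> x < int p" by (rule rng)
    show "\<exists>x\<in>carrier Q. \<pi> x = v" if "0 \<le> v" "v < int p" for v
    proof -
      have "v \<in> \<pi> ` carrier Q" using im that by simp
      then show ?thesis by blast
    qed
    show "int p dvd \<pi> (a \<triangleright> b) - (\<pi> a + int u * (\<pi> b - \<pi> a))"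
      if "a \<in> carrier Q" "b \<in> carrier Q" for a b
      unfolding op[OF that] using rng that p0
      by (subst Aff_zmul) (auto simp: carrier_integer_mod_group dvd_mod)
    show "(x, y) \<in> r \<longleftrightarrow> int p dvd \<pi> x - \<pi> y" if "x \<in> carrier Q" "y \<in> carrier Q" for x y
    proof -
      have "int p dvd \<pi> x - \<pi> y \<longleftrightarrow> \<pi> x = \<pi> y"
        using rng[OF that(1)] rng[OF that(2)] by (simp add: mod_eq_dvd_iff[symmetric])
      then show ?thesis using ker that by simp
    qed
    show "\<exists>t. \<forall>x\<in>carrier Q. int p dvd \<pi> (d x) - (t + \<pi> x)" if d: "d \<in> dis" for d
    proof -
      obtain t where t: "\<forall>x\<in>carrier Q. \<pi> (d x) = t \<otimes>\<^bsub>integer_mod_group p\<^esub> \<pi> x"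
        using aff_map_translation[OF \<pi> d] by blast
      then have "\<forall>x\<in>carrier Q. int p dvd \<pi> (d x) - (t + \<pi> x)" by (simp add: dvd_mod)
      then show ?thesis by blast
    qed
  qed
qed

text \<open>A displacement acting trivially on the classes could a priori exchange the two points in
  some classes only; \<open>fixed\<close> and \<open>unif\<close> exclude this. A lift
  \<open>h\<close> of a translation then obeys the conjugation relation up to the global exchange
  \<open>s\<close>, and its square obeys it exactly. The orbit of \<open>a\<close> under
  \<open>h ^^ 2\<close> meets each class once and is closed, contradicting connectedness.\<close>

lemma no_connected_cover_of_degree_2:
  assumes p: "Factorial_Ring.prime p" "p \<ge> 5" and r: "congr r" "card (carrier Q // r) = p"
    and card: "card (carrier Q) = 2 * p"
  shows False
proof -
  note R = congrD[OF r(1)]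
  obtain u and \<pi> :: "'a \<Rightarrow> int" where u: "1 < u" "u < p"
    and rng: "\<And>x. x \<in> carrier Q \<Longrightarrow> 0 \<le> \<pi> x \<and> \<pi> x < int p"
    and onto: "\<And>v. 0 \<le> v \<Longrightarrow> v < int p \<Longrightarrow> \<exists>x\<in>carrier Q. \<pi> x = v"
    and op: "\<And>a b. a \<in> carrier Q \<Longrightarrow> b \<in> carrier Q \<Longrightarrow>
      int p dvd \<pi> (a \<triangleright> b) - (\<pi> a + int u * (\<pi> b - \<pi> a))"
    and ker: "\<And>x y. x \<in> carrier Q \<Longrightarrow> y \<in> carrier Q \<Longrightarrow> (x, y) \<in> r \<longleftrightarrow> int p dvd \<pi> x - \<pi> y"
    and transl: "\<And>d. d \<in> dis \<Longrightarrow> \<exists>t. \<forall>x\<in>carrier Q. int p dvd \<pi> (d x) - (t + \<pi> x)"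
  proof (rule prime_quotient_coordinate[OF p(1) r], goal_cases)
    case (1 u \<pi>)
    from 1(2-8) show ?case by (rule 1(1))
  qed
  have pp: "Factorial_Ring.prime (int p)" using p(1) by simp
  have two: "card (r `` {x}) = 2" if "x \<in> carrier Q" for x
    using card_quotient[OF r(1) that] r(2) card p(2) by simp
  obtain s where s: "\<And>x. x \<in> carrier Q \<Longrightarrow> r `` {x} = {x, s x}" "\<And>x. x \<in> carrier Q \<Longrightarrow> s x \<noteq> x"
    "\<And>x. x \<in> carrier Q \<Longrightarrow> s x \<in> carrier Q" "\<And>x. x \<in> carrier Q \<Longrightarrow> s (s x) = x"
    "\<And>g x. g \<in> lmult \<Longrightarrow> x \<in> carrier Q \<Longrightarrow> g (s x) = s (g x)"
    using congr_swap[OF r(1) two] by blast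
  have r_iff: "(x, y) \<in> r \<longleftrightarrow> y = x \<or> y = s x" if "x \<in> carrier Q" for x y
    using s(1)[OF that] by (auto simp: set_eq_iff)
  have dl: "d \<in> lmult" if "d \<in> dis" for d using that dis_lmult by blast
  have L_inv: "finv (L b) z \<in> carrier Q" "b \<triangleright> finv (L b) z = z" if "b \<in> carrier Q" "z \<in> carrier Q" for b z
  proof -
    show "finv (L b) z \<in> carrier Q"
      using permutes_in_image[OF permutes_inv[OF L_permutes[OF that(1)]]] that(2) by simp
    then show "b \<triangleright> finv (L b) z = z"
      using perm_inv(1)[OF L_lmult[OF that(1)], of z] by (simp add: L_apply)
  qed
  have neq: "(x, y) \<notin> r" if "x \<in> carrier Q" "y \<in> carrier Q" "\<pi> x \<noteq> \<pi> y" for x y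
    using rng[OF that(1)] rng[OF that(2)] that(3) ker[OF that(1,2)]
    by (simp add: mod_eq_dvd_iff[symmetric])

  have fixed: "n z = z" if n: "n \<in> lmult" and x: "x \<in> carrier Q" "n x = x"
    and y: "y \<in> carrier Q" "n y = y" and xy: "(x, y) \<notin> r" and z: "z \<in> carrier Q" for n x y z
  proof -
    \<comment> \<open>\<open>n\<close> fixes \<open>x\<close> and \<open>y\<close>, hence commutes
      with \<open>L x\<close>, \<open>L y\<close> and \<open>d\<close>. As \<open>d\<close> induces
      a nonzero translation, its powers carry the fixed point \<open>x\<close> into every class;
      commuting with \<open>s\<close>, \<open>n\<close> also fixes the other point there.\<close>
    define d where "d = L x \<circ> finv (L y)"
    have d: "d \<in> dis" unfolding d_def using dis_gen x(1) y(1) .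
    obtain t where t: "\<And>w. w \<in> carrier Q \<Longrightarrow> int p dvd \<pi> (d w) - (t + \<pi> w)"
      using transl[OF d] by blast
    have d_eq: "d (y \<triangleright> w) = x \<triangleright> w" if "w \<in> carrier Q" for w
      using perm_inv(2)[OF L_lmult[OF y(1)], of w] that by (simp add: d_def L_apply)
    have "\<not> int p dvd t"
    proof
      assume t0: "int p dvd t"
      have "d y = x \<triangleright> y" using d_eq[OF y(1)] idem[OF y(1)] by simp
      then have 1: "int p dvd \<pi> (x \<triangleright> y) - (t + \<pi> y)" using t[OF y(1)] by simp
      have "(1 - int u) * (\<pi> x - \<pi> y) = (\<pi> (x \<triangleright> y) - (t + \<pi> y)) + t
          - (\<pi> (x \<triangleright> y) - (\<pi> x + int u * (\<pi> y - \<pi> x)))"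
        by (simp add: algebra_simps)
      then have "int p dvd (1 - int u) * (\<pi> x - \<pi> y)"
        using dvd_diff[OF dvd_add[OF 1 t0] op[OF x(1) y(1)]] by simp
      then have "int p dvd 1 - int u \<or> int p dvd \<pi> x - \<pi> y" using pp prime_dvd_multD by blast
      moreover have "\<not> int p dvd int u - 1" using u by (intro zdvd_not_zless) auto
      then have "\<not> int p dvd 1 - int u" by (simp add: dvd_diff_commute)
      ultimately show False using xy ker x(1) y(1) by simp
    qed
    then obtain i where i: "int p dvd \<pi> x + int i * t - \<pi> z"
      using prime_translation_covers[OF p(1)] by blast
    have comm: "n (d w) = d (n w)" if w: "w \<in> carrier Q" for w
    proof -
      obtain v where v: "v \<in> carrier Q" "y \<triangleright> v = w" using L_inv[OF y(1) w] by blast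
      have nv: "n v \<in> carrier Q" using lmult_closed[OF n v(1)] .
      have "n (d w) = x \<triangleright> n v" using d_eq[OF v(1)] lmult_hom[OF n x(1) v(1)] v(2) x(2) by simp
      moreover have "d (n w) = x \<triangleright> n v" using d_eq[OF nv] lmult_hom[OF n y(1) v(1)] v(2) y(2) by simp
      ultimately show ?thesis by simp
    qed
    have "n ((d ^^ j) x) = (d ^^ j) x \<and> (d ^^ j) x \<in> carrier Q
        \<and> int p dvd \<pi> ((d ^^ j) x) - (\<pi> x + int j * t)" for j
    proof (induction j)
      case 0
      then show ?case using x by simp
    next
      case (Suc j)
      let ?w = "(d ^^ j) x"
      have "\<pi> (d ?w) - (\<pi> x + int (Suc j) * t)
          = (\<pi> (d ?w) - (t + \<pi> ?w)) + (\<pi> ?w - (\<pi> x + int j * t))"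
        by (simp add: algebra_simps)
      then have "int p dvd \<pi> (d ?w) - (\<pi> x + int (Suc j) * t)"
        using Suc t[of ?w] dvd_add by metis
      then show ?case using Suc comm[of ?w] lmult_closed[OF dl[OF d], of ?w] by simp
    qed
    from this[of i] have w: "n ((d ^^ i) x) = (d ^^ i) x" "(d ^^ i) x \<in> carrier Q"
      and 1: "int p dvd \<pi> ((d ^^ i) x) - (\<pi> x + int i * t)" by simp_all
    have "int p dvd \<pi> ((d ^^ i) x) - \<pi> z" using dvd_add[OF 1 i] by (simp add: algebra_simps)
    then have "z = (d ^^ i) x \<or> z = s ((d ^^ i) x)" using ker[OF w(2) z] r_iff[OF w(2)] by simp
    then show "n z = z" using w s(5)[OF n w(2)] by auto
  qed

  have unif: "(\<forall>z\<in>carrier Q. n z = z) \<or> (\<forall>z\<in>carrier Q. n z = s z)"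
    if n: "n \<in> dis" and nr: "\<And>z. z \<in> carrier Q \<Longrightarrow> (n z, z) \<in> r" for n
  proof (rule ccontr)
    assume neg: "\<not> ?thesis"
    have alt: "n z = z \<or> n z = s z" if "z \<in> carrier Q" for z
      using R(5)[OF nr[OF that]] r_iff[OF that] by simp
    obtain x where x: "x \<in> carrier Q" "n x = x" using neg alt by blast
    obtain y where y: "y \<in> carrier Q" "n y \<noteq> y" using neg by blast
    have nx: "n z = s z" if z: "z \<in> carrier Q" "(x, z) \<notin> r" for z
      using fixed[OF dl[OF n] x z(1) _ z(2) y(1)] alt[OF z(1)] y(2) by auto
    have xy: "(x, y) \<notin> r" using r_iff[OF x(1)] s(5)[OF dl[OF n] x(1)] x(2) y(2) by auto
    then have yx: "(y, x) \<notin> r" using R(5) by blast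
    obtain d where d: "d \<in> dis" "d x = y" using dis_transitive[OF x(1) y(1)] by blast
    \<comment> \<open>By \<open>fixed\<close>, \<open>n\<close> exchanges the points in every class
      but that of \<open>x\<close>. Its conjugate \<open>m\<close> does so in every class but that
      of \<open>y\<close>, so \<open>n \<circ> m\<close> is the identity on all further
      classes.\<close>
    define m where "m = d \<circ> n \<circ> finv d"
    have m: "m \<in> dis" unfolding m_def using dis_normal[OF dl[OF d(1)] n] .
    have my: "m z = s z" if z: "z \<in> carrier Q" "(y, z) \<notin> r" for z
    proof -
      let ?w = "finv d z"
      have w: "?w \<in> carrier Q" using lmult_closed[OF dl[OF disD(4)[OF d(1)]] z(1)] .
      have dw: "d ?w = z" using perm_inv(1)[OF dl[OF d(1)]] .
      have "(x, ?w) \<notin> r" using lmult_congr[OF r(1) dl[OF d(1)], of x ?w] z(2) dw d(2) by auto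
      then have "m z = d (s ?w)" using nx[OF w] by (simp add: m_def)
      then show ?thesis using s(5)[OF dl[OF d(1)] w] dw by simp
    qed
    \<comment> \<open>Two further classes are needed to apply \<open>fixed\<close> to
      \<open>n \<circ> m\<close>. Four coordinates are available because \<open>p \<ge> 5\<close>,
      and at most two are taken. But \<open>n \<circ> m\<close> moves \<open>x\<close>.\<close>
    define T where "T = {0..<4} - {\<pi> x, \<pi> y}"
    have "card {\<pi> x, \<pi> y} \<le> 2" by (simp add: card_insert_if)
    moreover have "card {0..<4::int} - card {\<pi> x, \<pi> y} \<le> card T"
      unfolding T_def by (intro diff_card_le_card_Diff) simp
    ultimately have "\<not> card T \<le> Suc 0" by simp
    moreover have "finite T" by (simp add: T_def)
    ultimately obtain v1 v2 where "v1 \<in> T" "v2 \<in> T" and v12: "v1 \<noteq> v2"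
      using card_le_Suc0_iff_eq by blast
    then have v: "0 \<le> v1" "v1 < 4" "v1 \<noteq> \<pi> x" "v1 \<noteq> \<pi> y" "0 \<le> v2" "v2 < 4" "v2 \<noteq> \<pi> x" "v2 \<noteq> \<pi> y"
      by (simp_all add: T_def)
    obtain z where z: "z \<in> carrier Q" "\<pi> z = v1" using onto[of v1] v p(2) by auto
    obtain w where w: "w \<in> carrier Q" "\<pi> w = v2" using onto[of v2] v p(2) by auto
    have nm: "n (m a) = a" if a: "a \<in> carrier Q" "(x, a) \<notin> r" "(y, a) \<notin> r" for a
      using my[OF a(1,3)] s(5)[OF dl[OF n] a(1)] nx[OF a(1,2)] s(4)[OF a(1)] by simp
    have "(x, z) \<notin> r" "(y, z) \<notin> r" "(x, w) \<notin> r" "(y, w) \<notin> r" "(z, w) \<notin> r"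
      using x(1) y(1) z w v v12 by (auto simp: neq)
    then have "(n \<circ> m) x = x"
      using fixed[OF dl[OF disD(3)[OF n m]] z(1) _ w(1) _ _ x(1)] nm z(1) w(1) by simp
    moreover have "(n \<circ> m) x = s x" using my[OF x(1) yx] s(5)[OF dl[OF n] x(1)] x(2) by simp
    ultimately show False using s(2)[OF x(1)] by simp
  qed

  obtain a where a: "a \<in> carrier Q" "\<pi> a = 0" using onto[of 0] p(2) by auto
  obtain b0 where b0: "b0 \<in> carrier Q" "\<pi> b0 = 1" using onto[of 1] p(2) by auto
  obtain h where h: "h \<in> dis" "h a = b0" using dis_transitive[OF a(1) b0(1)] by blast
  obtain t where t: "\<And>w. w \<in> carrier Q \<Longrightarrow> int p dvd \<pi> (h w) - (t + \<pi> w)"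
    using transl[OF h(1)] by blast
  have "\<not> int p dvd t"
  proof
    assume "int p dvd t"
    moreover have "int p dvd 1 - t" using t[OF a(1)] h(2) a(2) b0(2) by simp
    ultimately have "int p dvd 1" using dvd_add[of "int p" "1 - t" t] by simp
    then show False using p(2) by simp
  qed
  \<comment> \<open>The square of \<open>h\<close> must still induce a nonzero translation.\<close>
  moreover have "\<not> int p dvd 2" using p(2) by (intro zdvd_not_zless) auto
  ultimately have t2: "\<not> int p dvd 2 * t" using pp prime_dvd_multD by blast
  have hi: "h ^^ i \<in> dis" for i using disD(5)[OF h(1)] .
  have hc: "(h ^^ i) z \<in> carrier Q" if "z \<in> carrier Q" for i z using lmult_closed[OF dl[OF hi] that] .
  have hpow: "int p dvd \<pi> ((h ^^ i) z) - (int i * t + \<pi> z)" if z: "z \<in> carrier Q" for i z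
  proof (induction i)
    case (Suc i)
    let ?w = "(h ^^ i) z"
    have "\<pi> (h ?w) - (int (Suc i) * t + \<pi> z)
        = (\<pi> (h ?w) - (t + \<pi> ?w)) + (\<pi> ?w - (int i * t + \<pi> z))"
      by (simp add: algebra_simps)
    then have "int p dvd \<pi> (h ?w) - (int (Suc i) * t + \<pi> z)"
      using Suc t[OF hc[OF z]] dvd_add by metis
    then show ?case by simp
  qed simp
  have "(\<forall>z\<in>carrier Q. (h ^^ p) z = z) \<or> (\<forall>z\<in>carrier Q. (h ^^ p) z = s z)"
  proof (rule unif[OF hi])
    fix z assume z: "z \<in> carrier Q"
    have "int p dvd (\<pi> ((h ^^ p) z) - (int p * t + \<pi> z)) + int p * t"
      using hpow[OF z, of p] by (intro dvd_add) auto
    then show "((h ^^ p) z, z) \<in> r" using ker[OF hc[OF z] z] by (simp add: algebra_simps)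
  qed
  \<comment> \<open>\<open>h ^^ p\<close> acts trivially on the classes, so it is the identity or
    \<open>s\<close>, and applying it twice gives the identity.\<close>
  then have hpp: "(h ^^ p) ((h ^^ p) z) = z" if "z \<in> carrier Q" for z using that s(3,4) by auto
  have per: "(h ^^ (2 * p * k)) z = z" if "z \<in> carrier Q" for k z
  proof (induction k)
    case (Suc k)
    have "2 * p * Suc k = (p + p) + 2 * p * k" by simp
    then have "(h ^^ (2 * p * Suc k)) z = (h ^^ p) ((h ^^ p) ((h ^^ (2 * p * k)) z))"
      by (simp only: funpow_add o_apply)
    then show ?case using Suc hpp[OF that] by simp
  qed simp
  have conj2: "b \<triangleright> h (h z) = (h ^^ (2 * u)) (b \<triangleright> z)" if b: "b \<in> carrier Q" and z: "z \<in> carrier Q" for b z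
  proof -
    \<comment> \<open>The defect in the conjugation relation. It acts trivially on classes, so it is
      the identity or \<open>s\<close>; applying the relation twice cancels
      \<open>s\<close>.\<close>
    define n where "n = (L b \<circ> h \<circ> finv (L b)) \<circ> finv (h ^^ u)"
    have n: "n \<in> dis" unfolding n_def by (intro disD(3,4) dis_normal L_lmult b h(1) hi)
    have n_eq: "n ((h ^^ u) (b \<triangleright> y)) = b \<triangleright> h y" if y: "y \<in> carrier Q" for y
      using perm_inv(2)[OF L_lmult[OF b], of y] perm_inv(2)[OF dl[OF hi], of u "b \<triangleright> y"] y
        lmult_closed[OF dl[OF h(1)] y] by (simp add: n_def L_apply)
    have "(\<forall>z\<in>carrier Q. n z = z) \<or> (\<forall>z\<in>carrier Q. n z = s z)"
    proof (rule unif[OF n])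
      fix w assume w: "w \<in> carrier Q"
      define v where "v = finv (h ^^ u) w"
      have v: "v \<in> carrier Q" "(h ^^ u) v = w"
        unfolding v_def using lmult_closed[OF dl[OF disD(4)[OF hi]] w] perm_inv(1)[OF dl[OF hi]] by auto
      obtain y where y: "y \<in> carrier Q" "b \<triangleright> y = v" using L_inv[OF b v(1)] by blast
      have hy: "h y \<in> carrier Q" using lmult_closed[OF dl[OF h(1)] y(1)] .
      have nw: "n w = b \<triangleright> h y" using n_eq[OF y(1)] y(2) v(2) by simp
      have "\<pi> (n w) - \<pi> w = (\<pi> (n w) - (\<pi> b + int u * (\<pi> (h y) - \<pi> b))) + int u * (\<pi> (h y) - (t + \<pi> y))
          - ((\<pi> v - (\<pi> b + int u * (\<pi> y - \<pi> b))) + (\<pi> w - (int u * t + \<pi> v)))"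
        (is "_ = ?e")
        by (simp add: algebra_simps)
      moreover have "int p dvd ?e"
        using dvd_diff[OF dvd_add[OF op[OF b hy] dvd_mult[OF t[OF y(1)], of "int u"]]
            dvd_add[OF op[OF b y(1)] hpow[OF v(1), of u]]]
        by (simp only: nw v(2) y(2))
      ultimately have "int p dvd \<pi> (n w) - \<pi> w" by (simp only:)
      then show "(n w, w) \<in> r" using ker[OF lmult_closed[OF dl[OF n] w] w] by simp
    qed
    moreover have bz: "b \<triangleright> z \<in> carrier Q" and hz: "h z \<in> carrier Q"
      using qop_closed[OF b z] lmult_closed[OF dl[OF h(1)] z] by auto
    moreover have "(h ^^ (2 * u)) (b \<triangleright> z) = (h ^^ u) ((h ^^ u) (b \<triangleright> z))"
      by (simp only: mult_2 funpow_add o_apply)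
    ultimately show ?thesis
    proof (elim disjE)
      assume *: "\<forall>z\<in>carrier Q. n z = z"
      have "b \<triangleright> h y = (h ^^ u) (b \<triangleright> y)" if "y \<in> carrier Q" for y
        using n_eq[OF that] * hc[OF qop_closed[OF b that]] by simp
      then show ?thesis using z hz \<open>(h ^^ (2 * u)) (b \<triangleright> z) = _\<close> by simp
    next
      assume *: "\<forall>z\<in>carrier Q. n z = s z"
      have 1: "b \<triangleright> h y = s ((h ^^ u) (b \<triangleright> y))" if "y \<in> carrier Q" for y
        using n_eq[OF that] * hc[OF qop_closed[OF b that]] by simp
      have "b \<triangleright> h (h z) = s ((h ^^ u) (s ((h ^^ u) (b \<triangleright> z))))" using 1[OF hz] 1[OF z] by simp
      also have "\<dots> = s (s ((h ^^ u) ((h ^^ u) (b \<triangleright> z))))"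
        using s(5)[OF dl[OF hi] hc[OF bz]] by simp
      also have "\<dots> = (h ^^ u) ((h ^^ u) (b \<triangleright> z))" using s(4) hc bz by simp
      finally show ?thesis using \<open>(h ^^ (2 * u)) (b \<triangleright> z) = _\<close> by simp
    qed
  qed
  have conj: "b \<triangleright> (h ^^ (2 * i)) z = (h ^^ (2 * u * i)) (b \<triangleright> z)"
    if b: "b \<in> carrier Q" and z: "z \<in> carrier Q" for b z i
  proof (induction i)
    case (Suc i)
    have "2 * Suc i = Suc (Suc (2 * i))" by simp
    then have "b \<triangleright> (h ^^ (2 * Suc i)) z = b \<triangleright> h (h ((h ^^ (2 * i)) z))"
      by (simp only: funpow.simps o_apply)
    also have "\<dots> = (h ^^ (2 * u)) ((h ^^ (2 * u * i)) (b \<triangleright> z))"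
      using conj2[OF b hc[OF z]] Suc by simp
    also have "\<dots> = (h ^^ (2 * u * Suc i)) (b \<triangleright> z)"
      by (simp only: mult_Suc_right funpow_add o_apply)
    finally show ?case .
  qed simp
  let ?S = "{(h ^^ (2 * i)) a | i. True}"
  have "?S = carrier Q"
  proof (rule eq_carrierI[of _ a])
    show "?S \<subseteq> carrier Q" using hc[OF a(1)] by auto
    show "a \<in> ?S" by (auto intro: exI[of _ 0])
    fix b y assume b: "b \<in> carrier Q" and "y \<in> ?S"
    then obtain j where y: "y = (h ^^ (2 * j)) a" by blast
    obtain i where i: "int p dvd \<pi> a + int i * (2 * t) - \<pi> b"
      using prime_translation_covers[OF p(1) t2] by blast
    define c where "c = (h ^^ (2 * i)) a"
    have c: "c \<in> carrier Q" using hc[OF a(1)] by (simp add: c_def)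
    have "int p dvd (\<pi> c - (int (2 * i) * t + \<pi> a)) + (\<pi> a + int i * (2 * t) - \<pi> b)"
      using hpow[OF a(1), of "2 * i"] i by (intro dvd_add) (simp_all add: c_def)
    then have "(c, b) \<in> r" using ker[OF c b] by (simp add: algebra_simps)
    then have "b = c \<or> b = s c" using r_iff[OF c] by simp
    \<comment> \<open>\<open>L b\<close> fixes \<open>b\<close> and commutes with \<open>s\<close>,
      so it fixes both points of its class, in particular the orbit point \<open>c\<close> there.
      The orbit can thus be rewritten with \<open>c\<close> as base point.\<close>
    then have bc: "b \<triangleright> c = c"
    proof
      assume "b = s c"
      then have "c = s b" using s(4)[OF c] by simp
      then show ?thesis using s(5)[OF L_lmult[OF b] b] idem[OF b] b c by (simp add: L_apply)
    qed (use idem[OF c] in simp)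
    \<comment> \<open>\<open>i * (p - 1)\<close> stands for \<open>- i\<close>, as
      \<open>h ^^ (2 * p)\<close> is the identity on the carrier.\<close>
    have "2 * (i * (p - 1)) + 2 * i = 2 * p * i"
      using p(2) by (cases p) (simp_all add: algebra_simps)
    moreover have "(h ^^ (2 * (i * (p - 1)))) c = (h ^^ (2 * (i * (p - 1)) + 2 * i)) a"
      by (simp only: c_def funpow_add o_apply)
    ultimately have "(h ^^ (2 * (i * (p - 1)))) c = a" using per[OF a(1), of i] by (simp only:)
    then have "y = (h ^^ (2 * (j + i * (p - 1)))) c"
      by (simp only: y distrib_left funpow_add o_apply)
    then have "b \<triangleright> y = (h ^^ (2 * u * (j + i * (p - 1)))) c"
      by (simp only: conj[OF b c] bc)
    also have "\<dots> = (h ^^ (2 * u * (j + i * (p - 1)))) ((h ^^ (2 * i)) a)" by (simp only: c_def)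
    also have "\<dots> = (h ^^ (2 * (u * (j + i * (p - 1)) + i))) a"
      by (simp only: distrib_left mult.assoc funpow_add o_apply)
    finally show "b \<triangleright> y \<in> ?S" by blast
  qed
  \<comment> \<open>The other point \<open>s a\<close> would have to lie in the orbit as well, but
    staying in the class forces \<open>p\<close> to divide \<open>i\<close>, and then the power of
    \<open>h\<close> returns to \<open>a\<close>.\<close>
  then obtain i where i: "s a = (h ^^ (2 * i)) a" using s(3)[OF a(1)] by blast
  have "int p dvd \<pi> a - \<pi> (s a)" using ker[OF a(1) s(3)[OF a(1)]] r_iff[OF a(1)] by simp
  moreover have "int p dvd \<pi> (s a) - (int (2 * i) * t + \<pi> a)" using hpow[OF a(1), of "2 * i"] i by simp
  ultimately have "int p dvd (\<pi> a - \<pi> (s a)) + (\<pi> (s a) - (int (2 * i) * t + \<pi> a))" by (rule dvd_add)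
  moreover have "\<dots> = - (int i * (2 * t))" by simp
  ultimately have "int p dvd int i * (2 * t)" by (simp only: dvd_minus_iff)
  then have "int p dvd int i" using pp t2 prime_dvd_multD by blast
  then obtain k where "i = p * k" by auto
  then have "s a = a" using i per[OF a(1), of k] by (simp add: mult.assoc)
  then show False using s(2)[OF a(1)] by simp
qed

end

section \<open>Connected quandles of size \<open>4 p\<close>\<close>

lemma quandle_prod_simps [simp]:
  "carrier (quandle_prod Q R) = carrier Q \<times> carrier R"
  "x \<triangleright>\<^bsub>quandle_prod Q R\<^esub> y = (fst x \<triangleright>\<^bsub>Q\<^esub> fst y, snd x \<triangleright>\<^bsub>R\<^esub> snd y)"
  by (simp_all add: quandle_prod_def case_prod_beta)

lemma divisors_4_prime:
  assumes p: "Factorial_Ring.prime (p :: nat)" and k: "k dvd 4 * p"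
  shows "k \<in> {1, 2, 4, p, 2 * p, 4 * p}"
proof -
  have four: "m \<in> {1, 2, 4}" if "m dvd 4" for m :: nat
  proof -
    have "m \<le> 4" "m \<noteq> 0" "m \<noteq> 3" using that dvd_imp_le[OF that] by (auto intro: Nat.gr0I)
    then show ?thesis by auto
  qed
  show ?thesis
  proof (cases "p dvd k")
    case True
    then obtain m where m: "k = p * m" by blast
    then have "m dvd 4" using k prime_gt_0_nat[OF p] by (simp add: mult.commute)
    then show ?thesis using four[of m] m by auto
  next
    case False
    then have "coprime k p" using prime_imp_coprime[OF p] by (simp add: coprime_commute)
    then have "k dvd 4" using k by (simp add: coprime_dvd_mult_left_iff)
    then show ?thesis using four[of k] by auto
  qed
qed

context finite_connected_quandle
begin

lemma congr_Int: "congr \<alpha> \<Longrightarrow> congr \<beta> \<Longrightarrow> congr (\<alpha> \<inter> \<beta>)"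
proof -
  assume \<alpha>: "congr \<alpha>" and \<beta>: "congr \<beta>"
  note A = congrD[OF \<alpha>] and B = congrD[OF \<beta>]
  show ?thesis
    unfolding congr_def
  proof (intro conjI allI impI equivI refl_onI symI transI)
    show "\<alpha> \<inter> \<beta> \<subseteq> carrier Q \<times> carrier Q" using A(3) by auto
  next
    fix x y z assume "(x, y) \<in> \<alpha> \<inter> \<beta>" "(y, z) \<in> \<alpha> \<inter> \<beta>"
    then show "(x, z) \<in> \<alpha> \<inter> \<beta>" using A(6)[of x y z] B(6)[of x y z] by simp
  next
    fix x y assume "(x, y) \<in> \<alpha> \<inter> \<beta>"
    then show "(y, x) \<in> \<alpha> \<inter> \<beta>" using A(5)[of x y] B(5)[of x y] by simp
  qed (use A(2,4) B(2,4) in auto)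
qed

lemma congr_full: "congr (carrier Q \<times> carrier Q)"
  by (auto simp: congr_def qop_closed intro!: equivI refl_onI symI transI)

text \<open>If no two nontrivial congruences met trivially, the nontrivial ones would form a finite
  nonempty family closed under intersection, which contains its own intersection. That is subdirect
  irreducibility.\<close>

lemma subdirectly_reducible_congruences:
  assumes red: "subdirectly_reducible Q" and gt1: "card (carrier Q) > 1"
  obtains \<alpha> \<beta> where "congr \<alpha>" "congr \<beta>" "\<alpha> \<noteq> Id_on (carrier Q)" "\<beta> \<noteq> Id_on (carrier Q)"
    "\<And>x y. (x, y) \<in> \<alpha> \<Longrightarrow> (x, y) \<in> \<beta> \<Longrightarrow> x = y"
proof -
  let ?K = "{r. congr r \<and> r \<noteq> Id_on (carrier Q)}"
  have "\<exists>\<alpha>\<in>?K. \<exists>\<beta>\<in>?K. \<alpha> \<inter> \<beta> = Id_on (carrier Q)"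
  proof (rule ccontr)
    assume "\<not> ?thesis"
    then have Int: "\<alpha> \<inter> \<beta> \<in> ?K" if "\<alpha> \<in> ?K" "\<beta> \<in> ?K" for \<alpha> \<beta>
      using that congr_Int by blast
    have "?K \<subseteq> Pow (carrier Q \<times> carrier Q)" using congrD(3) by auto
    then have finK: "finite ?K" using finite_subset finite by blast
    obtain x y where "x \<in> carrier Q" "y \<in> carrier Q" "x \<noteq> y"
      using gt1 finite by (metis One_nat_def card_le_Suc0_iff_eq linorder_not_le)
    then have "(x, y) \<in> carrier Q \<times> carrier Q" "(x, y) \<notin> Id_on (carrier Q)" by auto
    \<comment> \<open>More than one point makes the full relation nontrivial, so the family is not
      empty.\<close>
    then have full: "carrier Q \<times> carrier Q \<in> ?K" using congr_full by blast
    have "F \<noteq> {} \<Longrightarrow> F \<subseteq> ?K \<Longrightarrow> \<Inter>F \<in> ?K" if "finite F" for F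
      using that
    proof (induction F rule: finite_induct)
      case (insert r F)
      then show ?case using Int[of r "\<Inter>F"] by (cases "F = {}") auto
    qed simp
    from this[OF finK] full have "\<Inter>?K \<in> ?K" by blast
    then have "\<Inter>?K \<noteq> Id_on (carrier Q)" by blast
    moreover have "(carrier Q \<times> carrier Q) \<inter> \<Inter>?K = \<Inter>?K"
      using Inter_lower[OF full] by (rule Int_absorb1)
    moreover have "(carrier Q \<times> carrier Q) \<inter> \<Inter>?K = Id_on (carrier Q)"
      using red by (simp only: subdirectly_irreducible_def congr_iff[OF finite] not_not)
    ultimately show False by simp
  qed
  then obtain \<alpha> \<beta> where \<alpha>: "\<alpha> \<in> ?K" and \<beta>: "\<beta> \<in> ?K" and Id: "\<alpha> \<inter> \<beta> = Id_on (carrier Q)"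
    by (elim bexE)
  show ?thesis
  proof (rule that[of \<alpha> \<beta>])
    fix x y assume "(x, y) \<in> \<alpha>" "(x, y) \<in> \<beta>"
    then have "(x, y) \<in> Id_on (carrier Q)" unfolding Id[symmetric] by (rule IntI)
    then show "x = y" by (simp add: Id_on_iff)
  qed (use \<alpha> \<beta> in simp_all)
qed

lemma card_class_gt_1:
  assumes r: "congr r" "r \<noteq> Id_on (carrier Q)" and x: "x \<in> carrier Q"
  shows "card (r `` {x}) > 1"
proof -
  have "\<exists>a b. (a, b) \<in> r \<and> a \<noteq> b"
  proof (rule ccontr)
    assume "\<not> ?thesis"
    then have "r = Id_on (carrier Q)" using congrD(3,4)[OF r(1)] by (auto simp: Id_on_iff)
    then show False using r(2) by simp
  qed
  then obtain a b where ab: "(a, b) \<in> r" "a \<noteq> b" by blast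
  have a: "a \<in> carrier Q" and sub: "r `` {a} \<subseteq> carrier Q" using congrD(3)[OF r(1)] ab by auto
  have "card {a, b} \<le> card (r `` {a})"
    using ab congrD(4)[OF r(1) a] finite_subset[OF sub finite] by (intro card_mono) auto
  then show ?thesis using ab(2) class_card[OF r(1) a x] by simp
qed

lemma class_card_full:
  assumes r: "congr r" and x: "x \<in> carrier Q" "card (r `` {x}) = card (carrier Q)"
    and y: "y \<in> carrier Q" and z: "z \<in> carrier Q"
  shows "(y, z) \<in> r"
proof -
  have "r `` {y} \<subseteq> carrier Q" using congrD(3)[OF r] by auto
  then have "r `` {y} = carrier Q"
    using card_subset_eq[OF finite] class_card[OF r x(1) y] x(2) by simp
  then show ?thesis using z by blast
qed

lemma quotient_card_ne_2: "congr r \<Longrightarrow> card (carrier Q // r) \<noteq> 2"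
  using finite_connected_quandle.card_ne_2[OF quot_connected] by (simp add: quot_def)

text \<open>The join \<gamma> is studied through its image \<delta> on the quotient by \<alpha>, of
  size \<open>2 * p\<close>, where the degree 2 result applies. All class numbers other than 1 are
  impossible; if the join is full, any point is reached from \<open>a\<close> by exchanges commuting
  with \<open>L a\<close>, and \<open>L a\<close> fixes \<open>a\<close>.\<close>

lemma no_disjoint_swaps:
  assumes p: "Factorial_Ring.prime p" "p \<ge> 5" and card: "card (carrier Q) = 4 * p"
    and \<alpha>: "congr \<alpha>" "\<And>x. x \<in> carrier Q \<Longrightarrow> card (\<alpha> `` {x}) = 2"
    and \<beta>: "congr \<beta>" "\<And>x. x \<in> carrier Q \<Longrightarrow> card (\<beta> `` {x}) = 2"
    and disj: "\<And>x y. (x, y) \<in> \<alpha> \<Longrightarrow> (x, y) \<in> \<beta> \<Longrightarrow> x = y"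
  shows False
proof -
  note A = congrD[OF \<alpha>(1)] and B = congrD[OF \<beta>(1)]
  have gt1: "card (carrier Q) > 1" using card p(2) by simp
  then obtain x where x: "x \<in> carrier Q" by fastforce
  obtain s where s: "\<And>x. x \<in> carrier Q \<Longrightarrow> \<alpha> `` {x} = {x, s x}"
    "\<And>g x. g \<in> lmult \<Longrightarrow> x \<in> carrier Q \<Longrightarrow> g (s x) = s (g x)"
    using congr_swap[OF \<alpha>] by metis
  obtain t where t: "\<And>x. x \<in> carrier Q \<Longrightarrow> \<beta> `` {x} = {x, t x}" "\<And>x. x \<in> carrier Q \<Longrightarrow> t x \<noteq> x"
    "\<And>g x. g \<in> lmult \<Longrightarrow> x \<in> carrier Q \<Longrightarrow> g (t x) = t (g x)"
    using congr_swap[OF \<beta>] by metis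
  define \<gamma> where "\<gamma> = (\<alpha> \<union> \<beta>)\<^sup>+"
  have sub: "\<alpha> \<union> \<beta> \<subseteq> carrier Q \<times> carrier Q" using A(3) B(3) by auto
  have sym: "sym (\<alpha> \<union> \<beta>)" using A(5) B(5) by (auto intro!: symI)
  have \<gamma>C: "x \<in> carrier Q \<and> y \<in> carrier Q" if "(x, y) \<in> \<gamma>" for x y
    using trancl_subset_Sigma[OF sub] that by (auto simp: \<gamma>_def)
  have \<gamma>I: "(x, y) \<in> \<gamma>" if "(x, y) \<in> \<alpha> \<or> (x, y) \<in> \<beta>" for x y
    using that by (auto simp: \<gamma>_def)
  have \<gamma>_trans: "(x, z) \<in> \<gamma>" if "(x, y) \<in> \<gamma>" "(y, z) \<in> \<gamma>" for x y z
    using that unfolding \<gamma>_def by (rule trancl_trans)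
  have \<gamma>_sym: "(y, x) \<in> \<gamma>" if "(x, y) \<in> \<gamma>" for x y
    using symD[OF sym_trancl[OF sym]] that by (simp add: \<gamma>_def)
  have \<gamma>_right: "(a \<triangleright> b, a \<triangleright> b') \<in> \<gamma>" if a: "a \<in> carrier Q" and b: "(b, b') \<in> \<gamma>" for a b b'
    using b unfolding \<gamma>_def
  proof (induction rule: trancl_induct)
    case (base y)
    then have "(a \<triangleright> b, a \<triangleright> y) \<in> \<alpha> \<union> \<beta>" using A(2)[OF A(4)[OF a]] B(2)[OF B(4)[OF a]] by auto
    then show ?case by blast
  next
    case (step y z)
    then have "(a \<triangleright> y, a \<triangleright> z) \<in> \<alpha> \<union> \<beta>" using A(2)[OF A(4)[OF a]] B(2)[OF B(4)[OF a]] by auto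
    then show ?case using step.IH by (rule trancl_into_trancl[rotated])
  qed
  have \<gamma>_left: "(b \<triangleright> a, b' \<triangleright> a) \<in> \<gamma>" if a: "a \<in> carrier Q" and b: "(b, b') \<in> \<gamma>" for a b b'
    using b unfolding \<gamma>_def
  proof (induction rule: trancl_induct)
    case (base y)
    then have "(b \<triangleright> a, y \<triangleright> a) \<in> \<alpha> \<union> \<beta>" using A(2)[OF _ A(4)[OF a]] B(2)[OF _ B(4)[OF a]] by auto
    then show ?case by blast
  next
    case (step y z)
    then have "(y \<triangleright> a, z \<triangleright> a) \<in> \<alpha> \<union> \<beta>" using A(2)[OF _ A(4)[OF a]] B(2)[OF _ B(4)[OF a]] by auto
    then show ?case using step.IH by (rule trancl_into_trancl[rotated])
  qed
  interpret R: finite_connected_quandle "quot \<alpha>" using quot_connected[OF \<alpha>(1)] .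
  have cR: "carrier (quot \<alpha>) = (\<lambda>x. \<alpha> `` {x}) ` carrier Q"
    by (auto simp: quot_def quotient_def)
  have card_R: "card (carrier (quot \<alpha>)) = 2 * p"
    using card_quotient[OF \<alpha>(1) x] \<alpha>(2)[OF x] card by (simp add: quot_def)
  define \<delta> where "\<delta> = (\<lambda>(x, y). (\<alpha> `` {x}, \<alpha> `` {y})) ` \<gamma>"
  have \<delta>I: "(\<alpha> `` {x}, \<alpha> `` {y}) \<in> \<delta>" if "(x, y) \<in> \<gamma>" for x y using that by (auto simp: \<delta>_def)
  have \<delta>E: "\<exists>x y. (x, y) \<in> \<gamma> \<and> U = \<alpha> `` {x} \<and> V = \<alpha> `` {y}" if "(U, V) \<in> \<delta>" for U V
    using that by (auto simp: \<delta>_def)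
  have cls: "(x, y) \<in> \<gamma>" if "\<alpha> `` {x} = \<alpha> `` {y}" "x \<in> carrier Q" "y \<in> carrier Q" for x y
    using that eq_equiv_class_iff[OF A(1)] \<gamma>I by blast
  have \<delta>D: "(x, y) \<in> \<gamma>" if xy: "(\<alpha> `` {x}, \<alpha> `` {y}) \<in> \<delta>" "x \<in> carrier Q" "y \<in> carrier Q" for x y
  proof -
    obtain v w where vw: "(v, w) \<in> \<gamma>" "\<alpha> `` {x} = \<alpha> `` {v}" "\<alpha> `` {y} = \<alpha> `` {w}"
      using \<delta>E[OF xy(1)] by blast
    have "(x, v) \<in> \<gamma>" using cls[OF vw(2) xy(2)] \<gamma>C[OF vw(1)] by blast
    moreover have "(w, y) \<in> \<gamma>" using cls[OF vw(3)[symmetric] _ xy(3)] \<gamma>C[OF vw(1)] by blast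
    ultimately show ?thesis using vw(1) \<gamma>_trans by blast
  qed
  have \<delta>: "R.congr \<delta>"
    unfolding R.congr_def
  proof (intro conjI allI impI equivI refl_onI symI transI)
    show "\<delta> \<subseteq> carrier (quot \<alpha>) \<times> carrier (quot \<alpha>)"
    proof (intro subrelI SigmaI)
      fix U V assume "(U, V) \<in> \<delta>"
      from \<delta>E[OF this] show "U \<in> carrier (quot \<alpha>)" "V \<in> carrier (quot \<alpha>)"
        using \<gamma>C by (auto simp: cR)
    qed
  next
    fix U assume "U \<in> carrier (quot \<alpha>)"
    then show "(U, U) \<in> \<delta>" using A(4) \<gamma>I by (auto simp: cR intro!: \<delta>I)
  next
    fix U V assume "(U, V) \<in> \<delta>"
    from \<delta>E[OF this] obtain x y where xy: "(x, y) \<in> \<gamma>" "U = \<alpha> `` {x}" "V = \<alpha> `` {y}" by blast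
    show "(V, U) \<in> \<delta>" unfolding xy(2,3) by (rule \<delta>I[OF \<gamma>_sym[OF xy(1)]])
  next
    fix U V W assume UV: "(U, V) \<in> \<delta>" and VW: "(V, W) \<in> \<delta>"
    from \<delta>E[OF UV] obtain x y where xy: "(x, y) \<in> \<gamma>" "U = \<alpha> `` {x}" "V = \<alpha> `` {y}" by blast
    from \<delta>E[OF VW] obtain v w where vw: "(v, w) \<in> \<gamma>" "V = \<alpha> `` {v}" "W = \<alpha> `` {w}" by blast
    have "(y, w) \<in> \<gamma>" using \<delta>D[of y w] VW xy vw \<gamma>C by blast
    then show "(U, W) \<in> \<delta>" unfolding xy(2) vw(3) by (intro \<delta>I \<gamma>_trans[OF xy(1)])
  next
    fix U U' V V' assume U: "(U, U') \<in> \<delta>" and V: "(V, V') \<in> \<delta>"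
    from \<delta>E[OF U] obtain x y where xy: "(x, y) \<in> \<gamma>" "U = \<alpha> `` {x}" "U' = \<alpha> `` {y}" by blast
    from \<delta>E[OF V] obtain v w where vw: "(v, w) \<in> \<gamma>" "V = \<alpha> `` {v}" "V' = \<alpha> `` {w}" by blast
    have C: "x \<in> carrier Q" "y \<in> carrier Q" "v \<in> carrier Q" "w \<in> carrier Q"
      using \<gamma>C[OF xy(1)] \<gamma>C[OF vw(1)] by auto
    show "(U \<triangleright>\<^bsub>quot \<alpha>\<^esub> V, U' \<triangleright>\<^bsub>quot \<alpha>\<^esub> V') \<in> \<delta>"
      unfolding xy(2,3) vw(2,3) quot_op[OF \<alpha>(1) C(1,3)] quot_op[OF \<alpha>(1) C(2,4)]
      by (intro \<delta>I \<gamma>_trans[OF \<gamma>_left[OF C(3) xy(1)] \<gamma>_right[OF C(2) vw(1)]])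
  qed
  define X0 where "X0 = \<alpha> `` {x}"
  have X0: "X0 \<in> carrier (quot \<alpha>)" using x by (auto simp: cR X0_def)
  let ?n = "card (carrier (quot \<alpha>) // \<delta>)" and ?m = "card (\<delta> `` {X0})"
  have nm: "?n * ?m = 2 * p" using R.card_quotient[OF \<delta> X0] card_R by simp
  have "4 * p = ?n * (?m * 2)" using nm by (simp add: mult.assoc[symmetric])
  then have "?n dvd 4 * p" by (rule dvdI)
  then have "?n \<in> {1, 2, 4, p, 2 * p, 4 * p}" by (rule divisors_4_prime[OF p(1)])
  moreover have "?n \<noteq> 2" by (rule R.quotient_card_ne_2[OF \<delta>])
  moreover have "?n \<noteq> p" using R.no_connected_cover_of_degree_2[OF p \<delta> _ card_R] by blast
  moreover have "?n \<noteq> 4"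
  proof
    assume "?n = 4"
    then have "p = 2 * ?m" using nm by simp
    then have "2 dvd p" by (rule dvdI)
    then show False using primes_dvd_imp_eq[OF two_is_prime_nat p(1)] p(2) by simp
  qed
  moreover have "?m \<noteq> 0" using nm p(2) by (metis mult_0_right mult_eq_0_iff not_numeral_le_zero zero_neq_numeral)
  then have "?n \<noteq> 4 * p" using nm p(2) by (cases ?m) auto
  moreover have "?n \<noteq> 2 * p"
  proof
    \<comment> \<open>Then \<delta> is equality, which puts \<beta> inside \<alpha>, although the
      two meet trivially.\<close>
    assume "?n = 2 * p"
    then have "?m = 1" using nm p(2) by simp
    then have Id: "\<delta> = Id_on (carrier (quot \<alpha>))" using R.card_class_gt_1[OF \<delta> _ X0] by auto
    have xt: "(x, t x) \<in> \<beta>" using t(1)[OF x] by blast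
    then have "(\<alpha> `` {x}, \<alpha> `` {t x}) \<in> \<delta>" by (intro \<delta>I \<gamma>I) simp
    then have "\<alpha> `` {x} = \<alpha> `` {t x}" using Id by auto
    then have "(x, t x) \<in> \<alpha>" using eq_equiv_class_iff[OF A(1) x] B(3)[OF xt] by blast
    then show False using disj[OF _ xt] t(2)[OF x] by simp
  qed
  ultimately have "?n = 1" by simp
  then have m: "?m = card (carrier (quot \<alpha>))" using nm card_R by simp
  have full: "(y, z) \<in> \<gamma>" if yz: "y \<in> carrier Q" "z \<in> carrier Q" for y z
    using \<delta>D[OF R.class_card_full[OF \<delta> X0 m] yz] yz by (simp add: cR)
  have "a \<triangleright> z = z" if a: "a \<in> carrier Q" and z: "z \<in> carrier Q" for a z
    using full[OF a z] unfolding \<gamma>_def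
  proof (induction rule: trancl_induct)
    case (base y)
    then have "y \<in> carrier Q" "y = a \<or> y = s a \<or> y = t a" using sub s(1)[OF a] t(1)[OF a] by auto
    then show ?case
      using s(2)[OF L_lmult[OF a] a] t(3)[OF L_lmult[OF a] a] idem[OF a] a by (auto simp: L_apply)
  next
    case (step y z)
    then have "y \<in> carrier Q" "z \<in> carrier Q" using sub by auto
    moreover have "z = y \<or> z = s y \<or> z = t y"
      using s(1)[OF \<open>y \<in> carrier Q\<close>] t(1)[OF \<open>y \<in> carrier Q\<close>] step(2) by auto
    ultimately show ?case
      using s(2)[OF L_lmult[OF a], of y] t(3)[OF L_lmult[OF a], of y] step.IH by (auto simp: L_apply)
  qed
  then show False using singleton_not_closed[OF gt1 x] x by metis
qed

text \<open>The two quotient maps together are injective because the congruences meet trivially, and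
  onto because both sides have \<open>4 * p\<close> elements.\<close>

lemma product_of_quotients:
  assumes p: "Factorial_Ring.prime p" and card: "card (carrier Q) = 4 * p"
    and \<alpha>: "congr \<alpha>" "card (carrier Q // \<alpha>) = p" and \<beta>: "congr \<beta>" "card (carrier Q // \<beta>) = 4"
    and disj: "\<And>x y. (x, y) \<in> \<alpha> \<Longrightarrow> (x, y) \<in> \<beta> \<Longrightarrow> x = y"
  obtains u where "1 < u" "u < p"
    "quandle_isomorphic Q (quandle_prod (Aff Z2_squared omega) (Aff (integer_mod_group p) (zmul p u)))"
proof -
  have p0: "p > 0" using prime_gt_0_nat[OF p] .
  obtain u \<pi> where u: "1 < u" "u < p" and \<pi>: "aff_map (integer_mod_group p) (zmul p u) \<pi>"
    and ker\<pi>: "\<And>x y. (x, y) \<in> \<alpha> \<longleftrightarrow> x \<in> carrier Q \<and> y \<in> carrier Q \<and> \<pi> x = \<pi> y"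
    using prime_quotient[OF p \<alpha>] by metis
  obtain \<rho> where \<rho>: "aff_map Z2_squared omega \<rho>"
    and ker\<rho>: "\<And>x y. (x, y) \<in> \<beta> \<longleftrightarrow> x \<in> carrier Q \<and> y \<in> carrier Q \<and> \<rho> x = \<rho> y"
    using card_4_quotient[OF \<beta>] by metis
  let ?P = "quandle_prod (Aff Z2_squared omega) (Aff (integer_mod_group p) (zmul p u))"
  let ?h = "\<lambda>x. (\<rho> x, \<pi> x)"
  have inj: "inj_on ?h (carrier Q)" using ker\<pi> ker\<rho> disj by (auto intro!: inj_onI)
  have "carrier Z2_squared = {(0, 0), (1, 0), (0, 1), (1, 1)}" by (rule carrier_Z2_squared)
  then have c4: "card (carrier Z2_squared) = 4" "finite (carrier Z2_squared)"
    by (simp_all only:) simp_all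
  have cP: "card (carrier Z2_squared \<times> carrier (integer_mod_group p)) = 4 * p"
    using p0 unfolding card_cartesian_product c4(1) by (simp add: carrier_integer_mod_group)
  have sub: "?h ` carrier Q \<subseteq> carrier Z2_squared \<times> carrier (integer_mod_group p)"
    using \<pi> \<rho> unfolding aff_map_def by blast
  have fin: "finite (carrier Z2_squared \<times> carrier (integer_mod_group p))"
    using c4(2) p0 by (intro finite_cartesian_product) (auto simp: carrier_integer_mod_group)
  have "?h ` carrier Q = carrier Z2_squared \<times> carrier (integer_mod_group p)"
    by (rule card_subset_eq[OF fin sub]) (simp only: card_image[OF inj] cP card)
  then have "bij_betw ?h (carrier Q) (carrier ?P)"
    using inj by (simp only: bij_betw_def quandle_prod_simps Aff_simps)
  moreover have "?h (a \<triangleright> b) = ?h a \<triangleright>\<^bsub>?P\<^esub> ?h b" if "a \<in> carrier Q" "b \<in> carrier Q" for a b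
    using \<pi> \<rho> that by (simp add: aff_map_def del: Aff_simps)
  ultimately have "?h \<in> quandle_iso Q ?P" unfolding quandle_iso_def by blast
  then show ?thesis using that[OF u] unfolding quandle_isomorphic_def by blast
qed

theorem subdirectly_reducible_4p:
  assumes p: "Factorial_Ring.prime p" "p > 5" and card: "card (carrier Q) = 4 * p"
    and red: "subdirectly_reducible Q"
  obtains u where "1 < u" "u < p"
    "quandle_isomorphic Q (quandle_prod (Aff Z2_squared omega) (Aff (integer_mod_group p) (zmul p u)))"
proof -
  have gt1: "card (carrier Q) > 1" using card p(2) by simp
  then obtain x where x: "x \<in> carrier Q" by fastforce
  obtain \<alpha> \<beta> where \<alpha>: "congr \<alpha>" "\<alpha> \<noteq> Id_on (carrier Q)" and \<beta>: "congr \<beta>" "\<beta> \<noteq> Id_on (carrier Q)"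
    and disj: "\<And>x y. (x, y) \<in> \<alpha> \<Longrightarrow> (x, y) \<in> \<beta> \<Longrightarrow> x = y"
  proof (rule subdirectly_reducible_congruences[OF red gt1], goal_cases)
    case (1 \<alpha> \<beta>)
    from 1(2,4,3,5,6) show ?case by (rule 1(1))
  qed
  have odd: "p \<noteq> 2 * m" for m
  proof
    assume "p = 2 * m"
    then have "2 dvd p" by (rule dvdI)
    then show False using primes_dvd_imp_eq[OF two_is_prime_nat p(1)] p(2) by simp
  qed
  \<comment> \<open>A full class makes the companion congruence trivial, and class size
    \<open>2 * p\<close> leaves a quotient of size 2, which is not connected.\<close>
  have size: "card (r `` {x}) \<in> {2, 4, p}"
    if r: "congr r" "r \<noteq> Id_on (carrier Q)" "congr r'" "r' \<noteq> Id_on (carrier Q)"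
      "\<And>x y. (x, y) \<in> r \<Longrightarrow> (x, y) \<in> r' \<Longrightarrow> x = y" for r r'
  proof -
    have nk: "card (carrier Q // r) * card (r `` {x}) = 4 * p" using card_quotient[OF r(1) x] card by simp
    then have "card (r `` {x}) dvd 4 * p" by (metis dvd_triv_right)
    then have "card (r `` {x}) \<in> {1, 2, 4, p, 2 * p, 4 * p}" by (rule divisors_4_prime[OF p(1)])
    moreover have "card (r `` {x}) \<noteq> 1" using card_class_gt_1[OF r(1,2) x] by simp
    moreover have "card (r `` {x}) \<noteq> 2 * p" using nk quotient_card_ne_2[OF r(1)] p(2) by auto
    moreover have "card (r `` {x}) \<noteq> 4 * p"
    proof
      assume "card (r `` {x}) = 4 * p"
      then have "(y, z) \<in> r" if "y \<in> carrier Q" "z \<in> carrier Q" for y z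
        using class_card_full[OF r(1) x _ that] card by simp
      then have "y = z" if "(y, z) \<in> r'" for y z using r(5) that congrD(3)[OF r(3) that] by blast
      then have "r' \<subseteq> Id_on (carrier Q)" using congrD(3)[OF r(3)] by (auto simp: Id_on_iff)
      moreover have "Id_on (carrier Q) \<subseteq> r'" using congrD(4)[OF r(3)] by auto
      ultimately show False using r(4) by blast
    qed
    ultimately show ?thesis by auto
  qed
  note s\<alpha> = size[OF \<alpha> \<beta> disj] and s\<beta> = size[OF \<beta> \<alpha> disj[rotated]]
  have n: "card (carrier Q // r) * card (r `` {x}) = 4 * p" if "congr r" for r
    using card_quotient[OF that x] card by simp
  \<comment> \<open>As soon as \<open>r'\<close> has class size 4 or \<open>p\<close>, its quotient
    is affine, so the two congruences permute and their class sizes multiply to a divisor of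
    \<open>4 * p\<close>.\<close>
  have mixed: "card (r `` {x}) = p \<and> card (r' `` {x}) = 4 \<or> card (r `` {x}) = 4 \<and> card (r' `` {x}) = p"
    if r: "congr r" "card (r `` {x}) \<in> {2, 4, p}" and r': "congr r'" "card (r' `` {x}) \<in> {4, p}"
      and d: "\<And>x y. (x, y) \<in> r \<Longrightarrow> (x, y) \<in> r' \<Longrightarrow> x = y" for r r'
  proof -
    have "card (carrier Q // r') = p \<or> card (carrier Q // r') = 4"
      using n[OF r'(1)] r'(2) p(2) by auto
    then have "semiregular_on r'"
    proof
      assume *: "card (carrier Q // r') = p"
      show ?thesis using prime_quotient[OF p(1) r'(1) *] aff_map_semiregular by metis
    next
      assume *: "card (carrier Q // r') = 4"
      show ?thesis using card_4_quotient[OF r'(1) *] aff_map_semiregular by metis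
    qed
    then obtain \<theta> where \<theta>: "congr \<theta>"
      "\<And>x. x \<in> carrier Q \<Longrightarrow> card (\<theta> `` {x}) = card (r `` {x}) * card (r' `` {x})"
      using permuting_congruences[OF r(1) r'(1) _ d] by metis
    have 1: "card (carrier Q // \<theta>) * (card (r `` {x}) * card (r' `` {x})) = 4 * p"
      using n[OF \<theta>(1)] \<theta>(2)[OF x] by simp
    have 2: "card (carrier Q // \<theta>) \<noteq> 2" using quotient_card_ne_2[OF \<theta>(1)] .
    show ?thesis
    proof (cases "card (r' `` {x}) = 4")
      case True
      then have "p = card (carrier Q // \<theta>) * card (r `` {x})" using 1 by simp
      then show ?thesis
        using r(2) True odd[of "card (carrier Q // \<theta>)"] odd[of "2 * card (carrier Q // \<theta>)"] by auto
    next
      case False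
      then have *: "card (r' `` {x}) = p" using r'(2) by simp
      then have "card (carrier Q // \<theta>) * card (r `` {x}) = 4" using 1 p(2) by simp
      \<comment> \<open>The factorizations of 4 leave class size 4: the value 2 would give a
        quotient of size 2, and \<open>p\<close> is too large.\<close>
      moreover from this have "card (r `` {x}) \<le> 4" by (metis dvd_imp_le dvd_triv_right zero_less_numeral)
      ultimately show ?thesis using * r(2) 2 p(2) by auto
    qed
  qed
  have "card (\<alpha> `` {x}) = p \<and> card (\<beta> `` {x}) = 4 \<or> card (\<alpha> `` {x}) = 4 \<and> card (\<beta> `` {x}) = p"
  proof (cases "card (\<beta> `` {x}) = 2")
    case False
    then show ?thesis using mixed[OF \<alpha>(1) s\<alpha> \<beta>(1) _ disj] s\<beta> by auto
  next
    case True
    show ?thesis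
    proof (cases "card (\<alpha> `` {x}) = 2")
      case False
      then show ?thesis using mixed[OF \<beta>(1) s\<beta> \<alpha>(1) _ disj[rotated]] s\<alpha> by auto
    next
      case False': True
      have "p \<ge> 5" using p(2) by simp
      from no_disjoint_swaps[OF p(1) this card \<alpha>(1) _ \<beta>(1) _ disj]
      show ?thesis
        using class_card[OF \<alpha>(1) _ x] class_card[OF \<beta>(1) _ x] True False' by simp
    qed
  qed
  then show ?thesis
  proof
    assume *: "card (\<alpha> `` {x}) = p \<and> card (\<beta> `` {x}) = 4"
    then have "card (carrier Q // \<beta>) = p" "card (carrier Q // \<alpha>) = 4"
      using n[OF \<alpha>(1)] n[OF \<beta>(1)] p(2) by auto
    then show ?thesis
      using product_of_quotients[OF p(1) card \<beta>(1) _ \<alpha>(1) _ disj[rotated]] that by metis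
  next
    assume *: "card (\<alpha> `` {x}) = 4 \<and> card (\<beta> `` {x}) = p"
    then have "card (carrier Q // \<alpha>) = p" "card (carrier Q // \<beta>) = 4"
      using n[OF \<alpha>(1)] n[OF \<beta>(1)] p(2) by auto
    then show ?thesis
      using product_of_quotients[OF p(1) card \<alpha>(1) _ \<beta>(1) _ disj] that by metis
  qed
qed

end

section \<open>Products of affine quandles\<close>

lemma mod_affine:
  fixes x y u n :: int
  shows "(x + u * (y mod n - x)) mod n = (x + u * (y - x)) mod n"
    and "(x mod n + u * (y - x mod n)) mod n = (x + u * (y - x)) mod n"
proof -
  have "n dvd y mod n - y" "n dvd x mod n - x"
    unfolding minus_div_mult_eq_mod[symmetric] by simp_all
  then have "n dvd u * (y mod n - y)" "n dvd (1 - u) * (x mod n - x)" by simp_all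
  then show "(x + u * (y mod n - x)) mod n = (x + u * (y - x)) mod n"
    "(x mod n + u * (y - x mod n)) mod n = (x + u * (y - x)) mod n"
    unfolding mod_eq_dvd_iff by (simp_all add: algebra_simps)
qed

locale prime_Aff =
  fixes p u :: nat
  assumes p: "Factorial_Ring.prime p" and u: "1 < u" "u < p"
begin

lemma p_pos: "p > 0" using prime_gt_0_nat[OF p] .

lemma not_dvd: "\<not> int p dvd int u" "\<not> int p dvd 1 - int u"
proof -
  have "\<not> int p dvd int u - 1" "\<not> int p dvd int u" 
    using zdvd_not_zless[of "int u - 1" "int p"] zdvd_not_zless[of "int u" "int p"] u by simp_all
  then show "\<not> int p dvd int u" "\<not> int p dvd 1 - int u" by (simp_all add: dvd_diff_commute)
qed

abbreviation P where "P \<equiv> Aff (integer_mod_group p) (zmul p u)"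

lemma carrier_P: "carrier P = {0..<int p}"
  using p_pos by (simp add: carrier_integer_mod_group)

lemma op_P: "x \<in> {0..<int p} \<Longrightarrow> y \<in> {0..<int p} \<Longrightarrow> x \<triangleright>\<^bsub>P\<^esub> y = (x + int u * (y - x)) mod int p"
  using p_pos by (intro Aff_zmul) (simp_all add: carrier_integer_mod_group)

lemma zmul_inj: "inj_on (\<lambda>y. (x + int u * (y - x)) mod int p) {0..<int p}"
proof (rule inj_onI)
  fix y z assume yz: "y \<in> {0..<int p}" "z \<in> {0..<int p}"
    and eq: "(x + int u * (y - x)) mod int p = (x + int u * (z - x)) mod int p"
  have "int p dvd int u * (y - z)" using eq unfolding mod_eq_dvd_iff by (simp add: algebra_simps)
  moreover have "Factorial_Ring.prime (int p)" using p by simp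
  ultimately have "int p dvd y - z" using not_dvd(1) prime_dvd_multD by blast
  then show "y = z" using yz by (simp add: mod_eq_dvd_iff[symmetric])
qed

lemma zmul_bij: "bij_betw (\<lambda>y. (x + int u * (y - x)) mod int p) {0..<int p} {0..<int p}"
  using zmul_inj p_pos by (intro bij_betw_imageI endo_inj_surj) auto

lemma quandle_P: "quandle P"
proof
  fix a assume a: "a \<in> carrier P"
  have "bij_betw (\<lambda>b. a \<triangleright>\<^bsub>P\<^esub> b) {0..<int p} {0..<int p}
      \<longleftrightarrow> bij_betw (\<lambda>y. (a + int u * (y - a)) mod int p) {0..<int p} {0..<int p}"
    using a op_P unfolding carrier_P by (intro bij_betw_cong) blast
  then show "bij_betw (\<lambda>b. a \<triangleright>\<^bsub>P\<^esub> b) (carrier P) (carrier P)"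
    unfolding carrier_P using zmul_bij by blast
  show "a \<triangleright>\<^bsub>P\<^esub> a = a" using a unfolding carrier_P by (subst op_P) auto
next
  fix a b c assume "a \<in> carrier P" "b \<in> carrier P" "c \<in> carrier P"
  then have abc: "a \<in> {0..<int p}" "b \<in> {0..<int p}" "c \<in> {0..<int p}" unfolding carrier_P .
  have m: "x mod int p \<in> {0..<int p}" for x using p_pos by simp
  show "a \<triangleright>\<^bsub>P\<^esub> (b \<triangleright>\<^bsub>P\<^esub> c) = (a \<triangleright>\<^bsub>P\<^esub> b) \<triangleright>\<^bsub>P\<^esub> (a \<triangleright>\<^bsub>P\<^esub> c)"
    unfolding op_P[OF abc(2,3)] op_P[OF abc(1,2)] op_P[OF abc(1,3)] op_P[OF abc(1) m] op_P[OF m m] mod_affine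
    by (rule arg_cong[of _ _ "\<lambda>x. x mod int p"]) (simp add: algebra_simps)
qed

text \<open>Solving for \<open>c\<close> is division by \<open>1 - u\<close>. Since any two points
  are joined by one left translation, connectedness of the product is immediate.\<close>

lemma latin_P:
  assumes "a \<in> carrier P" "b \<in> carrier P"
  shows "\<exists>c\<in>carrier P. c \<triangleright>\<^bsub>P\<^esub> a = b"
proof -
  obtain i where i: "int p dvd int u * a + int i * (1 - int u) - b"
    using prime_translation_covers[OF p not_dvd(2)] by blast
  let ?c = "int i mod int p"
  have c: "?c \<in> {0..<int p}" using p_pos by simp
  have ab: "a \<in> {0..<int p}" "b \<in> {0..<int p}" using assms unfolding carrier_P .
  have "?c \<triangleright>\<^bsub>P\<^esub> a = (int i + int u * (a - int i)) mod int p"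
    unfolding op_P[OF c ab(1)] mod_affine ..
  also have "\<dots> = b mod int p" using i unfolding mod_eq_dvd_iff by (simp add: algebra_simps)
  also have "\<dots> = b" using ab(2) by simp
  finally show ?thesis using c unfolding carrier_P by blast
qed

lemma zmul_AutoGroup: "zmul p u \<in> carrier (AutoGroup (integer_mod_group p))"
proof -
  have car: "carrier (integer_mod_group p) = {0..<int p}" using carrier_P by simp
  have "bij_betw (zmul p u) {0..<int p} {0..<int p}
      \<longleftrightarrow> bij_betw (\<lambda>y. (0 + int u * (y - 0)) mod int p) {0..<int p} {0..<int p}"
    by (intro bij_betw_cong) (simp add: zmul_def car)
  then have "bij_betw (zmul p u) {0..<int p} {0..<int p}" using zmul_bij by blast
  then show ?thesis
    using zmul_hom[of p u] by (simp add: AutoGroup_def auto_def Bij_def car zmul_def)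
qed

end

lemma omega_bij: "bij_betw omega (carrier Z2_squared) (carrier Z2_squared)"
  unfolding carrier_Z2_squared by (auto simp: bij_betw_def inj_on_def omega_def carrier_Z2_squared)

lemma omega_AutoGroup: "omega \<in> carrier (AutoGroup Z2_squared)"
proof -
  have "omega \<in> extensional (carrier Z2_squared)" unfolding omega_def by (rule restrict_extensional)
  then show ?thesis using omega_hom omega_bij by (simp add: AutoGroup_def auto_def Bij_def)
qed

lemma ord_omega: "group.ord (AutoGroup Z2_squared) omega = 3"
proof -
  interpret Z: group Z2_squared using comm_group_Z2_squared by (simp add: comm_group_def)
  interpret A: group "AutoGroup Z2_squared" by (rule Z.AutoGroup)
  have \<omega>: "omega \<in> carrier (AutoGroup Z2_squared)" by (rule omega_AutoGroup)
  have mult: "f \<otimes>\<^bsub>AutoGroup Z2_squared\<^esub> g = compose (carrier Z2_squared) f g"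
    if "f \<in> carrier (AutoGroup Z2_squared)" "g \<in> carrier (AutoGroup Z2_squared)" for f g
    using that by (simp add: AutoGroup_def BijGroup_def auto_def)
  have "omega [^]\<^bsub>AutoGroup Z2_squared\<^esub> (3::nat)
      = omega \<otimes>\<^bsub>AutoGroup Z2_squared\<^esub> omega \<otimes>\<^bsub>AutoGroup Z2_squared\<^esub> omega"
    using \<omega> by (simp add: numeral_3_eq_3)
  also have "\<dots> = compose (carrier Z2_squared) (compose (carrier Z2_squared) omega omega) omega"
    using mult[OF \<omega> \<omega>] mult[OF A.m_closed[OF \<omega> \<omega>] \<omega>] by simp
  also have "\<dots> = (\<lambda>x\<in>carrier Z2_squared. x)"
    unfolding carrier_Z2_squared
    by (rule ext) (auto simp: compose_def omega_def carrier_Z2_squared)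
  also have "\<dots> = \<one>\<^bsub>AutoGroup Z2_squared\<^esub>" by (simp add: AutoGroup_def BijGroup_def)
  finally have "A.ord omega dvd 3" using A.pow_eq_id[OF \<omega>] by blast
  moreover have "A.ord omega \<noteq> 1"
  proof
    assume "A.ord omega = 1"
    then have "omega = \<one>\<^bsub>AutoGroup Z2_squared\<^esub>"
      using A.pow_eq_id[OF \<omega>, of 1] A.nat_pow_eone[OF \<omega>] by simp
    then have "omega = (\<lambda>x\<in>carrier Z2_squared. x)" by (simp add: AutoGroup_def BijGroup_def)
    moreover have m: "(1, 0) \<in> carrier Z2_squared" unfolding carrier_Z2_squared by simp
    ultimately have "omega (1, 0) = (1, 0)" by (metis restrict_apply')
    then show False using m by (simp only: omega_def restrict_apply' fst_conv snd_conv) simp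
  qed
  moreover have "Factorial_Ring.prime (3::nat)" by simp
  ultimately show ?thesis using prime_nat_iff by blast
qed

lemma quandle_Aff_omega: "quandle (Aff Z2_squared omega)"
proof
  note fin = carrier_Z2_squared
  fix a assume a: "a \<in> carrier (Aff Z2_squared omega)"
  let ?f = "\<lambda>b. a \<triangleright>\<^bsub>Aff Z2_squared omega\<^esub> b"
  let ?g = "\<lambda>y. ((fst a + snd a + snd y) mod 2, (fst a + fst y + snd y) mod 2)"
  have "bij_betw ?f (carrier Z2_squared) (carrier Z2_squared)
      \<longleftrightarrow> bij_betw ?g (carrier Z2_squared) (carrier Z2_squared)"
    using a by (intro bij_betw_cong Aff_omega) (simp_all only: Aff_simps)
  moreover have "bij_betw ?g (carrier Z2_squared) (carrier Z2_squared)"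
    using a unfolding Aff_simps carrier_Z2_squared
    by (elim insertE emptyE) (auto simp: bij_betw_def inj_on_def)
  ultimately show "bij_betw ?f (carrier (Aff Z2_squared omega)) (carrier (Aff Z2_squared omega))"
    by (simp only: Aff_simps)
  show "a \<triangleright>\<^bsub>Aff Z2_squared omega\<^esub> a = a"
    using a Aff_omega[of a a] unfolding Aff_simps(1) carrier_Z2_squared
    by (elim insertE emptyE) simp_all
next
  fix a b c assume "a \<in> carrier (Aff Z2_squared omega)" "b \<in> carrier (Aff Z2_squared omega)"
    "c \<in> carrier (Aff Z2_squared omega)"
  then have abc: "a \<in> carrier Z2_squared" "b \<in> carrier Z2_squared" "c \<in> carrier Z2_squared"
    unfolding Aff_simps by blast+
  have m: "(x mod 2, y mod 2) \<in> carrier Z2_squared" for x y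
    unfolding carrier_Z2_squared by auto
  show "a \<triangleright>\<^bsub>Aff Z2_squared omega\<^esub> (b \<triangleright>\<^bsub>Aff Z2_squared omega\<^esub> c)
      = (a \<triangleright>\<^bsub>Aff Z2_squared omega\<^esub> b) \<triangleright>\<^bsub>Aff Z2_squared omega\<^esub> (a \<triangleright>\<^bsub>Aff Z2_squared omega\<^esub> c)"
    unfolding Aff_omega[OF abc(2,3)] Aff_omega[OF abc(1,2)] Aff_omega[OF abc(1,3)]
      Aff_omega[OF abc(1) m] Aff_omega[OF m m]
    unfolding fst_conv snd_conv prod.inject mod_eq_dvd_iff
    by (intro conjI; simp; argo)
qed

lemma latin_Aff_omega:
  assumes "a \<in> carrier (Aff Z2_squared omega)" "b \<in> carrier (Aff Z2_squared omega)"
  shows "\<exists>c\<in>carrier (Aff Z2_squared omega). c \<triangleright>\<^bsub>Aff Z2_squared omega\<^esub> a = b"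
proof -
  have ab: "a \<in> carrier Z2_squared" "b \<in> carrier Z2_squared" using assms by (simp_all only: Aff_simps)
  \<comment> \<open>The equation reads \<open>(1 + omega) c = b + omega a\<close>; as
    \<open>1 + omega\<close> is the square of \<open>omega\<close> and \<open>omega\<close> has
    order 3, its solution is \<open>omega b + omega (omega a)\<close>.\<close>
  define c where "c = ((snd b + fst a + snd a) mod 2, (fst b + snd b + fst a) mod 2)"
  have c: "c \<in> carrier Z2_squared" unfolding c_def carrier_Z2_squared by auto
  have "c \<triangleright>\<^bsub>Aff Z2_squared omega\<^esub> a = b"
    unfolding Aff_omega[OF c ab(1)] using ab unfolding c_def carrier_Z2_squared
    by (elim insertE emptyE) simp_all
  then show ?thesis using c by (simp only: Aff_simps) blast
qed

lemma quandle_quandle_prod: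
  assumes Q: "quandle Q" and R: "quandle R"
  shows "quandle (quandle_prod Q R)"
proof
  interpret Q: quandle Q by fact
  interpret R: quandle R by fact
  fix a assume a: "a \<in> carrier (quandle_prod Q R)"
  have "bij_betw (map_prod (\<lambda>b. fst a \<triangleright>\<^bsub>Q\<^esub> b) (\<lambda>b. snd a \<triangleright>\<^bsub>R\<^esub> b))
      (carrier Q \<times> carrier R) (carrier Q \<times> carrier R)"
    using a by (intro bij_betw_map_prod Q.left_translation_bij R.left_translation_bij) auto
  then show "bij_betw (\<lambda>b. a \<triangleright>\<^bsub>quandle_prod Q R\<^esub> b) (carrier (quandle_prod Q R)) (carrier (quandle_prod Q R))"
    by (simp add: map_prod_def case_prod_beta')
  show "a \<triangleright>\<^bsub>quandle_prod Q R\<^esub> a = a" using a by (auto simp: Q.idem R.idem)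
next
  fix a b c assume "a \<in> carrier (quandle_prod Q R)" "b \<in> carrier (quandle_prod Q R)"
    "c \<in> carrier (quandle_prod Q R)"
  then have abc: "fst a \<in> carrier Q" "fst b \<in> carrier Q" "fst c \<in> carrier Q"
    "snd a \<in> carrier R" "snd b \<in> carrier R" "snd c \<in> carrier R" by auto
  then show "a \<triangleright>\<^bsub>quandle_prod Q R\<^esub> (b \<triangleright>\<^bsub>quandle_prod Q R\<^esub> c)
      = (a \<triangleright>\<^bsub>quandle_prod Q R\<^esub> b) \<triangleright>\<^bsub>quandle_prod Q R\<^esub> (a \<triangleright>\<^bsub>quandle_prod Q R\<^esub> c)"
    using quandle.left_distrib[OF Q abc(1,2,3)] quandle.left_distrib[OF R abc(4,5,6)]
    by (simp only: quandle_prod_simps fst_conv snd_conv)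
qed

lemma connected_iso:
  assumes Q: "connected_quandle Q" "finite (carrier Q)" and R: "quandle R" and iso: "quandle_isomorphic Q R"
  shows "connected_quandle R"
proof -
  interpret Q: finite_connected_quandle Q using finite_connected_quandleI[OF Q] .
  interpret R: quandle R by (rule R)
  obtain h where bij: "bij_betw h (carrier Q) (carrier R)"
    and hom: "\<And>a b. a \<in> carrier Q \<Longrightarrow> b \<in> carrier Q \<Longrightarrow> h (a \<triangleright>\<^bsub>Q\<^esub> b) = h a \<triangleright>\<^bsub>R\<^esub> h b"
    using iso unfolding quandle_isomorphic_def quandle_iso_def by blast
  have im: "h ` carrier Q = carrier R" using bij by (simp add: bij_betw_def)
  show ?thesis
  proof (rule R.connectedI)
    fix S assume S: "R.closed S" "S \<noteq> {}"
    then obtain y where y: "y \<in> S" by blast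
    have "y \<in> h ` carrier Q" using S(1) y unfolding R.closed_def im by (elim conjE) (rule subsetD)
    then obtain x where x: "x \<in> carrier Q" "h x = y" by auto
    have S_eq: "{x \<in> carrier Q. h x \<in> S} = carrier Q"
    proof (rule Q.eq_carrierI[of _ x])
      fix a z assume a: "a \<in> carrier Q" and z: "z \<in> {x \<in> carrier Q. h x \<in> S}"
      have "h a \<in> carrier R" using a im by blast
      then have "h a \<triangleright>\<^bsub>R\<^esub> h z \<in> S" using S(1) z unfolding R.closed_def by blast
      then show "a \<triangleright>\<^bsub>Q\<^esub> z \<in> {x \<in> carrier Q. h x \<in> S}" using a z hom Q.qop_closed by simp
    qed (use x y in auto)
    have "h x \<in> S" if "x \<in> carrier Q" for x
      using subsetD[OF equalityD2[OF S_eq] that] by simp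
    then have "carrier R \<subseteq> S" unfolding im[symmetric] by (rule image_subsetI)
    then show "S = carrier R" using S(1) unfolding R.closed_def by blast
  qed
qed

text \<open>The kernels of the two coordinate maps are nontrivial congruences that intersect in
  equality.\<close>

lemma (in finite_connected_quandle) iso_prod_imp_reducible:
  assumes iso: "quandle_isomorphic Q (quandle_prod R S)"
    and R: "r \<in> carrier R" "r' \<in> carrier R" "r \<noteq> r'" and S: "s \<in> carrier S" "s' \<in> carrier S" "s \<noteq> s'"
  shows "subdirectly_reducible Q"
proof -
  obtain h where bij: "bij_betw h (carrier Q) (carrier R \<times> carrier S)"
    and hom: "\<And>a b. a \<in> carrier Q \<Longrightarrow> b \<in> carrier Q \<Longrightarrow>
      h (a \<triangleright> b) = (fst (h a) \<triangleright>\<^bsub>R\<^esub> fst (h b), snd (h a) \<triangleright>\<^bsub>S\<^esub> snd (h b))"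
    using iso unfolding quandle_isomorphic_def quandle_iso_def by auto
  have im: "h ` carrier Q = carrier R \<times> carrier S" and inj: "inj_on h (carrier Q)"
    using bij by (simp_all add: bij_betw_def)
  let ?K = "\<lambda>k. {(x, y). x \<in> carrier Q \<and> y \<in> carrier Q \<and> k x = k y}"
  have cong: "quandle_congruence Q (?K k)"
    if "\<And>a b a' b'. a \<in> carrier Q \<Longrightarrow> b \<in> carrier Q \<Longrightarrow> a' \<in> carrier Q \<Longrightarrow> b' \<in> carrier Q \<Longrightarrow>
      k a = k a' \<Longrightarrow> k b = k b' \<Longrightarrow> k (a \<triangleright> b) = k (a' \<triangleright> b')" for k :: "'a \<Rightarrow> 'z"
    unfolding congr_iff[OF finite] congr_def
    using equiv_kernel[of "carrier Q" k] that qop_closed by auto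
  have "quandle_congruence Q (?K (\<lambda>x. fst (h x)))" "quandle_congruence Q (?K (\<lambda>x. snd (h x)))"
    by (auto intro!: cong simp: hom)
  moreover have "?K (\<lambda>x. fst (h x)) \<noteq> Id_on (carrier Q)"
  proof -
    obtain x y where "x \<in> carrier Q" "y \<in> carrier Q" "h x = (r, s)" "h y = (r, s')"
      using im R S by (metis (no_types, lifting) SigmaI imageE)
    then have "(x, y) \<in> ?K (\<lambda>x. fst (h x))" "(x, y) \<notin> Id_on (carrier Q)" using S(3) by auto
    then show ?thesis by blast
  qed
  moreover have "?K (\<lambda>x. snd (h x)) \<noteq> Id_on (carrier Q)"
  proof -
    obtain x y where "x \<in> carrier Q" "y \<in> carrier Q" "h x = (r, s)" "h y = (r', s)"
      using im R S by (metis (no_types, lifting) SigmaI imageE)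
    then have "(x, y) \<in> ?K (\<lambda>x. snd (h x))" "(x, y) \<notin> Id_on (carrier Q)" using R(3) by auto
    then show ?thesis by blast
  qed
  ultimately have "(carrier Q \<times> carrier Q) \<inter> \<Inter>{r. quandle_congruence Q r \<and> r \<noteq> Id_on (carrier Q)}
      \<subseteq> ?K (\<lambda>x. fst (h x)) \<inter> ?K (\<lambda>x. snd (h x))" by blast
  also have "\<dots> \<subseteq> Id_on (carrier Q)" using inj by (auto simp: inj_on_def prod_eq_iff)
  finally have "(carrier Q \<times> carrier Q) \<inter> \<Inter>{r. quandle_congruence Q r \<and> r \<noteq> Id_on (carrier Q)}
      \<subseteq> Id_on (carrier Q)" .
  moreover have "Id_on (carrier Q) \<subseteq> r" if "quandle_congruence Q r" for r
    using congrD(4)[OF quandle_congruence_imp_congr[OF that]] by auto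
  ultimately show ?thesis unfolding subdirectly_irreducible_def by blast
qed

text \<open>A chain records the iterates \<open>f i\<close> of \<open>L a \<circ> (L b)\<inverse>\<close> at \<open>b = f 0\<close>. In the product
  with multiplier \<open>u\<close> these are translates of \<open>b\<close>, and \<open>L b\<close> multiplies the even ones by \<open>u\<close>.\<close>

definition chain :: "('a, 'b) quandle_scheme \<Rightarrow> 'a \<Rightarrow> (nat \<Rightarrow> 'a) \<Rightarrow> (nat \<Rightarrow> 'a) \<Rightarrow> bool"
  where "chain Q a f g \<longleftrightarrow> a \<in> carrier Q \<and> (\<forall>i. f i \<in> carrier Q \<and> g i \<in> carrier Q
    \<and> f 0 \<triangleright>\<^bsub>Q\<^esub> g i = f i \<and> a \<triangleright>\<^bsub>Q\<^esub> g i = f (Suc i))"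

text \<open>An isomorphism invariant that recovers \<open>u\<close>. Doubled indices hide the factor
  of size 4: there a translation has period at most 2, so all even members of a chain agree with
  \<open>f 0\<close>, and only the factor of size \<open>p\<close> is seen.\<close>

definition chain_multiplier :: "('a, 'b) quandle_scheme \<Rightarrow> nat \<Rightarrow> bool"
  where "chain_multiplier Q k \<longleftrightarrow> (\<forall>a f g. chain Q a f g \<longrightarrow> f 0 \<triangleright>\<^bsub>Q\<^esub> f 2 = f (2 * k))"

lemma chain_multiplier_iso:
  assumes Q: "quandle Q" and iso: "quandle_isomorphic Q R" and k: "chain_multiplier R k"
  shows "chain_multiplier Q k"
  unfolding chain_multiplier_def
proof (intro allI impI)
  fix a f g assume c: "chain Q a f g"
  obtain h where bij: "bij_betw h (carrier Q) (carrier R)"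
    and hom: "\<And>a b. a \<in> carrier Q \<Longrightarrow> b \<in> carrier Q \<Longrightarrow> h (a \<triangleright>\<^bsub>Q\<^esub> b) = h a \<triangleright>\<^bsub>R\<^esub> h b"
    using iso unfolding quandle_isomorphic_def quandle_iso_def by blast
  have C: "a \<in> carrier Q" "\<And>i. f i \<in> carrier Q" "\<And>i. g i \<in> carrier Q"
    and eq: "\<And>i. f 0 \<triangleright>\<^bsub>Q\<^esub> g i = f i" "\<And>i. a \<triangleright>\<^bsub>Q\<^esub> g i = f (Suc i)"
    using c by (auto simp: chain_def)
  have "chain R (h a) (h \<circ> f) (h \<circ> g)"
    using C eq bij_betwE[OF bij] by (simp add: chain_def hom[symmetric])
  then have "h (f 0) \<triangleright>\<^bsub>R\<^esub> h (f 2) = h (f (2 * k))"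
    using k unfolding chain_multiplier_def by force
  then have "h (f 0 \<triangleright>\<^bsub>Q\<^esub> f 2) = h (f (2 * k))" using hom C(2) by simp
  then show "f 0 \<triangleright>\<^bsub>Q\<^esub> f 2 = f (2 * k)"
    using inj_onD[OF bij_betw_imp_inj_on[OF bij]] C(2) quandle.qop_closed[OF Q] by metis
qed

context prime_Aff
begin

definition PQ where "PQ = quandle_prod (Aff Z2_squared omega) P"

lemma carrier_PQ: "carrier PQ = carrier Z2_squared \<times> {0..<int p}"
  unfolding PQ_def quandle_prod_simps carrier_P by (simp only: Aff_simps)

lemma quandle_PQ: "quandle PQ"
  unfolding PQ_def by (intro quandle_quandle_prod quandle_Aff_omega quandle_P)

lemma card_PQ: "card (carrier PQ) = 4 * p"
  unfolding carrier_PQ card_cartesian_product carrier_Z2_squared by simp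

lemma connected_PQ: "connected_quandle PQ"
proof (rule quandle.connectedI[OF quandle_PQ])
  fix S assume S: "quandle.closed PQ S" "S \<noteq> {}"
  have SC: "S \<subseteq> carrier PQ" and cl: "\<And>a x. a \<in> carrier PQ \<Longrightarrow> x \<in> S \<Longrightarrow> a \<triangleright>\<^bsub>PQ\<^esub> x \<in> S"
    using S(1) unfolding quandle.closed_def[OF quandle_PQ] by blast+
  obtain x where x: "x \<in> S" using S(2) by blast
  have "b \<in> S" if b: "b \<in> carrier PQ" for b
  proof -
    have mem: "fst x \<in> carrier (Aff Z2_squared omega)" "fst b \<in> carrier (Aff Z2_squared omega)"
      "snd x \<in> carrier P" "snd b \<in> carrier P"
      using b x SC unfolding PQ_def quandle_prod_simps by (auto simp del: Aff_simps)
    obtain c where c: "c \<in> carrier (Aff Z2_squared omega)" "c \<triangleright>\<^bsub>Aff Z2_squared omega\<^esub> fst x = fst b"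
      using latin_Aff_omega[OF mem(1,2)] by blast
    obtain d where d: "d \<in> carrier P" "d \<triangleright>\<^bsub>P\<^esub> snd x = snd b"
      using latin_P[OF mem(3,4)] by blast
    have "(c, d) \<in> carrier PQ" using c(1) d(1) unfolding PQ_def quandle_prod_simps by blast
    then have "(c, d) \<triangleright>\<^bsub>PQ\<^esub> x \<in> S" using cl x by blast
    then show "b \<in> S" unfolding PQ_def quandle_prod_simps fst_conv snd_conv c(2) d(2) by simp
  qed
  then show "S = carrier PQ" using SC by blast
qed

lemma chain_multiplier_PQ: "chain_multiplier PQ u"
  unfolding chain_multiplier_def
proof (intro allI impI)
  fix a f g assume c: "chain PQ a f g"
  have mem: "fst a \<in> carrier Z2_squared" "fst (f i) \<in> carrier Z2_squared" "fst (g i) \<in> carrier Z2_squared"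
    "snd a \<in> {0..<int p}" "snd (f i) \<in> {0..<int p}" "snd (g i) \<in> {0..<int p}" for i
    using c unfolding chain_def carrier_PQ mem_Times_iff by blast+
  have eq1: "fst (f 0) \<triangleright>\<^bsub>Aff Z2_squared omega\<^esub> fst (g i) = fst (f i)"
    "fst a \<triangleright>\<^bsub>Aff Z2_squared omega\<^esub> fst (g i) = fst (f (Suc i))"
    and eq2: "snd (f 0) \<triangleright>\<^bsub>P\<^esub> snd (g i) = snd (f i)" "snd a \<triangleright>\<^bsub>P\<^esub> snd (g i) = snd (f (Suc i))" for i
    using c unfolding chain_def PQ_def quandle_prod_simps prod_eq_iff fst_conv snd_conv by blast+
  define F where "F i = snd (f i)" for i
  \<comment> \<open>The amount by which \<open>L a\<close> after the inverse of
    \<open>L (f 0)\<close> translates the second coordinate.\<close>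
  define d where "d = (1 - int u) * (snd a - F 0)"
  have dvd_mod: "int p dvd m - m mod int p" for m by (simp add: mod_eq_dvd_iff[symmetric])
  have "int p dvd F i - (F 0 + int i * d)" for i
  proof (induction i)
    case (Suc i)
    have e: "(F 0 + int u * (snd (g i) - F 0)) mod int p = F i"
      unfolding F_def op_P[OF mem(5,6), symmetric] by (rule eq2)
    have e': "(snd a + int u * (snd (g i) - snd a)) mod int p = F (Suc i)"
      unfolding F_def op_P[OF mem(4,6), symmetric] by (rule eq2)
    have 1: "int p dvd F 0 + int u * (snd (g i) - F 0) - F i"
      using dvd_mod[of "F 0 + int u * (snd (g i) - F 0)"] unfolding e .
    have 2: "int p dvd snd a + int u * (snd (g i) - snd a) - F (Suc i)"
      using dvd_mod[of "snd a + int u * (snd (g i) - snd a)"] unfolding e' .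
    have "F (Suc i) - (F 0 + int (Suc i) * d) = (F 0 + int u * (snd (g i) - F 0) - F i)
        - (snd a + int u * (snd (g i) - snd a) - F (Suc i)) + (F i - (F 0 + int i * d))"
      by (simp add: d_def algebra_simps)
    then show ?case using dvd_add[OF dvd_diff[OF 1 2] Suc] by (simp only:)
  qed simp
  from dvd_diff[OF dvd_mult[OF this[of 2], of "int u"] this[of "2 * u"]]
  have "int p dvd (F 0 + int u * (F 2 - F 0)) - F (2 * u)" by (simp add: algebra_simps)
  then have "(F 0 + int u * (F 2 - F 0)) mod int p = F (2 * u)"
    using mem(5)[of "2 * u"] by (simp add: mod_eq_dvd_iff[symmetric] F_def)
  then have "snd (f 0) \<triangleright>\<^bsub>P\<^esub> snd (f 2) = snd (f (2 * u))" using op_P mem by (simp add: F_def del: Aff_simps)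
  moreover have "fst (f (Suc (Suc i))) = fst (f i)" for i
  proof -
    have 1: "((fst (fst (f 0)) + snd (fst (f 0)) + snd (fst (g i))) mod 2,
        (fst (fst (f 0)) + fst (fst (g i)) + snd (fst (g i))) mod 2) = fst (f i)"
      "((fst (fst a) + snd (fst a) + snd (fst (g i))) mod 2,
        (fst (fst a) + fst (fst (g i)) + snd (fst (g i))) mod 2) = fst (f (Suc i))" for i
      using eq1[of i] Aff_omega mem by simp_all
    have 2: "fst (fst (f i)) = (fst (fst (f 0)) + snd (fst (f 0)) + snd (fst (g i))) mod 2"
      "snd (fst (f i)) = (fst (fst (f 0)) + fst (fst (g i)) + snd (fst (g i))) mod 2"
      "fst (fst (f (Suc i))) = (fst (fst a) + snd (fst a) + snd (fst (g i))) mod 2"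
      "snd (fst (f (Suc i))) = (fst (fst a) + fst (fst (g i)) + snd (fst (g i))) mod 2" for i
      using 1[of i] by (simp_all add: prod_eq_iff)
    have swap: "(x + v) mod 2 = (y + w) mod 2" if "(y + v) mod 2 = (x + w) mod 2" for v w x y :: int
      using that unfolding mod_eq_dvd_iff by simp argo
    have "fst (fst (f (Suc (Suc i)))) = fst (fst (f i))"
      unfolding 2(3)[of "Suc i"] 2(1)[of i]
      by (rule swap) (simp only: 2(3)[of i, symmetric] 2(1)[of "Suc i", symmetric])
    moreover have "snd (fst (f (Suc (Suc i)))) = snd (fst (f i))"
      unfolding 2(4)[of "Suc i"] 2(2)[of i] add.assoc
      by (rule swap) (simp only: add.assoc[symmetric] 2(4)[of i, symmetric] 2(2)[of "Suc i", symmetric])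
    ultimately show ?thesis by (rule prod_eqI)
  qed
  then have even: "fst (f (2 * i)) = fst (f 0)" for i by (induction i) simp_all
  have "fst (f 0) \<triangleright>\<^bsub>Aff Z2_squared omega\<^esub> fst (f 2) = fst (f (2 * u))"
    using even[of 1] even[of u] quandle.idem[OF quandle_Aff_omega, of "fst (f 0)"] mem(2)[of 0] by simp
  ultimately show "f 0 \<triangleright>\<^bsub>PQ\<^esub> f 2 = f (2 * u)"
    unfolding PQ_def quandle_prod_simps prod_eq_iff fst_conv snd_conv by blast
qed

text \<open>One chain with a nonzero step in the second coordinate determines the multiplier modulo
  \<open>p\<close>.\<close>

lemma chain_multiplier_PQ_unique:
  assumes k: "chain_multiplier PQ k" "k < p" and p2: "p > 2"
  shows "k = u"
proof -
  have z: "(0, 0) \<in> carrier Z2_squared" unfolding carrier_Z2_squared by simp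
  have z0: "(0, 0) \<triangleright>\<^bsub>Aff Z2_squared omega\<^esub> (0, 0) = (0, 0)"
    using Aff_omega[OF z z] by simp
  \<comment> \<open>The step of the chain based at 0 with \<open>a\<close> at \<open>u\<close>. This
    choice of \<open>a\<close> makes \<open>w\<close> a multiple of \<open>u\<close>, so
    \<open>g\<close> can be written down without an inverse of \<open>u\<close> modulo
    \<open>p\<close>.\<close>
  define w where "w = int u * (1 - int u)"
  define f where "f i = ((0, 0) :: int \<times> int, (int i * w) mod int p)" for i :: nat
  define g where "g i = ((0, 0) :: int \<times> int, (int i * (1 - int u)) mod int p)" for i :: nat
  have m: "x mod int p \<in> {0..<int p}" for x using p_pos by simp
  have 0: "(0 :: int) \<in> {0..<int p}" "int u \<in> {0..<int p}" using u by auto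
  have f0: "f 0 = ((0, 0), 0)" by (simp add: f_def)
  have "chain PQ ((0, 0), int u) f g"
    unfolding chain_def f0
  proof (intro conjI allI)
    fix i
    have "0 \<triangleright>\<^bsub>P\<^esub> ((int i * (1 - int u)) mod int p) = (int i * w) mod int p"
      unfolding op_P[OF 0(1) m] mod_affine by (simp add: w_def ac_simps)
    then show "((0, 0), 0) \<triangleright>\<^bsub>PQ\<^esub> g i = f i"
      unfolding PQ_def quandle_prod_simps f_def g_def fst_conv snd_conv z0 by simp
    have "int u \<triangleright>\<^bsub>P\<^esub> ((int i * (1 - int u)) mod int p) = (int (Suc i) * w) mod int p"
      unfolding op_P[OF 0(2) m] mod_affine
      by (rule arg_cong[of _ _ "\<lambda>x. x mod int p"]) (simp add: w_def algebra_simps)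
    then show "((0, 0), int u) \<triangleright>\<^bsub>PQ\<^esub> g i = f (Suc i)"
      unfolding PQ_def quandle_prod_simps f_def g_def fst_conv snd_conv z0 by simp
  qed (use z m 0 in \<open>auto simp: carrier_PQ f_def g_def\<close>)
  then have "f 0 \<triangleright>\<^bsub>PQ\<^esub> f 2 = f (2 * k)" using k(1) unfolding chain_multiplier_def by blast
  then have "0 \<triangleright>\<^bsub>P\<^esub> ((2 * w) mod int p) = (2 * int k * w) mod int p"
    unfolding PQ_def quandle_prod_simps f_def by (simp del: Aff_simps)
  then have "(int u * (2 * w)) mod int p = (2 * int k * w) mod int p"
    unfolding op_P[OF 0(1) m] mod_affine by simp
  then have "int p dvd (2 * (int u - int k)) * (int u * (1 - int u))"
    unfolding mod_eq_dvd_iff by (simp add: w_def algebra_simps)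
  moreover have pp: "Factorial_Ring.prime (int p)" using p by simp
  moreover have "\<not> int p dvd 2" using p2 by (intro zdvd_not_zless) auto
  ultimately have "int p dvd int u - int k" using not_dvd prime_dvd_multD[OF pp] by blast
  then show "k = u" using u k(2) by (simp add: mod_eq_dvd_iff[symmetric])
qed

lemma iso_PQ_imp_reducible:
  assumes "connected_quandle Q" "finite (carrier Q)" "quandle_isomorphic Q PQ"
  shows "subdirectly_reducible Q"
  using finite_connected_quandle.iso_prod_imp_reducible[OF finite_connected_quandleI[OF assms(1,2)]
      assms(3)[unfolded PQ_def], of "(0, 0)" "(1, 0)" 0 1] u
  by (simp add: carrier_Z2_squared carrier_integer_mod_group)

end

section \<open>Counting isomorphism classes\<close>

lemma quandle_isomorphic_card: "quandle_isomorphic Q R \<Longrightarrow> card (carrier Q) = card (carrier R)"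
  by (auto simp: quandle_isomorphic_def quandle_iso_def dest: bij_betw_same_card)

theorem card_isomorphism_classes_4p:
  assumes p: "Factorial_Ring.prime p" "p > 5"
  shows "card (isomorphism_classes
      {Q :: nat quandle. connected_quandle Q \<and> card (carrier Q) = 4 * p \<and>
        subdirectly_reducible Q}) = p - 2"
proof -
  define K where "K = {Q :: nat quandle. connected_quandle Q \<and> card (carrier Q) = 4 * p \<and> subdirectly_reducible Q}"
  define E where "E = {(Q, R). Q \<in> K \<and> R \<in> K \<and> quandle_isomorphic Q R}"
  have eqv: "equiv K E"
    unfolding E_def by (rule quandle_isomorphism_equiv) (auto simp: K_def connected_quandle_def)
  have E_iff: "(Q, R) \<in> E \<longleftrightarrow> Q \<in> K \<and> R \<in> K \<and> quandle_isomorphic Q R" for Q R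
    by (simp add: E_def)
  let ?P = "prime_Aff.PQ p"
  have PA: "prime_Aff p u" if "u \<in> {2..<p}" for u
    using that p by (intro prime_Aff.intro) auto
  have "\<exists>R :: nat quandle. quandle R \<and> quandle_isomorphic (?P u) R" if u: "u \<in> {2..<p}" for u
    using prime_Aff.quandle_PQ[OF PA[OF u]] prime_Aff.card_PQ[OF PA[OF u]] p(2)
    by (intro finite_quandle_nat_copy) (auto intro: card_ge_0_finite)
  \<comment> \<open>Copies of the products on natural numbers, since the classes are counted on that
    type. The multiplier \<open>u\<close> indexes them by \<open>{2..<p}\<close>, a set of
    \<open>p - 2\<close> elements.\<close>
  then obtain N :: "nat \<Rightarrow> nat quandle" where
    N: "\<And>u. u \<in> {2..<p} \<Longrightarrow> quandle (N u)" "\<And>u. u \<in> {2..<p} \<Longrightarrow> quandle_isomorphic (?P u) (N u)"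
    by metis
  have PN: "quandle_isomorphic (N u) (?P u)" if u: "u \<in> {2..<p}" for u
    using quandle_isomorphic_sym[OF prime_Aff.quandle_PQ[OF PA[OF u]] N(2)[OF u]] .
  have NK: "N u \<in> K" if u: "u \<in> {2..<p}" for u
  proof -
    note cP = prime_Aff.card_PQ[OF PA[OF u]]
    then have fin: "finite (carrier (?P u))" using p(2) by (auto intro: card_ge_0_finite)
    have con: "connected_quandle (N u)"
      using connected_iso[OF prime_Aff.connected_PQ[OF PA[OF u]] fin N(1)[OF u] N(2)[OF u]] .
    have card: "card (carrier (N u)) = 4 * p" using quandle_isomorphic_card[OF PN[OF u]] cP by simp
    then have "finite (carrier (N u))" using p(2) by (auto intro: card_ge_0_finite)
    then have "subdirectly_reducible (N u)"
      using prime_Aff.iso_PQ_imp_reducible[OF PA[OF u] con _ PN[OF u]] by blast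
    then show ?thesis using con card by (simp add: K_def)
  qed
  have "bij_betw (\<lambda>u. E `` {N u}) {2..<p} (K // E)"
  proof (rule bij_betw_imageI)
    show "inj_on (\<lambda>u. E `` {N u}) {2..<p}"
    proof (rule inj_onI)
      fix u v assume uv: "u \<in> {2..<p}" "v \<in> {2..<p}" and "E `` {N u} = E `` {N v}"
      then have "quandle_isomorphic (N v) (N u)"
        using eq_equiv_class_iff[OF eqv NK[OF uv(2)] NK[OF uv(1)]] by (simp add: E_iff)
      then have "quandle_isomorphic (?P v) (?P u)"
        using quandle_isomorphic_trans[OF N(2)[OF uv(2)] quandle_isomorphic_trans[OF _ PN[OF uv(1)]]] by simp
      then have "chain_multiplier (?P v) u"
        using chain_multiplier_iso[OF prime_Aff.quandle_PQ[OF PA[OF uv(2)]] _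
            prime_Aff.chain_multiplier_PQ[OF PA[OF uv(1)]]] by blast
      then show "u = v"
        using prime_Aff.chain_multiplier_PQ_unique[OF PA[OF uv(2)]] uv(1) p(2) by simp
    qed
    show "(\<lambda>u. E `` {N u}) ` {2..<p} = K // E"
    proof (intro equalityI subsetI)
      fix C assume "C \<in> (\<lambda>u. E `` {N u}) ` {2..<p}"
      then show "C \<in> K // E" using NK by (auto intro!: quotientI)
    next
      fix C assume "C \<in> K // E"
      then obtain R where R: "R \<in> K" "C = E `` {R}" by (rule quotientE)
      then have con: "connected_quandle R" and card: "card (carrier R) = 4 * p"
        and red: "subdirectly_reducible R" by (simp_all add: K_def)
      have "finite (carrier R)" using card p(2) by (auto intro: card_ge_0_finite)
      then interpret R: finite_connected_quandle R using finite_connected_quandleI[OF con] by blast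
      obtain u where u: "1 < u" "u < p" and iso: "quandle_isomorphic R
          (quandle_prod (Aff Z2_squared omega) (Aff (integer_mod_group p) (zmul p u)))"
        using R.subdirectly_reducible_4p[OF p card red] .
      have u2: "u \<in> {2..<p}" using u by simp
      have "quandle_isomorphic R (N u)"
        using quandle_isomorphic_trans[OF iso] N(2)[OF u2] unfolding prime_Aff.PQ_def[OF PA[OF u2]] by blast
      then have "C = E `` {N u}"
        using equiv_class_eq[OF eqv, of R "N u"] R NK[OF u2] by (simp add: E_iff)
      then show "C \<in> (\<lambda>u. E `` {N u}) ` {2..<p}" using u2 by blast
    qed
  qed
  then have "card (K // E) = card {2..<p}" by (metis bij_betw_same_card)
  then show ?thesis by (simp add: isomorphism_classes_def E_def K_def[symmetric])
qed

theorem proposition5p2: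
  fixes p :: nat
  assumes "Factorial_Ring.prime p" and "p > 5"
  shows "(\<forall>Q :: 'a quandle. connected_quandle Q \<and> card (carrier Q) = 4 * p \<longrightarrow>
      (subdirectly_reducible Q \<longleftrightarrow>
        (\<exists>f \<in> carrier (AutoGroup Z2_squared).
          \<exists>g \<in> carrier (AutoGroup (integer_mod_group p)).
            group.ord (AutoGroup Z2_squared) f = 3 \<and>
            quandle_isomorphic Q
              (quandle_prod (Aff Z2_squared f) (Aff (integer_mod_group p) g))))) \<and>
    card (isomorphism_classes
      {Q :: nat quandle. connected_quandle Q \<and> card (carrier Q) = 4 * p \<and>
        subdirectly_reducible Q}) = p - 2"
proof (intro conjI allI impI card_isomorphism_classes_4p[OF assms])
  fix Q :: "'a quandle" assume Q: "connected_quandle Q \<and> card (carrier Q) = 4 * p"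
  then have "finite (carrier Q)" using assms(2) by (auto intro: card_ge_0_finite)
  then interpret Q: finite_connected_quandle Q using finite_connected_quandleI Q by blast
  show "subdirectly_reducible Q \<longleftrightarrow>
        (\<exists>f \<in> carrier (AutoGroup Z2_squared).
          \<exists>g \<in> carrier (AutoGroup (integer_mod_group p)).
            group.ord (AutoGroup Z2_squared) f = 3 \<and>
            quandle_isomorphic Q
              (quandle_prod (Aff Z2_squared f) (Aff (integer_mod_group p) g)))" (is "_ \<longleftrightarrow> ?affine")
  proof
    assume red: "subdirectly_reducible Q"
    obtain u where u: "1 < u" "u < p" and iso: "quandle_isomorphic Q
        (quandle_prod (Aff Z2_squared omega) (Aff (integer_mod_group p) (zmul p u)))"
      using Q.subdirectly_reducible_4p[OF assms _ red] Q by blast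
    have "prime_Aff p u" using assms(1) u by (rule prime_Aff.intro)
    then show ?affine
      using iso omega_AutoGroup ord_omega prime_Aff.zmul_AutoGroup by blast
  next
    assume ?affine
    then obtain f g where iso: "quandle_isomorphic Q
        (quandle_prod (Aff Z2_squared f) (Aff (integer_mod_group p) g))"
      by blast
    show "subdirectly_reducible Q"
      \<comment> \<open>The witnesses are two distinct points in each factor, so both kernels are
        nontrivial.\<close>
      by (rule Q.iso_prod_imp_reducible[OF iso, of "(0, 0)" "(1, 0)" 0 1])
        (use assms(2) in \<open>simp_all add: carrier_Z2_squared carrier_integer_mod_group\<close>)
  qed
qed

end
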